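(* Let $A$ be a commutative ring. The canonical mapping from $\mathrm{Sperv}\,A[X]$ to $\mathrm{Sperv}\,A$ transforms any constructible subset into a constructible subset.
   Context: A real closed valued field is a real closed field together with a valuation ring, different from the field, which is convex for the order. In such a field, $x\preceq y$ means $v(x)\le v(y)$ where $v$ is the valuation ($v(0)=+\infty$). The real-valuative spectrum $\mathrm{Sperv}\,A$ of a commutative ring $A$: an element of $\mathrm{Sperv}\,A$ is given by a ring homomorphism $\varphi$ from $A$ to a real closed valued field $K$, and two such homomorphisms $\varphi,\varphi'$ define the same element of $\mathrm{Sperv}\,A$ iff there exists an isomorphism of ordered valued fields $\psi:R\to R'$ such that $\psi\circ\varphi=\varphi'$, where $R$ and $R'$ are the real closed valued fields generated by $\varphi(A)$ and $\varphi'(A)$ (inside the respective target fields, with the induced order and valuation). A constructible (also called $(\le,\preceq)$-constructible) subset of $\mathrm{Sperv}\,A$ is a boolean combination of elementary constructible subsets $U_x=\{\varphi\in\mathrm{Sperv}\,A:\varphi(x)>0\}$ and $V_{x,y}=\{\varphi\in\mathrm{Sperv}\,A:\varphi(x)\preceq\varphi(y)\}$, with $x,y\in A$. $A[X]$ is the polynomial ring in one variable; the canonical mapping is restriction of $\varphi$ from $A[X]$ to $A$. *)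

theory Defs
  imports "HOL-Algebra.UnivPoly" "HOL-Algebra.Subrings"
begin

record 'u ovring = "'u ring" +
  ole :: "'u \<Rightarrow> 'u \<Rightarrow> bool"
  vring :: "'u set"

locale real_closed_field = field K for K :: "'u ovring" (structure) +
  assumes ole_refl: "x \<in> carrier K \<Longrightarrow> ole K x x"
    and ole_antisym: "\<lbrakk>x \<in> carrier K; y \<in> carrier K; ole K x y; ole K y x\<rbrakk> \<Longrightarrow> x = y"
    and ole_trans: "\<lbrakk>x \<in> carrier K; y \<in> carrier K; z \<in> carrier K; ole K x y; ole K y z\<rbrakk>
      \<Longrightarrow> ole K x z"
    and ole_total: "\<lbrakk>x \<in> carrier K; y \<in> carrier K\<rbrakk> \<Longrightarrow> ole K x y \<or> ole K y x"
    and ole_add: "\<lbrakk>x \<in> carrier K; y \<in> carrier K; z \<in> carrier K; ole K x y\<rbrakk>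
      \<Longrightarrow> ole K (x \<oplus> z) (y \<oplus> z)"
    and ole_mult: "\<lbrakk>x \<in> carrier K; y \<in> carrier K; ole K \<zero> x; ole K \<zero> y\<rbrakk>
      \<Longrightarrow> ole K \<zero> (x \<otimes> y)"
    and nonneg_square: "\<lbrakk>x \<in> carrier K; ole K \<zero> x\<rbrakk> \<Longrightarrow> \<exists>y \<in> carrier K. y \<otimes> y = x"
    and odd_degree_root: "\<lbrakk>p \<in> carrier (UP K); odd (deg K p)\<rbrakk>
      \<Longrightarrow> \<exists>x \<in> carrier K. eval K K id x p = \<zero>"

locale real_closed_valued_field = real_closed_field K + subring "vring K" K
  for K :: "'u ovring" (structure) +
  assumes valuation_ring: "x \<in> carrier K - {\<zero>} \<Longrightarrow> x \<in> vring K \<or> inv x \<in> vring K"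
    and vring_proper: "vring K \<noteq> carrier K"
    and vring_convex: "\<lbrakk>x \<in> vring K; z \<in> vring K; y \<in> carrier K; ole K x y; ole K y z\<rbrakk>
      \<Longrightarrow> y \<in> vring K"

(* v x <= v y for the valuation v of the valuation ring: v 0 is infinite, and
   otherwise v y - v x = v (y / x), which is nonnegative iff y / x lies in the
   valuation ring.  Larger values correspond to smaller elements. *)
definition vle :: "'u ovring \<Rightarrow> 'u \<Rightarrow> 'u \<Rightarrow> bool" where
  "vle K x y \<longleftrightarrow> y = \<zero>\<^bsub>K\<^esub> \<or> x \<noteq> \<zero>\<^bsub>K\<^esub> \<and> y \<otimes>\<^bsub>K\<^esub> inv\<^bsub>K\<^esub> x \<in> vring K"

(* The smallest real closed subfield of K that contains B, with the induced order
   and valuation ring.  The latter may be trivial even if that of K is not, as for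
   the subfield generated by the empty set. *)
definition rc_generated :: "'u ovring \<Rightarrow> 'u set \<Rightarrow> 'u ovring" where
  "rc_generated K B =
    (let R = \<Inter>{L. subfield L K \<and> real_closed_field (K\<lparr>carrier := L\<rparr>) \<and> B \<subseteq> L}
     in K\<lparr>carrier := R, vring := vring K \<inter> R\<rparr>)"

definition ovfield_iso :: "'u ovring \<Rightarrow> 'u ovring \<Rightarrow> ('u \<Rightarrow> 'u) set" where
  "ovfield_iso R R' = {\<psi> \<in> ring_iso R R'.
     (\<forall>x \<in> carrier R. \<forall>y \<in> carrier R. ole R x y \<longleftrightarrow> ole R' (\<psi> x) (\<psi> y)) \<and>
     (\<forall>x \<in> carrier R. x \<in> vring R \<longleftrightarrow> \<psi> x \<in> vring R')}"

(* The target fields live on subsets of the type 'u, which acts as a universe: as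
   soon as it is infinite and has at least the cardinality of A, every point of
   the real-valuative spectrum has a representative in it. *)
type_synonym ('a, 'u) rcv_hom = "'u ovring \<times> ('a \<Rightarrow> 'u)"

definition rcv_homs :: "('a, 'm) ring_scheme \<Rightarrow> ('a, 'u) rcv_hom set" where
  "rcv_homs A = {(K, \<phi>). real_closed_valued_field K \<and> \<phi> \<in> ring_hom A K}"

definition rcv_equiv ::
  "('a, 'm) ring_scheme \<Rightarrow> (('a, 'u) rcv_hom \<times> ('a, 'u) rcv_hom) set" where
  "rcv_equiv A = {((K, \<phi>), (K', \<phi>')). (K, \<phi>) \<in> rcv_homs A \<and> (K', \<phi>') \<in> rcv_homs A \<and>
     (\<exists>\<psi> \<in> ovfield_iso (rc_generated K (\<phi> ` carrier A)) (rc_generated K' (\<phi>' ` carrier A)).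
        \<forall>a \<in> carrier A. \<psi> (\<phi> a) = \<phi>' a)}"

definition Sperv :: "('a, 'm) ring_scheme \<Rightarrow> ('a, 'u) rcv_hom set set" where
  "Sperv A = rcv_homs A // rcv_equiv A"

definition Sperv_pos :: "('a, 'm) ring_scheme \<Rightarrow> 'a \<Rightarrow> ('a, 'u) rcv_hom set set" where
  "Sperv_pos A x =
    {P \<in> Sperv A. \<exists>(K, \<phi>) \<in> P. ole K \<zero>\<^bsub>K\<^esub> (\<phi> x) \<and> \<phi> x \<noteq> \<zero>\<^bsub>K\<^esub>}"

definition Sperv_vle :: "('a, 'm) ring_scheme \<Rightarrow> 'a \<Rightarrow> 'a \<Rightarrow> ('a, 'u) rcv_hom set set" where
  "Sperv_vle A x y = {P \<in> Sperv A. \<exists>(K, \<phi>) \<in> P. vle K (\<phi> x) (\<phi> y)}"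

inductive_set constructible ::
  "('a, 'm) ring_scheme \<Rightarrow> ('a, 'u) rcv_hom set set set" for A where
  pos: "x \<in> carrier A \<Longrightarrow> Sperv_pos A x \<in> constructible A"
| vle: "\<lbrakk>x \<in> carrier A; y \<in> carrier A\<rbrakk> \<Longrightarrow> Sperv_vle A x y \<in> constructible A"
| compl: "S \<in> constructible A \<Longrightarrow> Sperv A - S \<in> constructible A"
| union: "\<lbrakk>S \<in> constructible A; T \<in> constructible A\<rbrakk> \<Longrightarrow> S \<union> T \<in> constructible A"

(* The class of the restriction to A of a representative on the polynomial ring;
   all representatives give the same class. *)
definition Sperv_restrict ::
  "('a, 'm) ring_scheme \<Rightarrow> (nat \<Rightarrow> 'a, 'u) rcv_hom set \<Rightarrow> ('a, 'u) rcv_hom set" where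
  "Sperv_restrict A P =
    (\<Union>(K, \<phi>) \<in> P. rcv_equiv A `` {(K, \<lambda>a. \<phi> (monom (UP A) a 0))})"

end

theory Submission
  imports Defs "HOL-Algebra.Algebraic_Closure_Type"
begin

text \<open>The theorem is quantifier elimination for real closed valued fields: a point over the given point
  \<open>(K, \<phi>)\<close> is obtained by sending the indeterminate to some \<open>x\<close> in \<open>K\<close>, so the image of a
  constructible set is defined by an existential formula over the parameters \<open>\<phi> a\<close>.

  Order formulas are eliminated by sign tables that are closed under derivatives and pseudo-remainders.
  For formulas with valuation atoms, Taylor expansion around the roots of the derivatives shows that a
  solution can be moved to one of finitely many candidates, which are algebraic over the parameters and an
  element \<open>w\<close> outside the valuation ring. A valuation comparison at such a candidate can be read off
  an algebraic equation and becomes a comparison of parameters, which leaves an order formula. Finally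
  \<open>w\<close> is sent to infinity.

  Elimination also shows that a real closed subfield contains all roots in \<open>K\<close> of its polynomials, so
  real closed subfields are closed under intersection and isomorphisms of generated subfields restrict.\<close>

text \<open>One quantifier-free formula must be equivalent to the existential one in all real closed
  valued fields at once. Its truth is then the same for all representatives of a point, because
  equivalent homomorphisms agree on signs and valuation comparisons of elements of A, and a point
  below can be lifted inside its own target field K. The subfield generated by the image of A would
  not do: its valuation may be trivial, whereas a solution beyond all critical valuations needs an
  element w outside the valuation ring.

  Nor need the image of A contain such a w. The candidates work for every positive w outside the
  ring, so the truth value does not depend on w, and for large w it is decided by leading
  coefficients.

  The delicate point is a valuation comparison at a candidate, whose quotient y is only algebraic
  over the data. In a vanishing sum of terms a_i y^i two terms have the same valuation, so a
  multiple of v(y) is a difference v(a_i) - v(a_j), and its sign is a comparison of coefficients.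
  Which pair is concerned can be expressed by the order, since terms whose absolute values agree up
  to an integer factor have equal valuation.\<close>

hide_const (open) UnivPoly.coeff UnivPoly.monom UnivPoly.eval

section \<open>Real closed fields as a type class\<close>

class rcf = linordered_field +
  assumes rcf_square: "0 \<le> x \<Longrightarrow> \<exists>y. y * y = x"
    and rcf_odd_sum: "odd n \<Longrightarrow> f n \<noteq> 0 \<Longrightarrow> \<exists>x. (\<Sum>k\<le>n. f k * x ^ k) = 0"

lemma rcf_odd_root:
  fixes p :: "'k::rcf poly"
  assumes "odd (degree p)"
  shows "\<exists>x. poly p x = 0"
proof -
  have "lead_coeff p \<noteq> 0" using assms by auto
  then show ?thesis
    using rcf_odd_sum[OF assms, of "coeff p"] by (simp add: poly_altdef)
qed

subsection \<open>Square roots of minus one and the intermediate value property\<close>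

abbreviation ac_poly :: "'k::field poly \<Rightarrow> 'k alg_closure poly" where
  "ac_poly \<equiv> map_poly to_ac"

lemma coeff_ac_poly [simp]: "coeff (ac_poly p) n = to_ac (coeff p n)"
  by (simp add: coeff_map_poly)

lemma degree_ac_poly [simp]: "degree (ac_poly p) = degree p"
  by (rule degree_map_poly) simp

lemma ac_poly_add: "ac_poly (p + q) = ac_poly p + ac_poly q"
  by (rule poly_eqI) simp

lemma ac_poly_diff: "ac_poly (p - q) = ac_poly p - ac_poly q"
  by (rule poly_eqI) simp

lemma ac_poly_mult: "ac_poly (p * q) = ac_poly p * ac_poly q"
  by (rule poly_eqI) (simp add: coeff_mult to_ac_sum)

lemma ac_poly_eq_0_iff: "ac_poly p = 0 \<longleftrightarrow> p = 0"
  by (simp add: poly_eq_iff)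

lemma poly_ac_poly: "poly (ac_poly p) (to_ac x) = to_ac (poly p x)"
  by (induction p) (simp_all add: map_poly_pCons)

text \<open>Indexing the roots by numbers, with multiplicity, makes it possible to form products
  over pairs of roots.\<close>

lemma prod_linear_factors:
  fixes p :: "'k::alg_closed_field poly"
  assumes "p \<noteq> 0"
  obtains \<alpha> where "p = smult (lead_coeff p) (\<Prod>i<degree p. [:- \<alpha> i, 1:])"
proof -
  obtain A where A: "size A = degree p" "p = smult (lead_coeff p) (\<Prod>x\<in>#A. [:- x, 1:])"
    using alg_closed_imp_factorization[OF assms] by blast
  obtain xs where xs: "mset xs = A"
    using ex_mset by blast
  have len: "length xs = degree p"
    using A(1) xs by auto
  have "(\<Prod>x\<in>#A. [:- x, 1:]) = prod_list (map (\<lambda>x. [:- x, 1:]) xs)"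
    unfolding xs[symmetric] by (simp flip: prod_mset_prod_list)
  also have "\<dots> = (\<Prod>i<degree p. [:- (xs ! i), 1:])"
    by (simp add: prod.list_conv_set_nth len atLeast0LessThan)
  finally show ?thesis
    using A(2) that by metis
qed

text \<open>Swapping the roles of the two polynomials reduces the degree as in Euclid's algorithm for resultants.\<close>
lemma prod_values_at_roots_in_range:
  fixes p g :: "'k::field poly"
  assumes "p \<noteq> 0" "ac_poly p = smult (to_ac (lead_coeff p)) (\<Prod>i<degree p. [:- \<alpha> i, 1:])"
  shows "(\<Prod>i<degree p. poly (ac_poly g) (\<alpha> i)) \<in> range to_ac"
  using assms
proof (induction "degree g" arbitrary: p g \<alpha> rule: less_induct)
  case less
  let ?n = "degree p" and ?m = "degree g"
  show ?case
  proof (cases "?m = 0")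
    case True
    then obtain c where "g = [:c:]"
      by (auto elim: degree_eq_zeroE)
    then have "(\<Prod>i<?n. poly (ac_poly g) (\<alpha> i)) = to_ac (c ^ ?n)"
      by (simp add: map_poly_pCons)
    then show ?thesis by blast
  next
    case False
    then have g0: "g \<noteq> 0" by auto
    then have "ac_poly g \<noteq> 0" by (simp add: ac_poly_eq_0_iff)
    from prod_linear_factors[OF this] obtain \<beta>
      where \<beta>: "ac_poly g = smult (to_ac (lead_coeff g)) (\<Prod>i<?m. [:- \<beta> i, 1:])"
      by auto
    define r where "r = p mod g"
    have "degree r < ?m \<or> r = 0"
      using degree_mod_less[OF g0] r_def by auto
    then have dr: "degree r < ?m"
      using False by auto
    have root: "poly (ac_poly g) (\<beta> k) = 0" if "k < ?m" for k
      unfolding \<beta> using that by (auto simp: poly_prod intro!: prod_zero)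
    have pr: "poly (ac_poly p) (\<beta> k) = poly (ac_poly r) (\<beta> k)" if "k < ?m" for k
    proof -
      have "ac_poly p = ac_poly (p div g) * ac_poly g + ac_poly r"
        unfolding r_def ac_poly_mult[symmetric] ac_poly_add[symmetric] by simp
      then show ?thesis using root[OF that] by simp
    qed
    have pv: "poly (ac_poly p) x = to_ac (lead_coeff p) * (\<Prod>i<?n. (x - \<alpha> i))" for x
      using less.prems(2) by (simp add: poly_prod)
    have gv: "poly (ac_poly g) x = to_ac (lead_coeff g) * (\<Prod>k<?m. (x - \<beta> k))" for x
      using \<beta> by (simp add: poly_prod)
    \<comment> \<open>Symmetry of the resultant: up to powers of -1 and of the leading coefficients,
      the values of \<open>g\<close> at the roots of \<open>p\<close> and those of \<open>p\<close>
      at the roots of \<open>g\<close> have the same product, that of all differences of roots. At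
      the roots of \<open>g\<close>, \<open>p\<close> equals its remainder \<open>r\<close>.\<close>
    have "(\<Prod>i<?n. poly (ac_poly g) (\<alpha> i)) = to_ac (lead_coeff g) ^ ?n * (\<Prod>i<?n. \<Prod>k<?m. (\<alpha> i - \<beta> k))"
      by (simp add: gv prod.distrib)
    also have "(\<Prod>i<?n. \<Prod>k<?m. (\<alpha> i - \<beta> k)) = (\<Prod>k<?m. \<Prod>i<?n. (\<alpha> i - \<beta> k))"
      by (rule prod.swap)
    also have "\<dots> = (\<Prod>k<?m. (- 1) ^ ?n * (\<Prod>i<?n. (\<beta> k - \<alpha> i)))"
    proof (rule prod.cong[OF refl])
      fix k
      have "(\<Prod>i<?n. (\<alpha> i - \<beta> k)) = (\<Prod>i<?n. (- 1) * (\<beta> k - \<alpha> i))"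
        by (rule prod.cong) auto
      then show "(\<Prod>i<?n. (\<alpha> i - \<beta> k)) = (- 1) ^ ?n * (\<Prod>i<?n. (\<beta> k - \<alpha> i))"
        by (simp only: prod.distrib) simp
    qed
    also have "\<dots> = (\<Prod>k<?m. to_ac ((- 1) ^ ?n / lead_coeff p) * poly (ac_poly r) (\<beta> k))"
    proof (rule prod.cong[OF refl])
      fix k assume "k \<in> {..<?m}"
      then have "to_ac (lead_coeff p) * (\<Prod>i<?n. (\<beta> k - \<alpha> i)) = poly (ac_poly r) (\<beta> k)"
        using pv[of "\<beta> k"] pr[of k] by simp
      then show "(- 1) ^ ?n * (\<Prod>i<?n. (\<beta> k - \<alpha> i)) = to_ac ((- 1) ^ ?n / lead_coeff p) * poly (ac_poly r) (\<beta> k)"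
        using less.prems(1) by (auto simp: field_simps)
    qed
    also have "\<dots> = to_ac (((- 1) ^ ?n / lead_coeff p) ^ ?m) * (\<Prod>k<?m. poly (ac_poly r) (\<beta> k))"
      by (simp only: prod.distrib prod_constant card_lessThan to_ac_power)
    finally have "(\<Prod>i<?n. poly (ac_poly g) (\<alpha> i)) = to_ac (lead_coeff g ^ ?n * ((- 1) ^ ?n / lead_coeff p) ^ ?m)
        * (\<Prod>k<?m. poly (ac_poly r) (\<beta> k))"
      by simp
    moreover obtain c where "(\<Prod>k<?m. poly (ac_poly r) (\<beta> k)) = to_ac c"
      using less.hyps[OF dr g0 \<beta>] by blast
    ultimately show ?thesis
      by (metis rangeI to_ac_mult)
  qed
qed

text \<open>Synthetic division at one point of \<open>U\<close> leaves a quotient of smaller degree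
  whose values at the remaining points again lie in the base field.\<close>

lemma poly_in_range_by_values:
  fixes P :: "'k::field alg_closure poly"
  assumes "infinite U" "\<And>x. x \<in> U \<Longrightarrow> poly P (to_ac x) \<in> range to_ac"
  shows "P \<in> range ac_poly"
  using assms
proof (induction "degree P" arbitrary: P U rule: less_induct)
  case less
  obtain a where a: "a \<in> U"
    using less.prems(1) by (metis finite.emptyI all_not_in_conv)
  obtain c where c: "poly P (to_ac a) = to_ac c"
    using less.prems(2)[OF a] by auto
  define M where "M = synthetic_div P (to_ac a)"
  have PM: "P = [:- to_ac a, 1:] * M + [:to_ac c:]"
    unfolding M_def c[symmetric] by (rule synthetic_div_correct'[symmetric])
  show ?case
  proof (cases "degree P = 0")
    case True
    then obtain d where "P = [:d:]" by (auto elim: degree_eq_zeroE)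
    then have "P = ac_poly [:c:]" using c by (simp add: map_poly_pCons)
    then show ?thesis by blast
  next
    case False
    then have "degree M < degree P"
      unfolding M_def by (simp add: degree_synthetic_div)
    moreover have "infinite (U - {a})"
      using less.prems(1) by simp
    moreover have "poly M (to_ac x) \<in> range to_ac" if xU: "x \<in> U - {a}" for x
    proof -
      obtain d where d: "poly P (to_ac x) = to_ac d"
        using less.prems(2)[of x] xU by blast
      have "to_ac (x - a) * poly M (to_ac x) = to_ac (d - c)"
        using arg_cong[OF PM, of "\<lambda>Q. poly Q (to_ac x)"] d by (simp add: algebra_simps)
      then have "poly M (to_ac x) = to_ac ((d - c) / (x - a))"
        using xU by (simp add: field_simps)
      then show ?thesis by blast
    qed
    ultimately obtain m where "M = ac_poly m"
      using less.hyps by blast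
    moreover have "ac_poly ([:- a, 1:] * m + [:c:]) = [:- to_ac a, 1:] * ac_poly m + [:to_ac c:]"
      by (simp only: ac_poly_add ac_poly_mult) (simp add: map_poly_pCons)
    ultimately have "P = ac_poly ([:- a, 1:] * m + [:c:])"
      using PM by simp
    then show ?thesis by blast
  qed
qed

text \<open>Division with remainder in the base field remains one over the closure, and quotient and
  remainder are unique by degree.\<close>

lemma ac_poly_div:
  fixes d e :: "'k::field poly"
  assumes "ac_poly e = ac_poly d * S" "d \<noteq> 0"
  shows "S \<in> range ac_poly"
proof -
  define r where "r = e mod d"
  have "ac_poly e = ac_poly d * ac_poly (e div d) + ac_poly r"
    unfolding r_def ac_poly_mult[symmetric] ac_poly_add[symmetric] by simp
  then have *: "ac_poly d * (S - ac_poly (e div d)) = ac_poly r"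
    using assms(1) by (simp add: algebra_simps)
  have "S - ac_poly (e div d) = 0"
  proof (rule ccontr)
    assume n: "S - ac_poly (e div d) \<noteq> 0"
    have "degree (ac_poly r) = degree (ac_poly d) + degree (S - ac_poly (e div d))"
      unfolding *[symmetric] using n assms(2) by (intro degree_mult_eq) (auto simp: ac_poly_eq_0_iff)
    then have "degree r \<ge> degree d" by simp
    moreover have "r \<noteq> 0" using * n assms(2) by (auto simp: ac_poly_eq_0_iff)
    ultimately show False
      using degree_mod_less[OF assms(2), of e] r_def by auto
  qed
  then have "S = ac_poly (e div d)" by simp
  then show ?thesis by blast
qed

text \<open>Successive approximation by base polynomials \<open>a\<close> with the leading term of
  \<open>q\<close>: in q^2 - a^2 = (q - a)(q + a) the second factor has leading coefficient 2, so
  the leading coefficient of q - a lies in the base field. Adding that term to \<open>a\<close>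
  lowers the degree of the difference.\<close>

lemma monic_sqrt_in_range:
  fixes q :: "'k::field_char_0 alg_closure poly"
  assumes "lead_coeff q = 1" "q * q \<in> range ac_poly"
  shows "q \<in> range ac_poly"
proof -
  have "q \<in> range ac_poly"
    if "degree a = degree q" "lead_coeff a = 1" for a :: "'k poly"
    using that
  proof (induction "degree (q - ac_poly a)" arbitrary: a rule: less_induct)
    case less
    let ?d = "q - ac_poly a"
    show ?case
    proof (cases "?d = 0")
      case True
      then have "q = ac_poly a" by simp
      then show ?thesis by blast
    next
      case False
      have dn: "degree ?d < degree q"
      proof -
        have "coeff ?d (degree q) = 0"
          using assms(1) less.prems by (metis coeff_ac_poly coeff_diff diff_self to_ac_1)
        moreover have "degree ?d \<le> degree q"
          by (rule degree_diff_le) (use less.prems in auto)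
        ultimately show ?thesis
          by (metis False coeff_0_degree_minus_1 le_eq_less_or_eq leading_coeff_0_iff)
      qed
      have s2: "degree (q + ac_poly a) = degree q \<and> lead_coeff (q + ac_poly a) = 2"
      proof -
        have c: "coeff (q + ac_poly a) (degree q) = 2"
          using assms(1) less.prems by (metis coeff_ac_poly coeff_add one_add_one to_ac_1)
        have "degree (q + ac_poly a) \<le> degree q"
          by (rule degree_add_le) (use less.prems in auto)
        moreover have "degree q \<le> degree (q + ac_poly a)"
          using c by (intro le_degree) auto
        ultimately show ?thesis using c by simp
      qed
      obtain e where e: "q * q = ac_poly e" using assms(2) by blast
      have "?d * (q + ac_poly a) = ac_poly (e - a * a)"
        by (simp add: ac_poly_diff ac_poly_mult e[symmetric] algebra_simps)
      then have "lead_coeff ?d * lead_coeff (q + ac_poly a) = lead_coeff (ac_poly (e - a * a))"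
        by (metis lead_coeff_mult)
      then have "lead_coeff ?d * 2 = to_ac (lead_coeff (e - a * a))"
        using s2 by (metis coeff_ac_poly degree_ac_poly)
      then have "lead_coeff ?d = to_ac (lead_coeff (e - a * a) / 2)"
        by (simp add: field_simps)
      then obtain c where c: "lead_coeff ?d = to_ac c" by blast
      define k where "k = degree ?d"
      define a' where "a' = a + Polynomial.monom c k"
      have "degree a' = degree q \<and> lead_coeff a' = 1"
      proof (cases "c = 0")
        case True
        then show ?thesis using less.prems by (simp add: a'_def)
      next
        case cz: False
        have "degree (Polynomial.monom c k) < degree a"
          using dn less.prems cz by (simp add: degree_monom_eq k_def)
        then show ?thesis
          unfolding a'_def using less.prems
          by (metis degree_add_eq_left lead_coeff_add_le add.commute)
      qed
      moreover have eq: "q - ac_poly a' = ?d - Polynomial.monom (to_ac c) k"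
        unfolding a'_def by (simp add: ac_poly_add map_poly_monom)
      have "degree (q - ac_poly a') < k \<or> q - ac_poly a' = 0"
      proof -
        have "coeff (q - ac_poly a') k = 0"
          unfolding eq using c by (simp add: k_def)
        moreover have "degree (q - ac_poly a') \<le> k"
          unfolding eq by (rule degree_diff_le) (auto simp: k_def degree_monom_le)
        ultimately show ?thesis
          by (metis le_eq_less_or_eq leading_coeff_0_iff)
      qed
      ultimately show ?thesis
      proof (elim disjE, goal_cases)
        case 1
        then show ?thesis using less.hyps[of a'] k_def by blast
      next
        case 2
        then have "q = ac_poly a'" by simp
        then show ?thesis by blast
      qed
    qed
  qed
  from this[of "Polynomial.monom 1 (degree q)"] show ?thesis
    by (simp add: degree_monom_eq)
qed

text \<open>For fixed i, the factors x - \<beta> i k used below are linear in \<alpha> k, of the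
  form u - w \<alpha> k. The homogeneous form is required because w = 1 + t \<alpha> i may
  vanish.\<close>

lemma homogenized_prod_linear:
  fixes p :: "'k::field poly"
  assumes "p = smult (lead_coeff p) (\<Prod>i<degree p. [:- \<alpha> i, 1:])" "p \<noteq> 0"
  shows "lead_coeff p * (\<Prod>i<degree p. u - w * \<alpha> i) = (\<Sum>l\<le>degree p. coeff p l * u ^ l * w ^ (degree p - l))"
proof (cases "w = 0")
  case True
  have "(\<Sum>l\<le>degree p. coeff p l * u ^ l * w ^ (degree p - l)) = (\<Sum>l\<in>{degree p}. coeff p l * u ^ l * w ^ (degree p - l))"
    using True by (intro sum.mono_neutral_right) auto
  then show ?thesis using True by simp
next
  case False
  have "(\<Prod>i<degree p. u - w * \<alpha> i) = (\<Prod>i<degree p. w * (u / w - \<alpha> i))"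
    using False by (intro prod.cong) (auto simp: field_simps)
  also have "\<dots> = w ^ degree p * (\<Prod>i<degree p. (u / w - \<alpha> i))"
    by (simp add: prod.distrib)
  finally have "lead_coeff p * (\<Prod>i<degree p. u - w * \<alpha> i) = w ^ degree p * (lead_coeff p * (\<Prod>i<degree p. (u / w - \<alpha> i)))"
    by simp
  also have "lead_coeff p * (\<Prod>i<degree p. (u / w - \<alpha> i)) = poly p (u / w)"
    by (subst (3) assms(1)) (simp add: poly_prod)
  also have "w ^ degree p * poly p (u / w) = (\<Sum>l\<le>degree p. coeff p l * u ^ l * w ^ (degree p - l))"
    unfolding poly_altdef sum_distrib_left
    using False by (intro sum.cong) (auto simp: field_simps power_diff)
  finally show ?thesis .
qed

lemma to_ac_poly_linear_comb: "poly (ac_poly [:a, b:]) x = to_ac a + x * to_ac b"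
  by (simp add: map_poly_pCons)

lemma poly_ac_poly_power: "poly (ac_poly (p ^ n)) x = poly (ac_poly p) x ^ n"
  by (induction n) (simp_all add: ac_poly_mult map_poly_1)

lemma poly_ac_poly_sum: "poly (ac_poly (sum f A)) x = (\<Sum>i\<in>A. poly (ac_poly (f i)) x)"
  by (induction A rule: infinite_finite_induct) (simp_all add: ac_poly_add)

text \<open>The polynomial \<open>Q\<close> below is recovered from its square, which is the quotient of the
  product over all pairs \<open>(i, k)\<close> by the product over the diagonal; both of these are
  norms and hence have coefficients in the base field.\<close>
lemma pair_polynomial_in_range:
  fixes p :: "'k::field_char_0 poly" and t :: 'k
  assumes p: "p \<noteq> 0" "ac_poly p = smult (to_ac (lead_coeff p)) (\<Prod>i<degree p. [:- \<alpha> i, 1:])"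
  defines "\<beta> \<equiv> \<lambda>i k. \<alpha> i + \<alpha> k + to_ac t * (\<alpha> i * \<alpha> k)"
  shows "(\<Prod>(i, k)\<in>{(i, k). i < k \<and> k < degree p}. [:- \<beta> i k, 1:]) \<in> range ac_poly"
proof -
  let ?n = "degree p"
  define I where "I = {(i, k). i < k \<and> k < ?n}"
  define J where "J = {(i, k). k < i \<and> i < ?n}"
  define f where "f = (\<lambda>(i, k). [:- \<beta> i k, 1:])"
  define Q where "Q = prod f I"
  define D where "D = (\<Prod>i<?n. f (i, i))"
  define E where "E = (\<Prod>i<?n. \<Prod>k<?n. f (i, k))"
  have fin: "finite I" "finite J"
    by (rule finite_subset[of _ "{..<?n} \<times> {..<?n}"]; force simp: I_def J_def)+
  have "E = prod f ({..<?n} \<times> {..<?n})"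
    unfolding E_def by (simp add: prod.cartesian_product)
  also have "{..<?n} \<times> {..<?n} = (I \<union> J) \<union> (\<lambda>i. (i, i)) ` {..<?n}"
    by (auto simp: I_def J_def)
  also have "prod f \<dots> = prod f (I \<union> J) * prod f ((\<lambda>i. (i, i)) ` {..<?n})"
    using fin by (intro prod.union_disjoint) (auto simp: I_def J_def)
  also have "prod f ((\<lambda>i. (i, i)) ` {..<?n}) = D"
    unfolding D_def by (subst prod.reindex) (auto simp: inj_on_def)
  also have "prod f (I \<union> J) = prod f I * prod f J"
    using fin by (intro prod.union_disjoint) (auto simp: I_def J_def)
  also have "prod f J = prod f I"
    by (rule prod.reindex_bij_witness[where i = prod.swap and j = prod.swap])
      (auto simp: I_def J_def f_def \<beta>_def algebra_simps)
  finally have EDQ: "E = D * (Q * Q)"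
    by (simp add: Q_def algebra_simps)
  have p0: "ac_poly p \<noteq> 0" using p(1) by (simp add: ac_poly_eq_0_iff)
  have pp: "ac_poly p = smult (lead_coeff (ac_poly p)) (\<Prod>i<degree (ac_poly p). [:- \<alpha> i, 1:])"
    using p(2) by (metis coeff_ac_poly degree_ac_poly)
  have "D \<in> range ac_poly"
  proof (rule poly_in_range_by_values[OF infinite_UNIV_char_0])
    fix x :: 'k
    have "poly D (to_ac x) = (\<Prod>i<?n. poly (ac_poly [:x, - 2, - t:]) (\<alpha> i))"
      unfolding D_def f_def poly_prod
      by (intro prod.cong) (auto simp: \<beta>_def map_poly_pCons algebra_simps)
    then show "poly D (to_ac x) \<in> range to_ac"
      using prod_values_at_roots_in_range[OF p] by metis
  qed
  then obtain d where d: "D = ac_poly d" by blast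
  have "E \<in> range ac_poly"
  proof (rule poly_in_range_by_values[OF infinite_UNIV_char_0])
    fix x :: 'k
    \<comment> \<open>This is p, made monic and homogenized, with u = x - T and w = 1 + t T in the
      indeterminate T. Its value at \<alpha> i is the inner product over k, so the double product is
      again a product of values at the roots of p.\<close>
    define g where "g = (\<Sum>l\<le>?n. smult (coeff p l / lead_coeff p) ([:x, - 1:] ^ l * [:1, t:] ^ (?n - l)))"
    have "poly E (to_ac x) = (\<Prod>i<?n. \<Prod>k<?n. (to_ac x - \<alpha> i) - (1 + to_ac t * \<alpha> i) * \<alpha> k)"
      unfolding E_def f_def poly_prod
      by (intro prod.cong) (auto simp: \<beta>_def algebra_simps)
    also have "\<dots> = (\<Prod>i<?n. poly (ac_poly g) (\<alpha> i))"
    proof (rule prod.cong[OF refl])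
      fix i
      let ?u = "to_ac x - \<alpha> i" and ?w = "1 + to_ac t * \<alpha> i"
      have "poly (ac_poly g) (\<alpha> i) = (\<Sum>l\<le>?n. to_ac (coeff p l / lead_coeff p) * (?u ^ l * ?w ^ (?n - l)))"
        unfolding g_def poly_ac_poly_sum
        by (intro sum.cong refl)
          (simp add: map_poly_smult ac_poly_mult poly_ac_poly_power to_ac_poly_linear_comb algebra_simps)
      also have "to_ac (lead_coeff p) * \<dots> = (\<Sum>l\<le>?n. to_ac (coeff p l) * ?u ^ l * ?w ^ (?n - l))"
        using p(1) by (simp add: sum_distrib_left field_simps)
      also have "\<dots> = to_ac (lead_coeff p) * (\<Prod>k<?n. ?u - ?w * \<alpha> k)"
        using homogenized_prod_linear[OF pp p0, of ?u ?w] by simp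
      finally show "(\<Prod>k<?n. ?u - ?w * \<alpha> k) = poly (ac_poly g) (\<alpha> i)"
        using p(1) by simp
    qed
    finally show "poly E (to_ac x) \<in> range to_ac"
      using prod_values_at_roots_in_range[OF p] by metis
  qed
  then obtain e where e: "E = ac_poly e" by blast
  have monic: "lead_coeff Q = 1" "lead_coeff D = 1"
    unfolding Q_def D_def f_def by (auto simp: lead_coeff_prod case_prod_unfold)
  have "d \<noteq> 0" using monic(2) d by auto
  with ac_poly_div[of e d "Q * Q"] EDQ d e have "Q * Q \<in> range ac_poly"
    by simp
  then have "Q \<in> range ac_poly"
    by (rule monic_sqrt_in_range[OF monic(1)])
  then show ?thesis by (simp add: Q_def f_def I_def)
qed

section \<open>Adjoining a square root of minus one\<close>

definition ac_i :: "'k::rcf alg_closure" where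
  "ac_i = (SOME z. z * z = - 1)"

lemma ac_i_square: "ac_i * ac_i = (- 1 :: 'k::rcf alg_closure)"
proof -
  have "\<exists>y. y ^ 2 = (- 1 :: 'k alg_closure)"
    by (rule nth_root_exists) simp
  then have "\<exists>y. y * y = (- 1 :: 'k alg_closure)"
    by (simp add: power2_eq_square)
  then show ?thesis unfolding ac_i_def by (rule someI_ex)
qed

definition cplx :: "'k::rcf \<Rightarrow> 'k \<Rightarrow> 'k alg_closure" where
  "cplx a b = to_ac a + to_ac b * ac_i"

lemma cplx_add: "cplx a b + cplx c d = cplx (a + c) (b + d)"
  by (simp add: cplx_def algebra_simps)

lemma cplx_diff: "cplx a b - cplx c d = cplx (a - c) (b - d)"
  by (simp add: cplx_def algebra_simps)

lemma cplx_mult: "cplx a b * cplx c d = cplx (a * c - b * d) (a * d + b * c)"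
proof -
  have "cplx a b * cplx c d = to_ac (a * c) + to_ac (b * d) * (ac_i * ac_i) + to_ac (a * d + b * c) * ac_i"
    by (simp add: cplx_def algebra_simps)
  then show ?thesis by (simp add: ac_i_square cplx_def)
qed

lemma cplx_eq_0_iff: "cplx a b = 0 \<longleftrightarrow> a = 0 \<and> b = (0 :: 'k::rcf)"
proof
  assume "cplx a b = 0"
  then have "cplx a b * cplx a (- b) = 0" by simp
  moreover have "cplx a b * cplx a (- b) = to_ac (a * a + b * b)"
    unfolding cplx_mult by (simp add: cplx_def)
  ultimately have "to_ac (a * a + b * b) = 0" by simp
  then show "a = 0 \<and> b = 0"
    by (simp only: to_ac_eq_0_iff) (simp add: add_nonneg_eq_0_iff)
qed (simp add: cplx_def)

lemma cplx_of_real: "to_ac a = cplx a 0"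
  by (simp add: cplx_def)

text \<open>The half-angle formulas, with \<open>r\<close> the absolute value of the complex number.
  They determine the square root up to the sign of its imaginary part, which has to match
  \<open>b\<close>.\<close>

lemma cplx_sqrt: "\<exists>c d. cplx c d * cplx c d = cplx a (b :: 'k::rcf)"
proof -
  obtain r0 where r0: "r0 * r0 = a * a + b * b"
    using rcf_square[of "a * a + b * b"] by auto
  define r where "r = \<bar>r0\<bar>"
  have r: "r * r = a * a + b * b" "r \<ge> 0" using r0 by (auto simp: r_def)
  have "\<bar>a\<bar> \<le> r"
  proof (rule ccontr)
    assume "\<not> \<bar>a\<bar> \<le> r"
    then have "r * r < \<bar>a\<bar> * \<bar>a\<bar>" using r(2) by (intro mult_strict_mono') auto
    then have "a * a + b * b < a * a" using r(1) by simp
    moreover have "b * b \<ge> 0" by simp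
    ultimately show False by linarith
  qed
  then have nn: "(r + a) / 2 \<ge> 0" "(r - a) / 2 \<ge> 0" by auto
  from rcf_square[OF nn(1)] obtain u where u: "u * u = (r + a) / 2" by blast
  from rcf_square[OF nn(2)] obtain v where v: "v * v = (r - a) / 2" by blast
  have "(2 * (u * v)) * (2 * (u * v)) = 4 * (u * u) * (v * v)" by (simp add: algebra_simps)
  also have "\<dots> = r * r - a * a" unfolding u v by (simp add: field_simps)
  also have "\<dots> = b * b" using r(1) by simp
  finally have "2 * (u * v) = b \<or> 2 * (u * v) = - b"
    by (rule square_eq_iff[THEN iffD1])
  moreover have "u * u - v * v = a" unfolding u v by (simp add: field_simps)
  ultimately have "cplx u v * cplx u v = cplx a b \<or> cplx u (- v) * cplx u (- v) = cplx a b"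
    by (auto simp: cplx_mult algebra_simps)
  then show ?thesis by blast
qed

lemma card_pairs_below: "2 * card {(i, k). i < k \<and> k < (n::nat)} = n * (n - 1)"
proof -
  have "{(i, k). i < k \<and> k < n} = prod.swap ` (SIGMA k:{..<n}. {..<k})"
    by (auto simp: image_iff)
  then have "card {(i, k). i < k \<and> k < n} = (\<Sum>k<n. k)"
    by (simp add: card_image)
  moreover have "2 * (\<Sum>k<n. k) = n * (n - 1)"
  proof (induction n)
    case (Suc n)
    then show ?case by (cases n) auto
  qed simp
  ultimately show ?thesis by simp
qed

text \<open>Laplace's proof of the fundamental theorem of algebra, by induction on the exponent of 2
  in the degree.\<close>
lemma complex_root_exists:
  fixes p :: "'k::rcf poly"
  assumes "degree p = 2 ^ m * l" "odd l"
  shows "\<exists>a b. poly (ac_poly p) (cplx a b) = 0"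
  using assms
proof (induction m arbitrary: p l)
  case 0
  then obtain x where "poly p x = 0" using rcf_odd_root[of p] by auto
  then have "poly (ac_poly p) (cplx x 0) = 0"
    by (metis cplx_of_real poly_ac_poly to_ac_0)
  then show ?case by blast
next
  case (Suc m)
  let ?n = "degree p"
  have "?n > 0" using Suc.prems by (auto intro: Nat.gr0I)
  then have p0: "p \<noteq> 0" by auto
  then have "ac_poly p \<noteq> 0" by (simp add: ac_poly_eq_0_iff)
  from prod_linear_factors[OF this] obtain \<alpha>
    where \<alpha>: "ac_poly p = smult (to_ac (lead_coeff p)) (\<Prod>i<?n. [:- \<alpha> i, 1:])"
    by auto
  have root: "poly (ac_poly p) (\<alpha> k) = 0" if "k < ?n" for k
    unfolding \<alpha> using that by (auto simp: poly_prod intro!: prod_zero)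
  define I where "I = {(i, k). i < k \<and> k < ?n}"
  define \<beta> where "\<beta> t i k = \<alpha> i + \<alpha> k + to_ac t * (\<alpha> i * \<alpha> k)" for t i k
  have finI: "finite I"
    by (rule finite_subset[of _ "{..<?n} \<times> {..<?n}"]; force simp: I_def)
  \<comment> \<open>The number n(n - 1)/2 of pairs contains one factor 2 less than the even number
    n, so the induction hypothesis applies to the pair polynomial.\<close>
  have cardI: "card I = 2 ^ m * (l * (?n - 1))"
  proof -
    have "2 * card I = 2 * (2 ^ m * (l * (?n - 1)))"
      unfolding I_def card_pairs_below using Suc.prems(1) by simp
    then show ?thesis by simp
  qed
  have odd: "odd (l * (?n - 1))"
    using Suc.prems \<open>?n > 0\<close> by auto
  have "\<exists>i k. (i, k) \<in> I \<and> \<beta> t i k \<in> range (case_prod cplx)" for t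
  proof -
    obtain q where q: "ac_poly q = (\<Prod>(i, k)\<in>I. [:- \<beta> t i k, 1:])"
      using pair_polynomial_in_range[OF p0 \<alpha>, of t] unfolding I_def \<beta>_def by (metis (no_types, lifting) imageE)
    have "degree (\<Prod>(i, k)\<in>I. [:- \<beta> t i k, 1:]) = card I"
      by (subst degree_prod_eq_sum_degree) (auto simp: case_prod_unfold)
    then have "degree q = 2 ^ m * (l * (?n - 1))"
      using q cardI by (metis degree_ac_poly)
    from Suc.IH[OF this odd] obtain a b where "poly (ac_poly q) (cplx a b) = 0" by blast
    then have "\<exists>ik\<in>I. poly (case ik of (i, k) \<Rightarrow> [:- \<beta> t i k, 1:]) (cplx a b) = 0"
      unfolding q poly_prod using finI by (simp add: prod_zero_iff)
    then obtain i k where "(i, k) \<in> I" "\<beta> t i k = cplx a b"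
      by auto
    then show ?thesis by (metis case_prod_conv rangeI)
  qed
  then have "\<forall>t. \<exists>ik. ik \<in> I \<and> \<beta> t (fst ik) (snd ik) \<in> range (case_prod cplx)"
    by (metis fst_conv snd_conv)
  from choice[OF this] obtain ik where ik: "\<And>t. ik t \<in> I \<and> \<beta> t (fst (ik t)) (snd (ik t)) \<in> range (case_prod cplx)"
    by blast
  \<comment> \<open>Pigeonhole: there are infinitely many parameters t but finitely many pairs. Two
    parameters with the same pair determine both the product and the sum of the two roots as complex
    numbers.\<close>
  have "\<exists>t s. t \<noteq> s \<and> ik t = ik s"
  proof (rule ccontr)
    assume "\<not> ?thesis"
    then have "inj ik" by (auto simp: inj_def)
    moreover have "finite (range ik)" using ik finI by (meson finite_subset image_subsetI)
    ultimately have "finite (UNIV :: 'k set)" using finite_image_iff by blast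
    then show False by (simp add: infinite_UNIV_char_0)
  qed
  then obtain t s where ts: "t \<noteq> s" "ik t = ik s" by blast
  obtain i k where ik_t: "ik t = (i, k)" by fastforce
  have iI: "i < ?n" using ik[of t] ik_t by (auto simp: I_def)
  obtain a b where ab: "\<alpha> i + \<alpha> k + to_ac t * (\<alpha> i * \<alpha> k) = cplx a b"
    using ik[of t] ik_t by (auto simp: \<beta>_def)
  obtain c d where cd: "\<alpha> i + \<alpha> k + to_ac s * (\<alpha> i * \<alpha> k) = cplx c d"
    using ik[of s] ik_t ts by (auto simp: \<beta>_def)
  define h where "h = inverse (t - s)"
  have "to_ac (t - s) * (\<alpha> i * \<alpha> k) = cplx (a - c) (b - d)"
    unfolding cplx_diff[symmetric] ab[symmetric] cd[symmetric] by (simp add: algebra_simps)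
  then have "to_ac h * (to_ac (t - s) * (\<alpha> i * \<alpha> k)) = cplx h 0 * cplx (a - c) (b - d)"
    by (simp add: cplx_of_real)
  moreover have "to_ac h * to_ac (t - s) = 1"
    unfolding to_ac_mult[symmetric] h_def using ts(1) by simp
  ultimately have prd: "\<alpha> i * \<alpha> k = cplx (h * (a - c)) (h * (b - d))"
    by (simp add: cplx_mult mult.assoc[symmetric])
  have sm: "\<alpha> i + \<alpha> k = cplx a b - cplx t 0 * (\<alpha> i * \<alpha> k)"
    using ab by (simp add: cplx_of_real algebra_simps)
  then obtain e f where ef: "\<alpha> i + \<alpha> k = cplx e f"
    unfolding prd by (simp add: cplx_mult cplx_diff)
  \<comment> \<open>The discriminant of the quadratic polynomial with these two roots; it has a
    complex square root, so the roots are complex.\<close>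
  have "(\<alpha> i - \<alpha> k) * (\<alpha> i - \<alpha> k) = cplx e f * cplx e f - cplx 4 0 * (\<alpha> i * \<alpha> k)"
    unfolding ef[symmetric] by (simp add: cplx_of_real[symmetric] algebra_simps)
  then obtain u v where "(\<alpha> i - \<alpha> k) * (\<alpha> i - \<alpha> k) = cplx u v"
    unfolding prd by (simp add: cplx_mult cplx_diff)
  then obtain x y where "(\<alpha> i - \<alpha> k) * (\<alpha> i - \<alpha> k) = cplx x y * cplx x y"
    by (metis cplx_sqrt)
  then have "\<alpha> i - \<alpha> k = cplx x y \<or> \<alpha> i - \<alpha> k = cplx 0 0 - cplx x y"
    by (auto simp: square_eq_iff cplx_def)
  then obtain x' y' where "\<alpha> i - \<alpha> k = cplx x' y'"
    by (auto simp: cplx_diff)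
  then have "cplx (1/2) 0 * (\<alpha> i + \<alpha> k + (\<alpha> i - \<alpha> k)) = cplx (1/2) 0 * (cplx e f + cplx x' y')"
    using ef by simp
  moreover have "cplx (1/2) 0 * (\<alpha> i + \<alpha> k + (\<alpha> i - \<alpha> k)) = \<alpha> i"
    by (simp add: cplx_of_real[symmetric] field_simps)
  ultimately obtain z w where "\<alpha> i = cplx z w"
    by (metis cplx_add cplx_mult)
  then show ?case using root[OF iI] by metis
qed

section \<open>Intermediate values, Rolle's theorem and mean values\<close>

text \<open>A complex root gives either a linear factor or a quadratic one without real zeros. The
  quadratic factor is positive, and a linear factor with root outside the interval has the same sign
  at both ends, so the sign change passes to the cofactor of smaller degree.\<close>

lemma poly_IVT_sign:
  fixes p :: "'k::rcf poly"
  assumes "a < b" "poly p a * poly p b < 0"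
  shows "\<exists>x. a < x \<and> x < b \<and> poly p x = 0"
  using assms(2)
proof (induction "degree p" arbitrary: p rule: less_induct)
  case less
  show ?case
  proof (cases "degree p = 0")
    case True
    then obtain c where "p = [:c:]" by (auto elim: degree_eq_zeroE)
    then have "c * c < 0" using less.prems by simp
    then show ?thesis by (simp add: not_square_less_zero)
  next
    case False
    obtain l m where lm: "degree p = 2 ^ m * l" "odd l"
    proof -
      have "\<exists>m l. n = 2 ^ m * l \<and> odd l" if "n > 0" for n :: nat
        using that
      proof (induction n rule: less_induct)
        case (less n)
        show ?case
        proof (cases "odd n")
          case True
          then show ?thesis by (intro exI[of _ 0] exI[of _ n]) auto
        next
          case False
          then obtain k where k: "n = 2 * k" by blast
          then obtain m l where "k = 2 ^ m * l" "odd l" using less.IH[of k] less.prems by auto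
          then show ?thesis using k by (intro exI[of _ "Suc m"] exI[of _ l]) auto
        qed
      qed
      then show ?thesis using that False by blast
    qed
    obtain u v where uv: "poly (ac_poly p) (cplx u v) = 0"
      using complex_root_exists[OF lm] by blast
    show ?thesis
    proof (cases "v = 0")
      case True
      then have "poly p u = 0"
        using uv by (metis cplx_of_real poly_ac_poly to_ac_eq_0_iff)
      then have "[:- u, 1:] dvd p" by (simp add: poly_eq_0_iff_dvd)
      then obtain r where r: "p = [:- u, 1:] * r" by (elim dvdE)
      have dr: "degree r < degree p"
        using False unfolding r by (cases "r = 0") (simp_all add: degree_mult_eq del: mult_pCons_left)
      have pv: "poly p x = (x - u) * poly r x" for x unfolding r by (simp add: algebra_simps)
      have prod: "((a - u) * (b - u)) * (poly r a * poly r b) < 0"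
        using less.prems by (simp add: pv algebra_simps)
      show ?thesis
      proof (cases "a < u \<and> u < b")
        case True
        then show ?thesis using \<open>poly p u = 0\<close> by blast
      next
        case nin: False
        have "(a - u) * (b - u) \<ge> 0"
          using nin assms(1) by (cases "u \<le> a") (auto intro!: mult_nonneg_nonneg mult_nonpos_nonpos)
        then have "poly r a * poly r b < 0"
          using prod by (metis mult_nonneg_nonneg not_le)
        from less.hyps[OF dr this] show ?thesis using pv by auto
      qed
    next
      case v: False
      define q where "q = [:u * u + v * v, - 2 * u, 1:]"
      have q0: "q \<noteq> 0" "degree q = 2" by (auto simp: q_def)
      have qz: "poly (ac_poly q) (cplx u v) = 0"
      proof -
        have "poly (ac_poly q) (cplx u v) = cplx (u * u + v * v) 0 + cplx (- 2 * u) 0 * cplx u v + cplx u v * cplx u v"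
          by (simp add: q_def map_poly_pCons cplx_of_real[symmetric] algebra_simps)
        also have "\<dots> = cplx 0 0"
          unfolding cplx_mult cplx_add by (simp add: algebra_simps)
        finally show ?thesis by (simp add: cplx_def)
      qed
      define r where "r = p mod q"
      have "ac_poly p = ac_poly (p div q) * ac_poly q + ac_poly r"
        unfolding r_def ac_poly_mult[symmetric] ac_poly_add[symmetric] by simp
      then have rz: "poly (ac_poly r) (cplx u v) = 0"
        using uv qz by simp
      have "degree r \<le> 1"
        using degree_mod_less[OF q0(1), of p] q0(2) r_def by auto
      then obtain c d where cd: "r = [:c, d:]"
        by (metis degree_eq_zeroE degree_pCons_eq_if le_SucE le_zero_eq One_nat_def pCons_cases pCons_0_0 Suc_inject)
      have "poly (ac_poly r) (cplx u v) = cplx c 0 + cplx d 0 * cplx u v"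
        by (simp add: cd map_poly_pCons cplx_of_real[symmetric] algebra_simps)
      also have "\<dots> = cplx (c + d * u) (d * v)"
        unfolding cplx_mult cplx_add by simp
      finally have "c + d * u = 0 \<and> d * v = 0"
        using rz cplx_eq_0_iff by metis
      then have "r = 0" using v cd by auto
      then obtain s where s: "p = q * s"
        unfolding r_def by (metis mod_0_imp_dvd dvdE)
      have "s \<noteq> 0" using less.prems s by auto
      then have ds: "degree s < degree p"
        using s q0 by (simp add: degree_mult_eq)
      have qpos: "poly q x > 0" for x
      proof -
        have "poly q x = (x - u) * (x - u) + v * v"
          by (simp add: q_def algebra_simps)
        moreover have "v * v > 0" using v by (auto simp: zero_less_mult_iff neq_iff)
        moreover have "(x - u) * (x - u) \<ge> 0" by simp
        ultimately show ?thesis by linarith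
      qed
      have "(poly q a * poly q b) * (poly s a * poly s b) < 0"
        using less.prems s by (simp add: algebra_simps)
      then have "poly s a * poly s b < 0"
        using qpos[of a] qpos[of b] by (metis mult_pos_pos zero_less_mult_pos mult_less_0_iff not_less_iff_gr_or_eq)
      from less.hyps[OF ds this] show ?thesis using s by auto
    qed
  qed
qed

lemma poly_sign_constant:
  fixes p :: "'k::rcf poly"
  assumes "\<And>x. a \<le> x \<Longrightarrow> x \<le> b \<Longrightarrow> poly p x \<noteq> 0" "a \<le> b"
  shows "poly p a * poly p b > 0"
proof (rule ccontr)
  assume *: "\<not> ?thesis"
  have "poly p a \<noteq> 0" "poly p b \<noteq> 0" using assms by auto
  with * have n: "poly p a * poly p b < 0" by (metis linorder_neqE_linordered_idom mult_eq_0_iff)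
  then have "a \<noteq> b" by (auto simp: not_square_less_zero)
  then show False using poly_IVT_sign[OF _ n] assms by fastforce
qed

text \<open>An algebraic argument in place of compactness. Between the root a and the next root c
  one has p = A^(m+1) C^(n+1) h, where h keeps its sign on the closed interval. Then p' = A^m C^n k,
  and k has opposite signs at a and c, so it vanishes in between.\<close>

lemma poly_Rolle:
  fixes p :: "'k::rcf poly"
  assumes "a < b" "poly p a = 0" "poly p b = 0"
  shows "\<exists>x. a < x \<and> x < b \<and> poly (pderiv p) x = 0"
proof (cases "p = 0")
  case True
  then show ?thesis using dense[OF assms(1)] by auto
next
  case False
  define Z where "Z = {x. poly p x = 0 \<and> a < x}"
  have "finite Z" unfolding Z_def by (rule finite_subset[OF _ poly_roots_finite[OF False]]) auto
  moreover have "b \<in> Z" using assms by (auto simp: Z_def)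
  ultimately have c: "Min Z \<in> Z" "Min Z \<le> b" "\<And>x. x \<in> Z \<Longrightarrow> Min Z \<le> x"
    by (auto intro: Min_in Min_le)
  define c where "c = Min Z"
  have ac: "a < c" "poly p c = 0" "c \<le> b" using c by (auto simp: c_def Z_def)
  have noroot: "poly p x \<noteq> 0" if "a < x" "x < c" for x
    using c(3)[of x] that by (auto simp: Z_def c_def)
  obtain g where g: "p = [:- a, 1:] ^ Polynomial.order a p * g" "\<not> [:- a, 1:] dvd g"
    using order_decomp[OF False] by blast
  have g0: "g \<noteq> 0" using g(2) by auto
  obtain h where h: "g = [:- c, 1:] ^ Polynomial.order c g * h" "\<not> [:- c, 1:] dvd h"
    using order_decomp[OF g0] by blast
  have "Polynomial.order a p \<noteq> 0" using assms False by (simp add: order_root)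
  then obtain m where m: "Polynomial.order a p = Suc m" by (cases "Polynomial.order a p") auto
  have "poly g c = 0"
    using arg_cong[OF g(1), of "\<lambda>q. poly q c"] ac by simp
  then have "Polynomial.order c g \<noteq> 0" using g0 by (simp add: order_root)
  then obtain n where n: "Polynomial.order c g = Suc n" by (cases "Polynomial.order c g") auto
  define A where "A = [:- a, 1:]"
  define C where "C = [:- c, 1:]"
  have ph: "p = A ^ Suc m * (C ^ Suc n * h)"
    using g(1) h(1) m n unfolding A_def C_def by metis
  have ha: "poly h a \<noteq> 0"
    using g(2) h(1) by (metis dvd_mult poly_eq_0_iff_dvd)
  have hc: "poly h c \<noteq> 0"
    using h(2) by (metis poly_eq_0_iff_dvd)
  have hx: "poly h x \<noteq> 0" if "a \<le> x" "x \<le> c" for x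
  proof (cases "x = a \<or> x = c")
    case False
    then have "poly p x \<noteq> 0" using that noroot by auto
    then show ?thesis unfolding ph by auto
  qed (use ha hc in auto)
  then have hh: "poly h a * poly h c > 0"
    using poly_sign_constant[of a c h] ac by auto
  define k where "k = smult (of_nat (Suc m)) (C * h) + smult (of_nat (Suc n)) (A * h) + A * C * pderiv h"
  have dk: "pderiv p = A ^ m * C ^ n * k"
  proof -
    have "pderiv A = 1" "pderiv C = 1" by (simp_all add: A_def C_def pderiv_pCons)
    then show ?thesis
      unfolding ph k_def pderiv_mult pderiv_power_Suc
      by (simp add: algebra_simps smult_add_right)
  qed
  have "poly k a * poly k c = (of_nat (Suc m) * of_nat (Suc n) * ((a - c) * (c - a))) * (poly h a * poly h c)"
    unfolding k_def by (simp add: A_def C_def algebra_simps)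
  moreover have "(of_nat (Suc m) * of_nat (Suc n) * ((a - c) * (c - a))) < (0::'k)"
    using ac by (intro mult_pos_neg mult_pos_pos mult_neg_pos) (simp_all del: of_nat_Suc)
  ultimately have "poly k a * poly k c < 0"
    using hh by (simp add: mult_neg_pos)
  from poly_IVT_sign[OF ac(1) this] show ?thesis
    unfolding dk using ac by auto
qed

lemma poly_MVT':
  fixes p :: "'k::rcf poly"
  assumes "a < b"
  shows "\<exists>x. a < x \<and> x < b \<and> poly p b - poly p a = (b - a) * poly (pderiv p) x"
proof -
  define f where "f = smult (b - a) p - smult (poly p b - poly p a) [:- a, 1:] - [:poly p a * (b - a):]"
  have "poly f a = 0" "poly f b = 0" by (simp_all add: f_def algebra_simps)
  from poly_Rolle[OF assms this] show ?thesis
    by (auto simp: f_def pderiv_diff pderiv_smult pderiv_pCons)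
qed

lemma rcf_nth_root:
  fixes a :: "'k::rcf"
  assumes "a > 0" "m > 0"
  shows "\<exists>t>0. t ^ m = a"
proof -
  define p where "p = Polynomial.monom 1 m - [:a:]"
  have p: "poly p x = x ^ m - a" for x by (simp add: p_def poly_monom)
  have "1 + a \<le> (1 + a) ^ m" using assms by (intro self_le_power) auto
  then have "poly p 0 * poly p (1 + a) < 0"
    using assms by (auto simp: p zero_power intro!: mult_neg_pos)
  from poly_IVT_sign[OF _ this] obtain x where "0 < x" "poly p x = 0" using assms by auto
  then show ?thesis using p by auto
qed

subsection \<open>Formulas\<close>

text \<open>Variables are named by numbers and quantifiers update the environment. In the
  elimination with valuation the numbers are fixed: 0 is the eliminated variable, 1 a quotient, 2 to
  6 are bound in the description of candidates, and 9 is the element outside the valuation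
  ring.\<close>

datatype 'a tm = TPar 'a | TVar nat | TZero | TOne | TAdd "'a tm" "'a tm" | TMul "'a tm" "'a tm" | TNeg "'a tm"

datatype 'a fm = FTrue | Pos "'a tm" | Vle "'a tm" "'a tm" | FNot "'a fm" | FAnd "'a fm" "'a fm" | FEx nat "'a fm"

primrec ev :: "('a \<Rightarrow> 'k) \<Rightarrow> (nat \<Rightarrow> 'k) \<Rightarrow> 'a tm \<Rightarrow> 'k::comm_ring_1" where
  "ev \<pi> e (TPar a) = \<pi> a"
| "ev \<pi> e (TVar n) = e n"
| "ev \<pi> e TZero = 0"
| "ev \<pi> e TOne = 1"
| "ev \<pi> e (TAdd s t) = ev \<pi> e s + ev \<pi> e t"
| "ev \<pi> e (TMul s t) = ev \<pi> e s * ev \<pi> e t"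
| "ev \<pi> e (TNeg t) = - ev \<pi> e t"

text \<open>The counterpart of \<open>vle\<close> for type-class fields. Read as a relation of size:
  the dominating argument is the one of smaller valuation.\<close>

definition vdom :: "'k::field set \<Rightarrow> 'k \<Rightarrow> 'k \<Rightarrow> bool" where
  "vdom V x y \<longleftrightarrow> y = 0 \<or> x \<noteq> 0 \<and> y / x \<in> V"

primrec holds :: "'k::linordered_field set \<Rightarrow> ('a \<Rightarrow> 'k) \<Rightarrow> (nat \<Rightarrow> 'k) \<Rightarrow> 'a fm \<Rightarrow> bool" where
  "holds V \<pi> e FTrue \<longleftrightarrow> True"
| "holds V \<pi> e (Pos t) \<longleftrightarrow> 0 < ev \<pi> e t"
| "holds V \<pi> e (Vle s t) \<longleftrightarrow> vdom V (ev \<pi> e s) (ev \<pi> e t)"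
| "holds V \<pi> e (FNot f) \<longleftrightarrow> \<not> holds V \<pi> e f"
| "holds V \<pi> e (FAnd f g) \<longleftrightarrow> holds V \<pi> e f \<and> holds V \<pi> e g"
| "holds V \<pi> e (FEx n f) \<longleftrightarrow> (\<exists>x. holds V \<pi> (e(n := x)) f)"

primrec qf :: "'a fm \<Rightarrow> bool" where
  "qf FTrue \<longleftrightarrow> True"
| "qf (Pos t) \<longleftrightarrow> True"
| "qf (Vle s t) \<longleftrightarrow> True"
| "qf (FNot f) \<longleftrightarrow> qf f"
| "qf (FAnd f g) \<longleftrightarrow> qf f \<and> qf g"
| "qf (FEx n f) \<longleftrightarrow> False"

primrec vfree :: "'a fm \<Rightarrow> bool" where
  "vfree FTrue \<longleftrightarrow> True"
| "vfree (Pos t) \<longleftrightarrow> True"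
| "vfree (Vle s t) \<longleftrightarrow> False"
| "vfree (FNot f) \<longleftrightarrow> vfree f"
| "vfree (FAnd f g) \<longleftrightarrow> vfree f \<and> vfree g"
| "vfree (FEx n f) \<longleftrightarrow> vfree f"

definition FOr :: "'a fm \<Rightarrow> 'a fm \<Rightarrow> 'a fm" where
  "FOr f g = FNot (FAnd (FNot f) (FNot g))"

definition FFalse :: "'a fm" where
  "FFalse = FNot FTrue"

lemma FOr_simps [simp]:
  "holds V \<pi> e (FOr f g) \<longleftrightarrow> holds V \<pi> e f \<or> holds V \<pi> e g"
  "qf (FOr f g) \<longleftrightarrow> qf f \<and> qf g"
  "vfree (FOr f g) \<longleftrightarrow> vfree f \<and> vfree g"
  by (simp_all add: FOr_def)

lemma FFalse_simps [simp]:
  "\<not> holds V \<pi> e FFalse" "qf FFalse" "vfree FFalse"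
  by (simp_all add: FFalse_def)

text \<open>Integer values keep the sign tables independent of the field.\<close>

definition sg :: "'k::linordered_idom \<Rightarrow> int" where
  "sg x = (if x > 0 then 1 else if x < 0 then - 1 else 0)"

lemma sg_simps [simp]: "sg x = 0 \<longleftrightarrow> x = 0" "sg x = 1 \<longleftrightarrow> x > 0" "sg x = - 1 \<longleftrightarrow> x < 0" "sg (0::'k) = 0" "sg (1::'k) = 1"
  for x :: "'k::linordered_idom"
  by (auto simp: sg_def)

lemma sg_mult: "sg (x * y) = sg x * sg y"
  by (auto simp: sg_def zero_less_mult_iff mult_less_0_iff)

subsection \<open>Coefficient lists\<close>

fun padd :: "'a tm list \<Rightarrow> 'a tm list \<Rightarrow> 'a tm list" where
  "padd [] q = q"
| "padd p [] = p"
| "padd (a # p) (b # q) = TAdd a b # padd p q"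

definition pscale :: "'a tm \<Rightarrow> 'a tm list \<Rightarrow> 'a tm list" where
  "pscale c q = map (TMul c) q"

fun pmul :: "'a tm list \<Rightarrow> 'a tm list \<Rightarrow> 'a tm list" where
  "pmul [] q = []"
| "pmul (a # p) q = padd (pscale a q) (TZero # pmul p q)"

text \<open>The lists are formal: a last entry may evaluate to zero, so the true degree is known
  only after the signs of the entries are given.\<close>

fun cf :: "nat \<Rightarrow> 'a tm \<Rightarrow> 'a tm list" where
  "cf n (TVar m) = (if m = n then [TZero, TOne] else [TVar m])"
| "cf n (TAdd s t) = padd (cf n s) (cf n t)"
| "cf n (TMul s t) = pmul (cf n s) (cf n t)"
| "cf n (TNeg t) = pscale (TNeg TOne) (cf n t)"
| "cf n t = [t]"

text \<open>The recursion is (a + X q)' = q + X q', which avoids integer coefficients.\<close>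

fun pder :: "'a tm list \<Rightarrow> 'a tm list" where
  "pder [] = []"
| "pder [a] = []"
| "pder (a # b # q) = padd (b # q) (TZero # pder (b # q))"

definition psem :: "('a \<Rightarrow> 'k) \<Rightarrow> (nat \<Rightarrow> 'k) \<Rightarrow> 'a tm list \<Rightarrow> 'k::comm_ring_1 poly" where
  "psem \<pi> e q = Poly (map (ev \<pi> e) q)"

lemma psem_simps [simp]: "psem \<pi> e [] = 0" "psem \<pi> e (a # q) = pCons (ev \<pi> e a) (psem \<pi> e q)"
  by (simp_all add: psem_def)

lemma psem_padd: "psem \<pi> e (padd p q) = psem \<pi> e p + psem \<pi> e q"
  by (induction p q rule: padd.induct) auto

lemma psem_pscale: "psem \<pi> e (pscale c q) = smult (ev \<pi> e c) (psem \<pi> e q)"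
  by (induction q) (auto simp: pscale_def)

lemma psem_pmul: "psem \<pi> e (pmul p q) = psem \<pi> e p * psem \<pi> e q"
  by (induction p) (auto simp: psem_padd psem_pscale)

lemma poly_cf: "poly (psem \<pi> e (cf n t)) x = ev \<pi> (e(n := x)) t"
  by (induction n t rule: cf.induct) (auto simp: psem_padd psem_pmul psem_pscale)

lemma psem_pder: "psem \<pi> e (pder q) = pderiv (psem \<pi> e (q :: 'a tm list) :: 'k::idom poly)"
  by (induction q rule: pder.induct) (auto simp: psem_padd pderiv_pCons)

lemma psem_snoc: "psem \<pi> e (q @ [a]) = psem \<pi> e q + Polynomial.monom (ev \<pi> e a) (length q)"
  by (induction q) (auto simp: monom_0 monom_Suc)

lemma psem_butlast: "q \<noteq> [] \<Longrightarrow> psem \<pi> e q = psem \<pi> e (butlast q) + Polynomial.monom (ev \<pi> e (last q)) (length q - 1)"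
  by (metis append_butlast_last_id length_butlast psem_snoc)

lemma coeff_psem: "coeff (psem \<pi> e q) i = (if i < length q then ev \<pi> e (q ! i) else 0)"
  by (simp add: psem_def coeff_Poly_eq nth_default_def)

lemma psem_lead:
  assumes "q \<noteq> []" "ev \<pi> e (last q) \<noteq> 0"
  shows "degree (psem \<pi> e q) = length q - 1" "lead_coeff (psem \<pi> e q) = ev \<pi> e (last q)"
proof -
  have c: "coeff (psem \<pi> e q) (length q - 1) = ev \<pi> e (last q)"
    using assms by (simp add: coeff_psem last_conv_nth)
  show "degree (psem \<pi> e q) = length q - 1"
    using assms c by (intro antisym degree_le le_degree) (auto simp: coeff_psem)
  then show "lead_coeff (psem \<pi> e q) = ev \<pi> e (last q)" using c by simp
qed

lemma length_padd [simp]: "length (padd p q) = max (length p) (length q)"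
  by (induction p q rule: padd.induct) auto

lemma length_pscale [simp]: "length (pscale c q) = length q"
  by (simp add: pscale_def)

lemma length_pder [simp]: "length (pder q) = length q - 1"
  by (induction q rule: pder.induct) auto

text \<open>The scaling by the square of the leading coefficient preserves signs at the roots of the divisor.\<close>
definition prem_step :: "'a tm list \<Rightarrow> 'a tm list \<Rightarrow> 'a tm list" where
  "prem_step q g = padd (pscale (TMul (last g) (last g)) (butlast q))
     (pscale (TNeg (TMul (last q) (last g))) (replicate (length q - length g) TZero @ butlast g))"

primrec prem_iter :: "nat \<Rightarrow> 'a tm list \<Rightarrow> 'a tm list \<Rightarrow> 'a tm list" where
  "prem_iter 0 q g = q"
| "prem_iter (Suc k) q g = prem_iter k (prem_step q g) g"

text \<open>Each step removes the last entry of the dividend, so this many steps make it shorter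
  than a nonempty divisor; a dividend that is already shorter is left alone.\<close>

definition prem :: "'a tm list \<Rightarrow> 'a tm list \<Rightarrow> 'a tm list" where
  "prem q g = prem_iter (length q + 1 - length g) q g"

lemma psem_shift: "psem \<pi> e (replicate k TZero @ q) = Polynomial.monom 1 k * psem \<pi> e q"
  by (induction k) (auto simp: monom_0 monom_Suc)

lemma length_prem_step:
  "g \<noteq> [] \<Longrightarrow> length g \<le> length q \<Longrightarrow> length (prem_step q g) = length q - 1"
  by (cases g) (auto simp: prem_step_def)

lemma poly_prem_step:
  assumes "g \<noteq> []" "length g \<le> length q" "poly (psem \<pi> e g) x = 0"
  shows "poly (psem \<pi> e (prem_step q g)) x = (ev \<pi> e (last g))\<^sup>2 * poly (psem \<pi> e q) x"
proof -
  let ?b = "ev \<pi> e (last g)" and ?a = "ev \<pi> e (last q)"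
  have q: "q \<noteq> []" using assms by auto
  have g: "poly (psem \<pi> e (butlast g)) x = - ?b * x ^ (length g - 1)"
    using assms(3) by (simp add: psem_butlast[OF assms(1)] poly_monom add_eq_0_iff)
  have qv: "poly (psem \<pi> e q) x = poly (psem \<pi> e (butlast q)) x + ?a * x ^ (length q - 1)"
    by (simp add: psem_butlast[OF q] poly_monom)
  have "length q - length g + (length g - 1) = length q - 1"
    using assms(1,2) by (cases g) auto
  then have "x ^ (length q - length g) * x ^ (length g - 1) = x ^ (length q - 1)"
    by (simp flip: power_add)
  then show ?thesis
    unfolding prem_step_def
    by (simp add: psem_padd psem_pscale psem_shift poly_monom g qv power2_eq_square algebra_simps)
qed

lemma length_prem_iter:
  assumes "g \<noteq> []" "k \<le> length q + 1 - length g"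
  shows "length (prem_iter k q g) = length q - k"
  using assms(2)
proof (induction k arbitrary: q)
  case (Suc k)
  then have "length (prem_step q g) = length q - 1"
    using assms(1) by (intro length_prem_step) auto
  with Suc show ?case by auto
qed simp

lemma length_prem: "g \<noteq> [] \<Longrightarrow> length g \<le> length q \<Longrightarrow> length (prem q g) = length g - 1"
  unfolding prem_def by (cases g) (auto simp: length_prem_iter)

lemma sg_prem_iter:
  fixes e :: "nat \<Rightarrow> 'k::linordered_field"
  assumes "g \<noteq> []" "k \<le> length q + 1 - length g" "ev \<pi> e (last g) \<noteq> 0" "poly (psem \<pi> e g) x = 0"
  shows "sg (poly (psem \<pi> e (prem_iter k q g)) x) = sg (poly (psem \<pi> e q) x)"
  using assms(2)
proof (induction k arbitrary: q)
  case (Suc k)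
  have l: "length (prem_step q g) = length q - 1"
    using assms(1) Suc.prems by (intro length_prem_step) auto
  have "sg (poly (psem \<pi> e (prem_step q g)) x) = sg ((ev \<pi> e (last g))\<^sup>2 * poly (psem \<pi> e q) x)"
    using assms Suc.prems by (subst poly_prem_step) auto
  also have "\<dots> = sg (poly (psem \<pi> e q) x)"
    using assms(3) by (simp add: sg_mult)
  finally show ?case using Suc.IH[of "prem_step q g"] Suc.prems l by auto
qed simp

lemma sg_prem:
  fixes e :: "nat \<Rightarrow> 'k::linordered_field"
  assumes "g \<noteq> []" "ev \<pi> e (last g) \<noteq> 0" "poly (psem \<pi> e g) x = 0"
  shows "sg (poly (psem \<pi> e (prem q g)) x) = sg (poly (psem \<pi> e q) x)"
  unfolding prem_def using assms by (intro sg_prem_iter) auto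

subsection \<open>Closed families of coefficient lists\<close>

text \<open>Derivatives control monotonicity between the points of a sign table, truncations replace
  lists whose leading coefficient vanishes, and pseudo-remainders give the signs at the roots of
  \<open>g\<close>.\<close>

definition closed_at :: "'a tm list set \<Rightarrow> 'a tm list \<Rightarrow> bool" where
  "closed_at Q g \<longleftrightarrow> pder g \<in> Q \<and> butlast g \<in> Q \<and> (\<forall>q\<in>Q. length g \<le> length q \<longrightarrow> prem q g \<in> Q)"

text \<open>The closure is formed by decreasing length. Closing at the lists of length n + 2 adds
  only lists of length n + 1, so it creates no new dividends for lists that were closed
  earlier.\<close>

lemma closed_family_exists:
  assumes "finite Q" "\<forall>g\<in>Q. length g \<ge> n + 2 \<longrightarrow> closed_at Q g"
  shows "\<exists>Q'. finite Q' \<and> Q \<subseteq> Q' \<and> (\<forall>g\<in>Q'. length g \<ge> 2 \<longrightarrow> closed_at Q' g)"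
  using assms
proof (induction n arbitrary: Q)
  case 0
  then show ?case by (intro exI[of _ Q]) auto
next
  case (Suc n)
  define G where "G = {g \<in> Q. length g = n + 2}"
  define Q1 where "Q1 = Q \<union> pder ` G \<union> butlast ` G \<union> (\<lambda>(q, g). prem q g) ` {(q, g). q \<in> Q \<and> g \<in> G \<and> length g \<le> length q}"
  have "finite {(q, g). q \<in> Q \<and> g \<in> G \<and> length g \<le> length q}"
    by (rule finite_subset[of _ "Q \<times> Q"]) (use Suc.prems in \<open>auto simp: G_def\<close>)
  then have fin: "finite Q1" using Suc.prems by (simp add: Q1_def G_def)
  have long: "q \<in> Q" if "q \<in> Q1" "length q \<ge> n + 2" for q
  proof -
    have "length (prem a b) = n + 1" if "b \<in> G" "length b \<le> length a" for a b
      using that by (subst length_prem) (auto simp: G_def)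
    moreover have "length (pder b) = n + 1" "length (butlast b) = n + 1" if "b \<in> G" for b
      using that by (auto simp: G_def)
    ultimately show ?thesis using that unfolding Q1_def by fastforce
  qed
  have "closed_at Q1 g" if "g \<in> Q1" "length g \<ge> n + 2" for g
  proof (cases "length g = n + 2")
    case True
    then have g: "g \<in> G" using long that unfolding G_def by blast
    have "prem q g \<in> Q1" if "q \<in> Q1" "length g \<le> length q" for q
    proof -
      have "q \<in> Q" using long[OF that(1)] that(2) True by linarith
      then show ?thesis using that(2) g unfolding Q1_def by blast
    qed
    moreover have "pder g \<in> Q1" "butlast g \<in> Q1" using g unfolding Q1_def by blast+
    ultimately show ?thesis unfolding closed_at_def by blast
  next
    case False
    have "g \<in> Q" using that long by blast
    moreover have "length g \<ge> Suc n + 2" using False that by linarith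
    ultimately have "closed_at Q g" using Suc.prems(2) by blast
    moreover have "q \<in> Q" if "q \<in> Q1" "length g \<le> length q" for q
      using long[OF that(1)] that(2) \<open>length g \<ge> n + 2\<close> by linarith
    moreover have "Q \<subseteq> Q1" unfolding Q1_def by blast
    ultimately show ?thesis unfolding closed_at_def by blast
  qed
  then obtain Q' where "finite Q'" "Q1 \<subseteq> Q'" "\<forall>g\<in>Q'. length g \<ge> 2 \<longrightarrow> closed_at Q' g"
    using Suc.IH[of Q1] fin by blast
  moreover have "Q \<subseteq> Q1" unfolding Q1_def by blast
  ultimately show ?case by blast
qed

text \<open>An admissible order for \<open>sign_table\<close>, which works from the end of the list:
  whatever is needed to treat a list stands behind it. Sorting a closed family by length gives such
  an order.\<close>

fun good :: "'a tm list list \<Rightarrow> bool" where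
  "good [] \<longleftrightarrow> True"
| "good (q # d) \<longleftrightarrow> good d \<and> (length q \<ge> 2 \<longrightarrow> pder q \<in> set d \<and> butlast q \<in> set d \<and>
     (\<forall>g\<in>set d. length g \<ge> 2 \<longrightarrow> prem q g \<in> set d))"

lemma good_list_exists:
  assumes "finite P"
  shows "\<exists>d. good d \<and> P \<subseteq> set d"
proof -
  define n where "n = Max (insert 0 (length ` P))"
  have "length g \<le> n" if "g \<in> P" for g
    using assms that by (auto simp: n_def)
  then have "\<forall>g\<in>P. length g \<ge> n + 2 \<longrightarrow> closed_at P g" by fastforce
  from closed_family_exists[OF assms this] obtain Q
    where Q: "finite Q" "P \<subseteq> Q" "\<And>g. g \<in> Q \<Longrightarrow> length g \<ge> 2 \<Longrightarrow> closed_at Q g" by blast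
  have "\<exists>d. good d \<and> set d = {q \<in> Q. length q \<le> m}" for m
  proof (induction m)
    case 0
    show ?case
    proof (cases "[] \<in> Q")
      case True
      then show ?thesis by (intro exI[of _ "[[]]"]) auto
    next
      case False
      then show ?thesis by (intro exI[of _ "[]"]) auto
    qed
  next
    case (Suc m)
    then obtain d0 where d0: "good d0" "set d0 = {q \<in> Q. length q \<le> m}" by blast
    have "\<exists>d. good d \<and> set d = {q \<in> Q. length q \<le> m} \<union> F" if "finite F" "F \<subseteq> {q \<in> Q. length q = Suc m}" for F
      using that
    proof (induction F rule: finite_induct)
      case empty
      then show ?case using d0 by auto
    next
      case (insert q F)
      then obtain d where d: "good d" "set d = {q \<in> Q. length q \<le> m} \<union> F" by auto
      have q: "q \<in> Q" "length q = Suc m" using insert by auto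
      have "good (q # d)"
      proof -
        have "pder q \<in> set d \<and> butlast q \<in> set d \<and> (\<forall>g\<in>set d. length g \<ge> 2 \<longrightarrow> prem q g \<in> set d)"
          if "length q \<ge> 2"
        proof (intro conjI ballI impI)
          show "pder q \<in> set d" "butlast q \<in> set d"
            using Q(3)[OF q(1) that] q unfolding d closed_at_def by auto
          fix g assume g: "g \<in> set d" "length g \<ge> 2"
          then have gq: "g \<in> Q" "length g \<le> Suc m" using d insert by auto
          then have "prem q g \<in> Q" using Q(3)[OF gq(1) g(2)] q unfolding closed_at_def by auto
          moreover have "length (prem q g) \<le> m"
            using g gq q by (subst length_prem) auto
          ultimately show "prem q g \<in> set d" using d by auto
        qed
        then show ?thesis using d by auto
      qed
      moreover have "set (q # d) = {q \<in> Q. length q \<le> m} \<union> insert q F" using d by auto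
      ultimately show ?case by blast
    qed
    from this[of "{q \<in> Q. length q = Suc m}"] Q(1)
    obtain d where "good d" "set d = {q \<in> Q. length q \<le> m} \<union> {q \<in> Q. length q = Suc m}" by auto
    moreover have "{q \<in> Q. length q \<le> m} \<union> {q \<in> Q. length q = Suc m} = {q \<in> Q. length q \<le> Suc m}" by auto
    ultimately show ?case by auto
  qed
  from this[of "Max (insert 0 (length ` Q))"] obtain d
    where d: "good d" "set d = {q \<in> Q. length q \<le> Max (insert 0 (length ` Q))}" by blast
  moreover have "length q \<le> Max (insert 0 (length ` Q))" if "q \<in> Q" for q
    using Q(1) that by auto
  ultimately have "set d = Q" by auto
  then show ?thesis using d Q by auto
qed

subsection \<open>Sign tables\<close>

type_synonym 'a sgrow = "'a tm list \<Rightarrow> int"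

text \<open>A table consists of the signs on the leftmost interval and, for each subsequent point in
  increasing order, the signs at the point and on the interval to its right.\<close>
fun add_root_col :: "'a tm list \<Rightarrow> ('a sgrow \<Rightarrow> int) \<Rightarrow> int \<Rightarrow> int \<Rightarrow> 'a sgrow \<Rightarrow> ('a sgrow \<times> 'a sgrow) list
    \<Rightarrow> 'a sgrow \<times> ('a sgrow \<times> 'a sgrow) list" where
  "add_root_col q v si sl r [] = (if sl * si < 0 then (r(q := sl), [(r(q := 0), r(q := si))])
     else (r(q := if sl \<noteq> 0 then sl else si), []))"
| "add_root_col q v si sl r ((p, r') # T) = (let (r2, T2) = add_root_col q v si (v p) r' T in
     if sl * v p < 0 then (r(q := sl), (r(q := 0), r(q := v p)) # (p(q := v p), r2) # T2)
     else (r(q := if sl \<noteq> 0 then sl else v p), (p(q := v p), r2) # T2))"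

text \<open>At a root of a nonconstant \<open>g\<close> with known sign column, the polynomial of
  \<open>q\<close> has the sign of its pseudo-remainder. Any such \<open>g\<close> serves.\<close>

definition point_sign :: "('a tm \<Rightarrow> int) \<Rightarrow> 'a tm list list \<Rightarrow> 'a tm list \<Rightarrow> 'a sgrow \<Rightarrow> int" where
  "point_sign s d q p = p (prem q (SOME g. g \<in> set d \<and> length g \<ge> 2 \<and> s (last g) \<noteq> 0 \<and> p g = 0))"

text \<open>Only a list with nonzero leading coefficient and formal degree at least one can add
  roots. The start value for \<open>add_root_col\<close> is then the sign at minus infinity, whence
  the power of -1. In the other case the sign is that of a constant or of the truncated
  list.\<close>

fun sign_table :: "('a tm \<Rightarrow> int) \<Rightarrow> 'a tm list list \<Rightarrow> 'a sgrow \<times> ('a sgrow \<times> 'a sgrow) list" where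
  "sign_table s [] = (\<lambda>_. 0, [])"
| "sign_table s (q # d) = (let (r, T) = sign_table s d in
     if length q \<ge> 2 \<and> s (last q) \<noteq> 0
     then add_root_col q (point_sign s d q) (s (last q)) ((- 1) ^ (length q - 1) * s (last q)) r T
     else let v = (\<lambda>p. if q = [] then 0 else if length q = 1 then s (last q) else p (butlast q)) in
       (r(q := v r), map (\<lambda>(p, r'). (p(q := v p), r'(q := v r'))) T))"

fun rows :: "'a sgrow \<times> ('a sgrow \<times> 'a sgrow) list \<Rightarrow> 'a sgrow set" where
  "rows (r, T) = insert r (fst ` set T \<union> snd ` set T)"

fun above :: "'k::linorder option \<Rightarrow> 'k \<Rightarrow> bool" where
  "above None x \<longleftrightarrow> True"
| "above (Some a) x \<longleftrightarrow> a < x"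

fun below :: "'k::linorder option \<Rightarrow> 'k \<Rightarrow> bool" where
  "below None x \<longleftrightarrow> True"
| "below (Some a) x \<longleftrightarrow> x < a"

definition row_ok :: "('a \<Rightarrow> 'k) \<Rightarrow> (nat \<Rightarrow> 'k) \<Rightarrow> 'a tm list set \<Rightarrow> 'a sgrow \<Rightarrow> 'k::linordered_idom \<Rightarrow> bool" where
  "row_ok \<pi> e P r x \<longleftrightarrow> (\<forall>q\<in>P. r q = sg (poly (psem \<pi> e q) x))"

text \<open>Every listed point is required to be a root of a member with nonvanishing leading
  coefficient, since \<open>point_sign\<close> has to find one there.\<close>

fun table_ok :: "('a \<Rightarrow> 'k) \<Rightarrow> (nat \<Rightarrow> 'k) \<Rightarrow> 'a tm list set \<Rightarrow> 'k option \<Rightarrow> 'a sgrow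
    \<Rightarrow> ('a sgrow \<times> 'a sgrow) list \<Rightarrow> 'k::linordered_idom \<Rightarrow> bool" where
  "table_ok \<pi> e P lo r [] z \<longleftrightarrow> (\<forall>x. above lo x \<longrightarrow> row_ok \<pi> e P r x)"
| "table_ok \<pi> e P lo r ((p, r') # T) z \<longleftrightarrow> (\<exists>y. above lo y \<and> (\<forall>x. above lo x \<and> x < y \<longrightarrow> row_ok \<pi> e P r x)
     \<and> row_ok \<pi> e P p y \<and> (\<exists>g\<in>P. length g \<ge> 2 \<and> ev \<pi> e (last g) \<noteq> 0 \<and> p g = 0)
     \<and> table_ok \<pi> e P (Some y) r' T z)"

lemma strictly_between:
  fixes Q :: "'k::rcf poly"
  assumes "a < x" "x < b" "\<And>y. a < y \<Longrightarrow> y < b \<Longrightarrow> poly (pderiv Q) y \<noteq> 0"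
  shows "(poly Q x - poly Q a) * (poly Q b - poly Q x) > 0"
proof -
  obtain u where u: "a < u" "u < x" "poly Q x - poly Q a = (x - a) * poly (pderiv Q) u"
    using poly_MVT'[OF assms(1)] by blast
  obtain w where w: "x < w" "w < b" "poly Q b - poly Q x = (b - x) * poly (pderiv Q) w"
    using poly_MVT'[OF assms(2)] by blast
  have "poly (pderiv Q) u * poly (pderiv Q) w > 0"
    by (rule poly_sign_constant) (use u w assms in auto)
  moreover have "(poly Q x - poly Q a) * (poly Q b - poly Q x) =
      ((x - a) * (b - x)) * (poly (pderiv Q) u * poly (pderiv Q) w)"
    unfolding u(3) w(3) by (simp add: algebra_simps)
  moreover have "(x - a) * (b - x) > 0" using assms by simp
  ultimately show ?thesis by simp
qed

definition left_sign :: "'k::rcf poly \<Rightarrow> 'k option \<Rightarrow> int \<Rightarrow> bool" where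
  "left_sign Q lo s \<longleftrightarrow> (case lo of Some a \<Rightarrow> sg (poly Q a) = s
     | None \<Rightarrow> s \<noteq> 0 \<and> (\<exists>B. \<forall>x<B. sg (poly Q x) = s))"

definition right_sign :: "'k::rcf poly \<Rightarrow> 'k option \<Rightarrow> int \<Rightarrow> bool" where
  "right_sign Q hi s \<longleftrightarrow> (case hi of Some a \<Rightarrow> sg (poly Q a) = s
     | None \<Rightarrow> s \<noteq> 0 \<and> (\<exists>B. \<forall>x>B. sg (poly Q x) = s))"

text \<open>Replaces infinite ends of an interval by finite points with the same sign, so that the
  mean value argument becomes applicable.\<close>

lemma sample_points:
  fixes Q :: "'k::rcf poly"
  assumes "left_sign Q lo sl" "right_sign Q hi sr"
    "\<And>x. above lo x \<Longrightarrow> below hi x \<Longrightarrow> poly (pderiv Q) x \<noteq> 0" "above lo x" "below hi x"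
  shows "\<exists>a b. a < x \<and> x < b \<and> sg (poly Q a) = sl \<and> sg (poly Q b) = sr
    \<and> (\<forall>y. a < y \<and> y < b \<longrightarrow> above lo y \<and> below hi y \<and> poly (pderiv Q) y \<noteq> 0)"
proof -
  have "\<exists>a<x. sg (poly Q a) = sl \<and> (\<forall>y>a. above lo y)"
  proof (cases lo)
    case None
    then obtain B where B: "\<And>x. x < B \<Longrightarrow> sg (poly Q x) = sl"
      using assms(1) by (auto simp: left_sign_def)
    have "min x B - 1 < x" "min x B - 1 < B" by (auto simp: min_def less_diff_eq)
    then show ?thesis using None B[of "min x B - 1"] by (intro exI[of _ "min x B - 1"]) auto
  next
    case (Some a)
    then show ?thesis using assms(1,4) by (intro exI[of _ a]) (auto simp: left_sign_def)
  qed
  moreover have "\<exists>b>x. sg (poly Q b) = sr \<and> (\<forall>y<b. below hi y)"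
  proof (cases hi)
    case None
    then obtain B where B: "\<And>x. x > B \<Longrightarrow> sg (poly Q x) = sr"
      using assms(2) by (auto simp: right_sign_def)
    have "max x B + 1 > x" "max x B + 1 > B" by (auto simp: max_def)
    then show ?thesis using None B[of "max x B + 1"] by (intro exI[of _ "max x B + 1"]) auto
  next
    case (Some b)
    then show ?thesis using assms(2,5) by (intro exI[of _ b]) (auto simp: right_sign_def)
  qed
  ultimately show ?thesis using assms(3) by blast
qed

text \<open>By strict monotonicity the two end signs are not both zero. If they are not opposite,
  the nonzero one prevails inside.\<close>

lemma sign_between:
  fixes Q :: "'k::rcf poly"
  assumes "left_sign Q lo sl" "right_sign Q hi sr"
    "\<And>x. above lo x \<Longrightarrow> below hi x \<Longrightarrow> poly (pderiv Q) x \<noteq> 0" "above lo x" "below hi x"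
    "\<not> sl * sr < 0"
  shows "sg (poly Q x) = (if sl \<noteq> 0 then sl else sr)"
proof -
  obtain a b where ab: "a < x" "x < b" "sg (poly Q a) = sl" "sg (poly Q b) = sr"
    "\<And>y. a < y \<Longrightarrow> y < b \<Longrightarrow> poly (pderiv Q) y \<noteq> 0"
    using sample_points[OF assms(1-5)] by blast
  from strictly_between[OF ab(1,2,5)]
  have "poly Q a < poly Q x \<and> poly Q x < poly Q b \<or> poly Q x < poly Q a \<and> poly Q b < poly Q x"
    by (auto simp: zero_less_mult_iff)
  then show ?thesis using ab(3,4) assms(6) by (auto simp: sg_def split: if_splits)
qed

lemma root_between:
  fixes Q :: "'k::rcf poly"
  assumes "left_sign Q lo sl" "right_sign Q hi sr"
    "\<And>x. above lo x \<Longrightarrow> below hi x \<Longrightarrow> poly (pderiv Q) x \<noteq> 0" "above lo x" "below hi x"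
    "sl * sr < 0"
  shows "\<exists>y. above lo y \<and> below hi y \<and> poly Q y = 0"
proof -
  obtain a b where ab: "a < x" "x < b" "sg (poly Q a) = sl" "sg (poly Q b) = sr"
    "\<And>y. a < y \<Longrightarrow> y < b \<Longrightarrow> above lo y \<and> below hi y"
    using sample_points[OF assms(1-5)] by blast
  have "poly Q a * poly Q b < 0"
    using ab(3,4) assms(6) by (auto simp: sg_def mult_less_0_iff split: if_splits)
  then show ?thesis using poly_IVT_sign[of a b Q] ab by fastforce
qed

text \<open>A constant positive lower bound, rather than mere positivity, lets the induction absorb
  the next lower coefficient: x times the bound eventually exceeds it.\<close>

lemma poly_lower_bound_at_top:
  fixes p :: "'k::linordered_field poly"
  assumes "lead_coeff p > 0"
  shows "\<exists>B \<epsilon>. \<epsilon> > 0 \<and> (\<forall>x>B. poly p x \<ge> \<epsilon>)"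
  using assms
proof (induction p)
  case 0
  then show ?case by simp
next
  case (pCons a p)
  show ?case
  proof (cases "p = 0")
    case True
    then show ?thesis using pCons by (intro exI[of _ 0] exI[of _ a]) auto
  next
    case False
    then obtain B \<epsilon> where B: "\<epsilon> > 0" "\<And>x. x > B \<Longrightarrow> poly p x \<ge> \<epsilon>"
      using pCons by auto
    have "poly (pCons a p) x \<ge> \<epsilon>" if "x > max B ((\<bar>a\<bar> + \<epsilon>) / \<epsilon>)" for x
    proof -
      have "(\<bar>a\<bar> + \<epsilon>) / \<epsilon> > 0" using B(1) by (intro divide_pos_pos) auto
      then have x: "x > B" "x > (\<bar>a\<bar> + \<epsilon>) / \<epsilon>" "x > 0" using that by auto
      have "\<bar>a\<bar> + \<epsilon> < x * \<epsilon>" using x(2) B(1) by (simp add: pos_divide_less_eq)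
      also have "x * \<epsilon> \<le> x * poly p x" using x B by (intro mult_left_mono) auto
      finally show ?thesis by auto
    qed
    then show ?thesis using B(1) by blast
  qed
qed

lemma sg_poly_at_top:
  fixes p :: "'k::linordered_field poly"
  assumes "p \<noteq> 0"
  shows "\<exists>B. \<forall>x>B. sg (poly p x) = sg (lead_coeff p)"
proof (cases "lead_coeff p > 0")
  case True
  obtain B \<epsilon> where "\<epsilon> > 0" "\<And>x. x > B \<Longrightarrow> poly p x \<ge> \<epsilon>"
    using poly_lower_bound_at_top[OF True] by blast
  then show ?thesis using True by (intro exI[of _ B]) (force simp: sg_def)
next
  case False
  then have n: "lead_coeff p < 0" using assms by (simp add: order_less_le)
  then have "lead_coeff (- p) > 0" by simp
  from poly_lower_bound_at_top[OF this] obtain B \<epsilon> where B: "\<epsilon> > 0" "\<And>x. x > B \<Longrightarrow> poly (- p) x \<ge> \<epsilon>"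
    by blast
  have "poly p x < 0" if "x > B" for x using B(2)[OF that] B(1) by simp
  then have "\<forall>x>B. sg (poly p x) = - 1" by simp
  moreover have "sg (lead_coeff p) = - 1" using n by simp
  ultimately show ?thesis by metis
qed

lemma sg_power: "sg (x ^ n) = sg x ^ n"
  by (induction n) (simp_all add: sg_mult)

lemma sg_poly_at_bot:
  fixes p :: "'k::linordered_field poly"
  assumes "p \<noteq> 0"
  shows "\<exists>B. \<forall>x<B. sg (poly p x) = (- 1) ^ degree p * sg (lead_coeff p)"
proof -
  define q where "q = pcompose p [:0, - 1:]"
  have "q \<noteq> 0" unfolding q_def using assms by (simp add: pcompose_eq_0_iff)
  from sg_poly_at_top[OF this] obtain B where B: "\<And>x. x > B \<Longrightarrow> sg (poly q x) = sg (lead_coeff q)"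
    by blast
  have "lead_coeff q = lead_coeff p * (- 1) ^ degree p"
    unfolding q_def by (subst lead_coeff_comp) auto
  moreover have "sg (- 1 :: 'k) = - 1" by (simp add: sg_def)
  ultimately have lq: "sg (lead_coeff q) = (- 1) ^ degree p * sg (lead_coeff p)"
    by (simp only: sg_mult sg_power mult.commute)
  have "sg (poly p x) = sg (lead_coeff q)" if "x < - B" for x
    using B[of "- x"] that by (simp add: q_def poly_pcompose)
  then show ?thesis using lq by auto
qed

lemma above_below_nonempty:
  fixes lo :: "'k::linordered_field option"
  assumes "\<And>h. hi = Some h \<Longrightarrow> above lo h"
  shows "\<exists>x. above lo x \<and> below hi x"
proof (cases hi)
  case None
  then show ?thesis by (cases lo) (auto intro: gt_ex)
next
  case (Some h)
  then show ?thesis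
  proof (cases lo)
    case None
    then show ?thesis using Some by (auto intro: lt_ex)
  next
    case (Some a)
    then show ?thesis using assms \<open>hi = Some h\<close> by (auto intro: dense)
  qed
qed

lemma row_ok_insert_upd:
  "row_ok \<pi> e P r x \<Longrightarrow> s = sg (poly (psem \<pi> e q) x) \<Longrightarrow> row_ok \<pi> e (insert q P) (r(q := s)) x"
  by (auto simp: row_ok_def)

section \<open>Correctness of the sign tables\<close>

lemma table_ok_map:
  fixes e :: "nat \<Rightarrow> 'k::linordered_idom"
  assumes "table_ok \<pi> e P lo r T z" "\<And>p x. row_ok \<pi> e P p x \<Longrightarrow> v p = sg (poly (psem \<pi> e q) x)"
  shows "table_ok \<pi> e (insert q P) lo (r(q := v r)) (map (\<lambda>(p, r'). (p(q := v p), r'(q := v r'))) T) z"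
  using assms(1)
proof (induction T arbitrary: lo r)
  case Nil
  have "row_ok \<pi> e (insert q P) (r(q := v r)) x" if "above lo x" for x
    using Nil that by (intro row_ok_insert_upd assms(2)) auto
  then show ?case by (simp only: list.map table_ok.simps) blast
next
  case (Cons pr T)
  obtain p r' where pr: "pr = (p, r')" by fastforce
  from Cons.prems obtain y g where y: "above lo y" "\<And>x. above lo x \<Longrightarrow> x < y \<Longrightarrow> row_ok \<pi> e P r x"
    "row_ok \<pi> e P p y" "g \<in> P" "length g \<ge> 2" "ev \<pi> e (last g) \<noteq> 0" "p g = 0" "table_ok \<pi> e P (Some y) r' T z"
    unfolding pr by auto
  have "(p(q := v p)) g = 0"
    using assms(2)[OF y(3)] y(3,4,7) by (auto simp: row_ok_def)
  moreover have "row_ok \<pi> e (insert q P) (p(q := v p)) y"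
    by (rule row_ok_insert_upd[OF y(3) assms(2)[OF y(3)]])
  moreover have "row_ok \<pi> e (insert q P) (r(q := v r)) x" if "above lo x" "x < y" for x
    by (rule row_ok_insert_upd[OF y(2)[OF that] assms(2)[OF y(2)[OF that]]])
  ultimately show ?case
    unfolding pr list.map case_prod_conv table_ok.simps using y(1,4,5,6) Cons.IH[OF y(8)] by blast
qed

text \<open>A constant sign that is zero would give the derivative infinitely many roots and hence a
  constant polynomial.\<close>

lemma pderiv_nonzero_on_interval:
  fixes Q :: "'k::rcf poly"
  assumes "\<And>x. above lo x \<Longrightarrow> below hi x \<Longrightarrow> sg (poly (pderiv Q) x) = s" "degree Q > 0"
    "above lo x" "below hi x"
  shows "poly (pderiv Q) x \<noteq> 0"
proof
  assume "poly (pderiv Q) x = 0"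
  then have "s = 0" using assms(1)[OF assms(3,4)] by simp
  obtain u where u: "u < x" "above lo u"
  proof (cases lo)
    case None
    then show ?thesis using that lt_ex[of x] by auto
  next
    case (Some a)
    then show ?thesis using that assms(3) dense[of a x] by auto
  qed
  have "{u<..<x} \<subseteq> {y. poly (pderiv Q) y = 0}"
  proof
    fix y assume y: "y \<in> {u<..<x}"
    have "above lo y" using u y by (cases lo) auto
    moreover have "below hi y" using assms(4) y by (cases hi) auto
    ultimately show "y \<in> {y. poly (pderiv Q) y = 0}" using assms(1)[of y] \<open>s = 0\<close> by simp
  qed
  moreover have "infinite {u<..<x}" using u(1) by (simp add: infinite_Ioo)
  ultimately have "pderiv Q = 0" using poly_roots_finite finite_subset by blast
  then show False using assms(2) by (simp add: pderiv_eq_0_iff)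
qed

text \<open>The derivative belongs to the family and therefore keeps a nonzero sign on each
  interval. So \<open>q\<close> is strictly monotone there and has a root inside exactly when its
  end signs are opposite; that root splits the interval without affecting the other columns.\<close>

lemma table_ok_add_root_col:
  fixes e :: "nat \<Rightarrow> 'k::rcf"
  assumes "table_ok \<pi> e P lo r T z"
    and v: "\<And>p y. row_ok \<pi> e P p y \<Longrightarrow> \<exists>g\<in>P. length g \<ge> 2 \<and> ev \<pi> e (last g) \<noteq> 0 \<and> p g = 0 \<Longrightarrow>
      v p = sg (poly (psem \<pi> e q) y)"
    and q: "pder q \<in> P" "length q \<ge> 2" "ev \<pi> e (last q) \<noteq> 0"
    and si: "right_sign (psem \<pi> e q) None si"
    and sl: "left_sign (psem \<pi> e q) lo sl"
  shows "case add_root_col q v si sl r T of (r2, T2) \<Rightarrow> table_ok \<pi> e (insert q P) lo r2 T2 z"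
  using assms(1) sl
proof (induction T arbitrary: lo r sl)
  case Nil
  let ?Q = "psem \<pi> e q"
  have deg: "degree ?Q > 0" using psem_lead(1)[of q \<pi> e] q by (cases q) auto
  have rows: "row_ok \<pi> e P r x" if "above lo x" for x using Nil.prems(1) that by simp
  have d: "poly (pderiv ?Q) x \<noteq> 0" if "above lo x" "below None x" for x
  proof (rule pderiv_nonzero_on_interval[OF _ deg that])
    fix x assume "above lo x" "below None x"
    then show "sg (poly (pderiv ?Q) x) = r (pder q)"
      using rows q(1) by (auto simp: row_ok_def psem_pder)
  qed
  obtain x0 where x0: "above lo x0" "below None x0"
    using above_below_nonempty[of None lo] by auto
  show ?case
  proof (cases "sl * si < 0")
    case True
    from root_between[OF Nil.prems(2) si d x0 True] obtain y where y: "above lo y" "poly ?Q y = 0" by auto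
    have "sg (poly ?Q x) = sl" if "above lo x" "x < y" for x
    proof -
      have "sg (poly ?Q x) = (if sl \<noteq> 0 then sl else 0)"
        by (rule sign_between[OF Nil.prems(2), of "Some y"]) (use d that y in \<open>auto simp: right_sign_def\<close>)
      then show ?thesis by (simp split: if_splits)
    qed
    moreover have "sg (poly ?Q x) = si" if "x > y" for x
    proof -
      have ab: "above lo x" if "x > y" for x using that y(1) by (cases lo) auto
      have "sg (poly ?Q x) = (if (0::int) \<noteq> 0 then 0 else si)"
        by (rule sign_between[OF _ si, of "Some y"]) (use d that y ab in \<open>auto simp: left_sign_def\<close>)
      then show ?thesis by simp
    qed
    moreover have "above lo x" if "x > y" for x using that y(1) by (cases lo) auto
    ultimately show ?thesis using True y rows q
      by (auto intro!: exI[of _ y] row_ok_insert_upd)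
  next
    case False
    have "sg (poly ?Q x) = (if sl \<noteq> 0 then sl else si)" if "above lo x" for x
      by (rule sign_between[OF Nil.prems(2) si d]) (use that False in auto)
    then show ?thesis using False rows by (auto intro!: row_ok_insert_upd)
  qed
next
  case (Cons pr T)
  let ?Q = "psem \<pi> e q"
  obtain p r' where pr: "pr = (p, r')" by fastforce
  from Cons.prems obtain y0 where y0: "above lo y0" "\<And>x. above lo x \<Longrightarrow> x < y0 \<Longrightarrow> row_ok \<pi> e P r x"
    "row_ok \<pi> e P p y0" "\<exists>g\<in>P. length g \<ge> 2 \<and> ev \<pi> e (last g) \<noteq> 0 \<and> p g = 0" "table_ok \<pi> e P (Some y0) r' T z"
    unfolding pr by auto
  have vp: "v p = sg (poly ?Q y0)" by (rule v[OF y0(3,4)])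
  obtain r2 T2 where rT: "add_root_col q v si (v p) r' T = (r2, T2)" by fastforce
  have "left_sign ?Q (Some y0) (v p)" using vp by (simp add: left_sign_def)
  from Cons.IH[OF y0(5) this] rT have ok2: "table_ok \<pi> e (insert q P) (Some y0) r2 T2 z" by simp
  have deg: "degree ?Q > 0" using psem_lead(1)[of q \<pi> e] q by (cases q) auto
  have d: "poly (pderiv ?Q) x \<noteq> 0" if "above lo x" "below (Some y0) x" for x
  proof (rule pderiv_nonzero_on_interval[OF _ deg that])
    fix x assume "above lo x" "below (Some y0) x"
    then show "sg (poly (pderiv ?Q) x) = r (pder q)"
      using y0(2) q(1) by (auto simp: row_ok_def psem_pder)
  qed
  obtain x0 where x0: "above lo x0" "below (Some y0) x0"
    using above_below_nonempty[of "Some y0" lo] y0(1) by auto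
  have rs: "right_sign ?Q (Some y0) (v p)" using vp by (simp add: right_sign_def)
  have g': "\<exists>g\<in>insert q P. length g \<ge> 2 \<and> ev \<pi> e (last g) \<noteq> 0 \<and> (p(q := v p)) g = 0"
    using y0(3,4) vp by (auto simp: row_ok_def)
  have py: "row_ok \<pi> e (insert q P) (p(q := v p)) y0" by (rule row_ok_insert_upd[OF y0(3) vp])
  show ?case
  proof (cases "sl * v p < 0")
    case True
    from root_between[OF Cons.prems(2) rs d x0 True] obtain y where y: "above lo y" "y < y0" "poly ?Q y = 0" by auto
    have "sg (poly ?Q x) = sl" if "above lo x" "x < y" for x
    proof -
      have "sg (poly ?Q x) = (if sl \<noteq> 0 then sl else 0)"
        by (rule sign_between[OF Cons.prems(2), of "Some y"]) (use d that y in \<open>auto simp: right_sign_def\<close>)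
      then show ?thesis by (simp split: if_splits)
    qed
    then have a1: "\<forall>x. above lo x \<and> x < y \<longrightarrow> row_ok \<pi> e (insert q P) (r(q := sl)) x"
      using y0(2) y by (auto intro!: row_ok_insert_upd)
    have ab: "above lo x" if "x > y" for x using that y(1) by (cases lo) auto
    have "sg (poly ?Q x) = v p" if "x > y" "x < y0" for x
    proof -
      have "sg (poly ?Q x) = (if (0::int) \<noteq> 0 then 0 else v p)"
        by (rule sign_between[OF _ rs, of "Some y"]) (use d that y ab in \<open>auto simp: left_sign_def\<close>)
      then show ?thesis by simp
    qed
    then have a2: "\<forall>x. above (Some y) x \<and> x < y0 \<longrightarrow> row_ok \<pi> e (insert q P) (r(q := v p)) x"
      using y0(2) ab by (auto intro!: row_ok_insert_upd)
    have a3: "row_ok \<pi> e (insert q P) (r(q := 0)) y"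
      using y0(2)[OF y(1,2)] y(3) by (auto intro!: row_ok_insert_upd)
    have "table_ok \<pi> e (insert q P) (Some y) (r(q := v p)) ((p(q := v p), r2) # T2) z"
      unfolding table_ok.simps using a2 y(2) py g' ok2 by (intro exI[of _ y0]) auto
    moreover have "\<exists>g\<in>insert q P. length g \<ge> 2 \<and> ev \<pi> e (last g) \<noteq> 0 \<and> (r(q := 0)) g = 0"
      using q by auto
    ultimately have "table_ok \<pi> e (insert q P) lo (r(q := sl)) ((r(q := 0), r(q := v p)) # (p(q := v p), r2) # T2) z"
      unfolding table_ok.simps(2)[of _ _ _ lo] using a1 a3 y(1) by blast
    then show ?thesis using True by (simp add: pr rT del: table_ok.simps)
  next
    case False
    have "sg (poly ?Q x) = (if sl \<noteq> 0 then sl else v p)" if "above lo x" "x < y0" for x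
      by (rule sign_between[OF Cons.prems(2) rs d]) (use that False in auto)
    then have "\<forall>x. above lo x \<and> x < y0 \<longrightarrow> row_ok \<pi> e (insert q P) (r(q := if sl \<noteq> 0 then sl else v p)) x"
      using y0(2) by (blast intro: row_ok_insert_upd[OF _ sym])
    then have "table_ok \<pi> e (insert q P) lo (r(q := if sl \<noteq> 0 then sl else v p)) ((p(q := v p), r2) # T2) z"
      unfolding table_ok.simps(2)[of _ _ _ lo] using y0(1) py g' ok2 by blast
    then show ?thesis using False by (simp add: pr rT del: table_ok.simps)
  qed
qed

lemma table_ok_sign_table:
  fixes e :: "nat \<Rightarrow> 'k::rcf"
  assumes "good d" "\<And>q. q \<in> set d \<Longrightarrow> q \<noteq> [] \<Longrightarrow> s (last q) = sg (ev \<pi> e (last q))"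
  shows "case sign_table s d of (r, T) \<Rightarrow> table_ok \<pi> e (set d) None r T z"
  using assms
proof (induction d)
  case Nil
  then show ?case by (simp add: row_ok_def)
next
  case (Cons q d)
  obtain r T where rT: "sign_table s d = (r, T)" by fastforce
  with Cons have ok: "table_ok \<pi> e (set d) None r T z" by auto
  let ?Q = "psem \<pi> e q"
  show ?case
  proof (cases "length q \<ge> 2 \<and> s (last q) \<noteq> 0")
    case True
    then have q: "q \<noteq> []" "length q \<ge> 2" by auto
    then have sq: "s (last q) = sg (ev \<pi> e (last q))" using Cons.prems(2)[of q] by auto
    then have l: "ev \<pi> e (last q) \<noteq> 0" using True by auto
    note lead = psem_lead[OF q(1) l]
    have Q0: "?Q \<noteq> 0" using lead l by auto
    have si: "right_sign ?Q None (s (last q))"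
      using sg_poly_at_top[OF Q0] lead sq True by (auto simp: right_sign_def)
    have sl: "left_sign ?Q None ((- 1) ^ (length q - 1) * s (last q))"
    proof -
      have "(- 1) ^ (length q - 1) * s (last q) = (- 1) ^ degree ?Q * sg (lead_coeff ?Q)"
        unfolding lead(2) unfolding lead(1) sq ..
      then show ?thesis using sg_poly_at_bot[OF Q0] True Q0 by (simp add: left_sign_def)
    qed
    have pd: "pder q \<in> set d" using Cons.prems(1) True by auto
    have v: "point_sign s d q p = sg (poly ?Q y)"
      if ro: "row_ok \<pi> e (set d) p y" and ex: "\<exists>g\<in>set d. length g \<ge> 2 \<and> ev \<pi> e (last g) \<noteq> 0 \<and> p g = 0" for p y
    proof -
      define g where "g = (SOME g. g \<in> set d \<and> length g \<ge> 2 \<and> s (last g) \<noteq> 0 \<and> p g = 0)"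
      obtain g0 where g0: "g0 \<in> set d" "length g0 \<ge> 2" "ev \<pi> e (last g0) \<noteq> 0" "p g0 = 0" using ex by blast
      have "g0 \<noteq> []" using g0(2) by auto
      then have "s (last g0) \<noteq> 0" using Cons.prems(2)[of g0] g0 by simp
      then have g: "g \<in> set d \<and> length g \<ge> 2 \<and> s (last g) \<noteq> 0 \<and> p g = 0"
        unfolding g_def using g0 by (intro someI[of "\<lambda>g. g \<in> set d \<and> length g \<ge> 2 \<and> s (last g) \<noteq> 0 \<and> p g = 0" g0]) auto
      then have g1: "g \<noteq> []" by auto
      then have "ev \<pi> e (last g) \<noteq> 0" using Cons.prems(2)[of g] g by auto
      moreover have "poly (psem \<pi> e g) y = 0" using ro g by (auto simp: row_ok_def)
      ultimately have "sg (poly (psem \<pi> e (prem q g)) y) = sg (poly ?Q y)"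
        using g1 by (intro sg_prem) auto
      moreover have "prem q g \<in> set d" using Cons.prems(1) g True by auto
      ultimately show ?thesis using ro by (simp add: point_sign_def g_def[symmetric] row_ok_def)
    qed
    from table_ok_add_root_col[OF ok v pd _ l si sl] q
    show ?thesis using True by (simp add: rT)
  next
    case False
    define v :: "'a sgrow \<Rightarrow> int" where "v = (\<lambda>p. if q = [] then 0 else if length q = 1 then s (last q) else p (butlast q))"
    have "v p = sg (poly ?Q x)" if ro: "row_ok \<pi> e (set d) p x" for p x
    proof (cases "length q \<ge> 2")
      case True
      then have q: "q \<noteq> []" by auto
      then have "ev \<pi> e (last q) = 0" using False True Cons.prems(2)[of q] by auto
      then have "?Q = psem \<pi> e (butlast q)" using psem_butlast[OF q, of \<pi> e] by simp
      moreover have "butlast q \<in> set d" using Cons.prems(1) True by auto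
      moreover have "v p = p (butlast q)" using True by (auto simp: v_def)
      ultimately show ?thesis using ro by (simp add: row_ok_def)
    next
      case short: False
      then consider "q = []" | c where "q = [c]" by (cases q) (auto simp: Suc_le_eq)
      then show ?thesis
      proof cases
        case 2
        then show ?thesis using Cons.prems(2)[of q] by (simp add: v_def)
      qed (simp add: v_def)
    qed
    then have t: "table_ok \<pi> e (insert q (set d)) None (r(q := v r)) (map (\<lambda>(p, r'). (p(q := v p), r'(q := v r'))) T) z"
      by (rule table_ok_map[OF ok])
    have "sign_table s (q # d) = (r(q := v r), map (\<lambda>(p, r'). (p(q := v p), r'(q := v r'))) T)"
      unfolding sign_table.simps rT Let_def case_prod_conv if_not_P[OF False] v_def by (rule refl)
    then show ?thesis using t by (simp only: list.set prod.case)
  qed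
qed

text \<open>The rows are exactly the sign vectors that occur, so an existential quantifier becomes a
  search through the rows.\<close>

lemma table_rows_realized:
  fixes e :: "nat \<Rightarrow> 'k::linordered_field"
  assumes "table_ok \<pi> e P lo r T z"
  shows "(\<forall>x. above lo x \<longrightarrow> (\<exists>p\<in>rows (r, T). row_ok \<pi> e P p x)) \<and> (\<forall>p\<in>rows (r, T). \<exists>x. above lo x \<and> row_ok \<pi> e P p x)"
  using assms
proof (induction T arbitrary: lo r)
  case Nil
  then show ?case using above_below_nonempty[of None lo] by auto
next
  case (Cons pr T)
  obtain p r' where pr: "pr = (p, r')" by fastforce
  from Cons.prems obtain y where y: "above lo y" "\<And>x. above lo x \<Longrightarrow> x < y \<Longrightarrow> row_ok \<pi> e P r x"
    "row_ok \<pi> e P p y" "table_ok \<pi> e P (Some y) r' T z"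
    unfolding pr by auto
  note IH = Cons.IH[OF y(4)]
  have up: "above lo x" if "y < x" for x using that y(1) by (cases lo) auto
  obtain x0 where x0: "above lo x0" "x0 < y" using above_below_nonempty[of "Some y" lo] y(1) by auto
  have R: "rows (r, pr # T) = insert r (insert p (rows (r', T)))" by (auto simp: pr)
  show ?case unfolding R
  proof (intro conjI allI impI ballI)
    fix x assume "above lo x"
    then show "\<exists>p'\<in>insert r (insert p (rows (r', T))). row_ok \<pi> e P p' x"
      using y(2,3) IH by (cases x y rule: linorder_cases) (auto simp del: rows.simps)
  next
    fix p' assume "p' \<in> insert r (insert p (rows (r', T)))"
    moreover have "\<exists>x. above lo x \<and> row_ok \<pi> e P p' x" if "p' \<in> rows (r', T)"
      using IH that up by (meson above.simps(2))
    ultimately show "\<exists>x. above lo x \<and> row_ok \<pi> e P p' x"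
      using x0 y by (auto simp del: rows.simps)
  qed
qed

subsection \<open>Quantifier elimination without valuation\<close>

text \<open>The sign table depends only on the signs of finitely many coefficients. A formula is
  obtained by distinguishing these signs, with \<open>F\<close> evaluated outside the logic in each
  branch.\<close>

fun case_signs :: "'a tm list \<Rightarrow> (('a tm \<Rightarrow> int) \<Rightarrow> bool) \<Rightarrow> ('a tm \<Rightarrow> int) \<Rightarrow> 'a fm" where
  "case_signs [] F s = (if F s then FTrue else FFalse)"
| "case_signs (t # ts) F s = FOr (FAnd (Pos t) (case_signs ts F (s(t := 1))))
     (FOr (FAnd (Pos (TNeg t)) (case_signs ts F (s(t := - 1))))
       (FAnd (FAnd (FNot (Pos t)) (FNot (Pos (TNeg t)))) (case_signs ts F (s(t := 0)))))"

lemma case_signs: "holds V \<pi> e (case_signs ts F s) \<longleftrightarrow> F (\<lambda>t. if t \<in> set ts then sg (ev \<pi> e t) else s t)"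
proof (induction ts arbitrary: s)
  case (Cons t ts)
  have eq: "(\<lambda>u. if u \<in> set ts then sg (ev \<pi> e u) else (s(t := k)) u)
      = (\<lambda>u. if u = t \<or> u \<in> set ts then sg (ev \<pi> e u) else s u)" if "sg (ev \<pi> e t) = k" for k
    using that by auto
  consider "ev \<pi> e t > 0" | "ev \<pi> e t < 0" | "ev \<pi> e t = 0" by fastforce
  then show ?case
  proof cases
    case 1
    then show ?thesis using eq[of 1] by (simp add: Cons.IH)
  next
    case 2
    then show ?thesis using eq[of "- 1"] by (simp add: Cons.IH)
  next
    case 3
    then show ?thesis using eq[of 0] by (simp add: Cons.IH)
  qed
qed simp

lemma case_signs_simple: "qf (case_signs ts F s) \<and> vfree (case_signs ts F s)"
  by (induction ts arbitrary: s) auto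

primrec atoms :: "'a fm \<Rightarrow> 'a tm list" where
  "atoms FTrue = []"
| "atoms (Pos t) = [t]"
| "atoms (Vle s t) = []"
| "atoms (FNot f) = atoms f"
| "atoms (FAnd f g) = atoms f @ atoms g"
| "atoms (FEx n f) = []"

primrec beval :: "('a tm \<Rightarrow> int) \<Rightarrow> 'a fm \<Rightarrow> bool" where
  "beval s FTrue \<longleftrightarrow> True"
| "beval s (Pos t) \<longleftrightarrow> s t = 1"
| "beval s (Vle t u) \<longleftrightarrow> False"
| "beval s (FNot f) \<longleftrightarrow> \<not> beval s f"
| "beval s (FAnd f g) \<longleftrightarrow> beval s f \<and> beval s g"
| "beval s (FEx n f) \<longleftrightarrow> False"

lemma beval:
  "qf f \<Longrightarrow> vfree f \<Longrightarrow> (\<And>t. t \<in> set (atoms f) \<Longrightarrow> s t = sg (ev \<pi> e t)) \<Longrightarrow> beval s f \<longleftrightarrow> holds V \<pi> e f"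
  by (induction f) auto

definition sign_family :: "'a tm list list \<Rightarrow> 'a tm list list" where
  "sign_family ps = (SOME d. good d \<and> set ps \<subseteq> set d)"

lemma sign_family: "good (sign_family ps)" "set ps \<subseteq> set (sign_family ps)"
proof -
  have "good (sign_family ps) \<and> set ps \<subseteq> set (sign_family ps)"
    unfolding sign_family_def by (rule someI_ex) (rule good_list_exists, simp)
  then show "good (sign_family ps)" "set ps \<subseteq> set (sign_family ps)" by auto
qed

text \<open>Among the coefficients, \<open>sign_table\<close> inspects only the last entries of
  nonempty lists, so these are the terms to be distinguished.\<close>

definition elim_var :: "nat \<Rightarrow> 'a fm \<Rightarrow> 'a fm" where
  "elim_var n f = (let d = sign_family (map (cf n) (atoms f)) in
     case_signs (map last (filter (\<lambda>q. q \<noteq> []) d))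
       (\<lambda>s. \<exists>p\<in>rows (sign_table s d). beval (\<lambda>t. p (cf n t)) f) (\<lambda>_. 0))"

lemma holds_elim_var:
  fixes e :: "nat \<Rightarrow> 'k::rcf"
  assumes "qf f" "vfree f"
  shows "holds V \<pi> e (elim_var n f) \<longleftrightarrow> (\<exists>x. holds V \<pi> (e(n := x)) f)"
proof -
  define d where "d = sign_family (map (cf n) (atoms f))"
  define s where "s = (\<lambda>t. if t \<in> set (map last (filter (\<lambda>q. q \<noteq> []) d)) then sg (ev \<pi> e t) else 0)"
  have d: "good d" "\<And>t. t \<in> set (atoms f) \<Longrightarrow> cf n t \<in> set d"
    using sign_family[of "map (cf n) (atoms f)"] by (auto simp: d_def)
  obtain r T where rT: "sign_table s d = (r, T)" by fastforce
  have "s (last q) = sg (ev \<pi> e (last q))" if "q \<in> set d" "q \<noteq> []" for q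
    using that by (auto simp: s_def)
  from table_ok_sign_table[OF d(1) this, of 0] rT have "table_ok \<pi> e (set d) None r T 0" by simp
  note R = table_rows_realized[OF this]
  have b: "beval (\<lambda>t. p (cf n t)) f \<longleftrightarrow> holds V \<pi> (e(n := x)) f" if "row_ok \<pi> e (set d) p x" for p x
    by (rule beval[OF assms]) (use that d(2) in \<open>auto simp: row_ok_def poly_cf\<close>)
  have "holds V \<pi> e (elim_var n f) \<longleftrightarrow> (\<exists>p\<in>rows (r, T). beval (\<lambda>t. p (cf n t)) f)"
    unfolding elim_var_def Let_def case_signs d_def[symmetric] s_def[symmetric] rT ..
  also have "\<dots> \<longleftrightarrow> (\<exists>x. holds V \<pi> (e(n := x)) f)"
    using R b by (metis above.simps(1))
  finally show ?thesis .
qed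

primrec rqe :: "'a fm \<Rightarrow> 'a fm" where
  "rqe FTrue = FTrue"
| "rqe (Pos t) = Pos t"
| "rqe (Vle s t) = Vle s t"
| "rqe (FNot f) = FNot (rqe f)"
| "rqe (FAnd f g) = FAnd (rqe f) (rqe g)"
| "rqe (FEx n f) = elim_var n (rqe f)"

lemma rqe_simple: "vfree f \<Longrightarrow> qf (rqe f) \<and> vfree (rqe f)"
  by (induction f) (auto simp: elim_var_def Let_def case_signs_simple)

lemma holds_rqe:
  fixes e :: "nat \<Rightarrow> 'k::rcf"
  shows "vfree f \<Longrightarrow> holds V \<pi> e (rqe f) \<longleftrightarrow> holds V \<pi> e f"
  by (induction f arbitrary: e) (auto simp: holds_elim_var rqe_simple)

subsection \<open>Convex valuation rings\<close>

definition convex_ring :: "'k::linordered_field set \<Rightarrow> bool" where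
  "convex_ring V \<longleftrightarrow> 1 \<in> V \<and> (\<forall>x\<in>V. \<forall>y\<in>V. x + y \<in> V \<and> x * y \<in> V)
     \<and> (\<forall>x y. y \<in> V \<and> \<bar>x\<bar> \<le> \<bar>y\<bar> \<longrightarrow> x \<in> V)"

locale convex_valuation =
  fixes V :: "'k::rcf set"
  assumes V: "convex_ring V"
begin

abbreviation dom :: "'k \<Rightarrow> 'k \<Rightarrow> bool" (infix \<open>\<succeq>\<close> 50) where
  "x \<succeq> y \<equiv> vdom V x y"

lemma V_one: "1 \<in> V" and V_add: "x \<in> V \<Longrightarrow> y \<in> V \<Longrightarrow> x + y \<in> V"
  and V_mult: "x \<in> V \<Longrightarrow> y \<in> V \<Longrightarrow> x * y \<in> V"
  and V_convex: "y \<in> V \<Longrightarrow> \<bar>x\<bar> \<le> \<bar>y\<bar> \<Longrightarrow> x \<in> V"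
  using V unfolding convex_ring_def by blast+

lemma dom_0_left [simp]: "0 \<succeq> y \<longleftrightarrow> y = 0"
  and dom_0_right [simp]: "x \<succeq> 0"
  by (auto simp: vdom_def)

text \<open>Convexity enters here: the order of absolute values refines the valuation. Totality
  follows from it.\<close>

lemma dom_le: "\<bar>y\<bar> \<le> \<bar>x\<bar> \<Longrightarrow> x \<succeq> y"
  by (cases "x = 0") (auto simp: vdom_def intro!: V_convex[OF V_one])

lemma dom_refl [simp]: "x \<succeq> x"
  by (rule dom_le) simp

lemma dom_total: "x \<succeq> y \<or> y \<succeq> x"
  using dom_le[of x y] dom_le[of y x] by linarith

lemma dom_trans: "x \<succeq> y \<Longrightarrow> y \<succeq> z \<Longrightarrow> x \<succeq> z"
proof (cases "z = 0")
  case False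
  assume a: "x \<succeq> y" "y \<succeq> z"
  then have "y \<noteq> 0" using False by auto
  then have "x \<noteq> 0" using a by auto
  have "z / x = (y / x) * (z / y)" using \<open>y \<noteq> 0\<close> by simp
  then show ?thesis using a False \<open>y \<noteq> 0\<close> \<open>x \<noteq> 0\<close> V_mult[of "y / x" "z / y"] by (auto simp: vdom_def)
qed auto

lemma dom_add: "x \<succeq> y \<Longrightarrow> x \<succeq> z \<Longrightarrow> x \<succeq> y + z"
proof (cases "x = 0 \<or> y = 0 \<or> z = 0")
  case False
  assume "x \<succeq> y" "x \<succeq> z"
  then show ?thesis using False V_add[of "y / x" "z / x"] by (auto simp: vdom_def add_divide_distrib)
qed auto

lemma dom_sum: "(\<And>i. i \<in> A \<Longrightarrow> x \<succeq> f i) \<Longrightarrow> x \<succeq> sum f A"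
  by (induction A rule: infinite_finite_induct) (auto intro: dom_add)

lemma dom_mult: "x \<succeq> y \<Longrightarrow> z \<succeq> u \<Longrightarrow> x * z \<succeq> y * u"
proof (cases "y = 0 \<or> u = 0")
  case False
  assume "x \<succeq> y" "z \<succeq> u"
  then show ?thesis using False V_mult[of "y / x" "u / z"] by (auto simp: vdom_def)
qed auto

lemma dom_cancel: "z \<noteq> 0 \<Longrightarrow> x * z \<succeq> y * z \<longleftrightarrow> x \<succeq> y"
  by (auto simp: vdom_def)

lemma dom_abs [simp]: "\<bar>x\<bar> \<succeq> y \<longleftrightarrow> x \<succeq> y" "x \<succeq> \<bar>y\<bar> \<longleftrightarrow> x \<succeq> y"
proof -
  have "\<bar>z\<bar> \<succeq> z" "z \<succeq> \<bar>z\<bar>" for z by (auto intro: dom_le)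
  then show "\<bar>x\<bar> \<succeq> y \<longleftrightarrow> x \<succeq> y" "x \<succeq> \<bar>y\<bar> \<longleftrightarrow> x \<succeq> y"
    by (blast intro: dom_trans)+
qed

text \<open>Together with \<open>of_nat_dom\<close>: positive integers are units of a convex ring.
  Hence factorials and other integer factors never influence a valuation comparison.\<close>

lemma dom_of_nat: "x \<succeq> of_nat n * x"
proof -
  have "of_nat n \<in> V" by (induction n) (auto intro: V_add V_one V_convex[OF V_one])
  then show ?thesis by (auto simp: vdom_def)
qed

lemma of_nat_dom: "n > 0 \<Longrightarrow> of_nat n * x \<succeq> x"
proof (rule dom_le)
  assume "n > 0"
  then have "(1::'k) \<le> of_nat n" by (metis of_nat_1 of_nat_le_iff Suc_leI One_nat_def)
  then have "1 * \<bar>x\<bar> \<le> of_nat n * \<bar>x\<bar>" by (intro mult_right_mono) auto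
  then show "\<bar>x\<bar> \<le> \<bar>of_nat n * x\<bar>" by (simp add: abs_mult)
qed

lemma dom_power_mono: "x \<succeq> y \<Longrightarrow> x ^ m \<succeq> y ^ m"
  by (induction m) (auto intro: dom_mult)

lemma V_power_iff: "m > 0 \<Longrightarrow> x ^ m \<in> V \<longleftrightarrow> x \<in> V"
proof
  assume m: "m > 0" "x ^ m \<in> V"
  show "x \<in> V"
  proof (cases "\<bar>x\<bar> \<le> 1")
    case True
    then show ?thesis using V_convex[OF V_one] by simp
  next
    case False
    then have "\<bar>x\<bar> \<le> \<bar>x\<bar> ^ m" using m by (intro self_le_power) auto
    then show ?thesis using V_convex[OF m(2), of x] by (simp add: power_abs)
  qed
next
  assume "x \<in> V"
  then show "x ^ m \<in> V" by (induction m) (auto intro: V_one V_mult)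
qed

lemma dom_power_iff: "m > 0 \<Longrightarrow> x ^ m \<succeq> y ^ m \<longleftrightarrow> x \<succeq> y"
  by (auto simp: vdom_def V_power_iff simp flip: power_divide)

lemma not_dom_less: "\<not> x \<succeq> y \<Longrightarrow> \<bar>x\<bar> < \<bar>y\<bar>"
  using dom_le[of y x] by linarith

lemma dom_max_exists:
  fixes f :: "nat \<Rightarrow> 'k"
  shows "\<exists>i\<le>n. \<forall>j\<le>n. f i \<succeq> f j"
proof (induction n)
  case (Suc n)
  then obtain i where i: "i \<le> n" "\<forall>j\<le>n. f i \<succeq> f j" by blast
  show ?case
  proof (cases "f i \<succeq> f (Suc n)")
    case True
    then show ?thesis using i by (intro exI[of _ i]) (auto simp: le_Suc_eq)
  next
    case False
    then have "f (Suc n) \<succeq> f i" using dom_total by blast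
    then show ?thesis using i by (intro exI[of _ "Suc n"]) (auto simp: le_Suc_eq intro: dom_trans)
  qed
qed auto

end

subsection \<open>Dominant Taylor coefficients\<close>

lemma higher_pderiv_shift:
  fixes p :: "'k::field_char_0 poly"
  shows "(pderiv ^^ j) (pcompose p [:x, 1:]) = pcompose ((pderiv ^^ j) p) [:x, 1:]"
  by (induction j) (auto simp: pderiv_pcompose pderiv_pCons)

lemma poly_taylor:
  fixes p :: "'k::field_char_0 poly"
  assumes "degree p \<le> n"
  shows "poly p (x + s) = (\<Sum>j\<le>n. poly ((pderiv ^^ j) p) x / fact j * s ^ j)"
proof -
  define q where "q = pcompose p [:x, 1:]"
  have "degree q \<le> n" using assms by (simp add: q_def degree_pcompose)
  have c: "coeff q j = poly ((pderiv ^^ j) p) x / fact j" for j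
  proof -
    have "poly ((pderiv ^^ j) p) x = coeff ((pderiv ^^ j) q) 0"
      unfolding q_def higher_pderiv_shift by (simp add: poly_pcompose flip: poly_0_coeff_0)
    also have "\<dots> = fact j * coeff q j"
      by (simp add: coeff_higher_pderiv pochhammer_fact)
    finally show ?thesis by simp
  qed
  have "poly p (x + s) = poly q s" by (simp add: q_def poly_pcompose algebra_simps)
  also have "\<dots> = (\<Sum>j\<le>n. coeff q j * s ^ j)"
    using \<open>degree q \<le> n\<close> by (rule poly_as_sum_of_monoms'[THEN arg_cong, of _ _ "\<lambda>q. poly q s", symmetric, simplified poly_sum poly_monom])
  finally show ?thesis by (simp add: c)
qed

context convex_valuation
begin

definition isolated :: "'k poly set \<Rightarrow> 'k \<Rightarrow> 'k \<Rightarrow> bool" where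
  "isolated D x t \<longleftrightarrow> (\<forall>q\<in>D. \<forall>r. q \<noteq> 0 \<and> poly q r = 0 \<longrightarrow> x - r \<succeq> t)"

lemma fact_dom: "x / fact j \<succeq> x" "x \<succeq> x / fact j"
proof -
  have "fact j * (x / fact j) = x" by simp
  then show "x / fact j \<succeq> x" using dom_of_nat[of "x / fact j" "fact j"] by simp
  show "x \<succeq> x / fact j" using of_nat_dom[of "fact j" "x / fact j"] by simp
qed

text \<open>Newton's method: if \<open>poly p x\<close> were too small, then \<open>p\<close> would change sign between
  \<open>x\<close> and \<open>x - 2 * h\<close>, where \<open>h\<close> is the Newton correction at \<open>x\<close>.\<close>
lemma dom_derivative:
  assumes closed: "\<And>q. q \<in> D \<Longrightarrow> pderiv q \<in> D" and iso: "isolated D x t" and t: "t \<noteq> 0" and p: "p \<in> D"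
  shows "poly p x \<succeq> poly ((pderiv ^^ j) p) x * t ^ j"
  using p
proof (induction "degree p" arbitrary: p j rule: less_induct)
  case less
  show ?case
  proof (cases "degree p = 0")
    case True
    then have "pderiv p = 0" by (simp add: pderiv_eq_0_iff)
    then have "(pderiv ^^ j) p = (if j = 0 then p else 0)"
      by (induction j) auto
    then show ?thesis by simp
  next
    case False
    then have "degree (pderiv p) < degree p" by (simp add: degree_pderiv)
    from less.hyps[OF this closed[OF less.prems]]
    have IH: "poly (pderiv p) x \<succeq> poly ((pderiv ^^ Suc j) p) x * t ^ j" for j
      by (simp add: funpow_Suc_right del: funpow.simps)
    define A where "A = poly (pderiv p) x"
    have main: "poly p x \<succeq> A * t"
    proof (rule ccontr)
      assume n: "\<not> ?thesis"
      then have A0: "A \<noteq> 0" by auto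
      have px0: "poly p x \<noteq> 0"
      proof
        assume "poly p x = 0"
        then have "x - x \<succeq> t" using iso less.prems False unfolding isolated_def by (metis degree_0)
        then show False using t by simp
      qed
      define h where "h = poly p x / A"
      have ph: "poly p x = h * A" and h0: "h \<noteq> 0" using A0 px0 by (auto simp: h_def)
      have nh: "\<not> h \<succeq> t" using n A0 dom_cancel[of A h t] by (simp add: ph mult.commute)
      \<comment> \<open>The Taylor terms of order at least two at x - 2h. By the induction
        hypothesis for the derivative, each is dominated by A h (h/t). The step 2h instead of h
        keeps the constant and linear terms from cancelling.\<close>
      define E where "E = (\<Sum>j\<in>{2..degree p}. poly ((pderiv ^^ j) p) x / fact j * (- 2 * h) ^ j)"
      have "poly p (x + - 2 * h) = (\<Sum>j\<le>degree p. poly ((pderiv ^^ j) p) x / fact j * (- 2 * h) ^ j)"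
        by (rule poly_taylor) simp
      also have "{..degree p} = {0, 1} \<union> {2..degree p}" using False by auto
      also have "(\<Sum>j\<in>\<dots>. poly ((pderiv ^^ j) p) x / fact j * (- 2 * h) ^ j) = poly p x - 2 * h * A + E"
        unfolding E_def by (subst sum.union_disjoint) (auto simp: A_def)
      finally have val: "poly p (x - 2 * h) = - (h * A) + E" by (simp add: ph)
      have E: "A * h * (h / t) \<succeq> E"
        unfolding E_def
      proof (rule dom_sum)
        fix j assume "j \<in> {2..degree p}"
        then obtain k where k: "j = Suc (Suc k)" by (metis atLeastAtMost_iff add_2_eq_Suc le_Suc_ex)
        have "A \<succeq> poly ((pderiv ^^ j) p) x * t ^ Suc k" using IH[of "Suc k"] by (simp add: A_def k)
        then have "A * (h * (h / t) ^ Suc k) \<succeq> poly ((pderiv ^^ j) p) x * t ^ Suc k * (h * (h / t) ^ Suc k)"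
          by (rule dom_mult) simp
        also have "poly ((pderiv ^^ j) p) x * t ^ Suc k * (h * (h / t) ^ Suc k) = poly ((pderiv ^^ j) p) x * h ^ j"
          using t by (simp add: k power_divide)
        finally have a: "A * (h * (h / t) ^ Suc k) \<succeq> poly ((pderiv ^^ j) p) x * h ^ j" .
        have "\<bar>h / t\<bar> \<le> 1" using not_dom_less[OF nh] t by simp
        then have "(1::'k) \<succeq> (h / t) ^ k"
          by (intro dom_le) (auto simp: power_abs intro: power_le_one)
        then have "A * h * (h / t) * 1 \<succeq> A * h * (h / t) * (h / t) ^ k" by (intro dom_mult) auto
        then have "A * h * (h / t) \<succeq> A * (h * (h / t) ^ Suc k)" by (simp add: algebra_simps)
        from dom_trans[OF this a] have b: "A * h * (h / t) \<succeq> poly ((pderiv ^^ j) p) x * h ^ j" .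
        have "(1::'k) \<succeq> (- 2) ^ j" using dom_of_nat[of 1 "2 ^ j"] by (metis dom_abs(2) abs_neg_numeral abs_numeral mult_1_right of_nat_numeral of_nat_power power_abs)
        from dom_mult[OF b this]
        have "A * h * (h / t) \<succeq> poly ((pderiv ^^ j) p) x * (- 2 * h) ^ j"
          unfolding power_mult_distrib by (simp only: mult_ac mult_1_left mult_1_right)
        from dom_trans[OF this fact_dom(2)[of _ j]]
        show "A * h * (h / t) \<succeq> poly ((pderiv ^^ j) p) x / fact j * (- 2 * h) ^ j"
          by simp
      qed
      \<comment> \<open>As h does not dominate t, the factor h/t makes E smaller than h A in
        valuation. So p(x - 2h) has the sign of -h A, opposite to that of p(x) = h A.\<close>
      have "\<bar>E\<bar> < \<bar>h * A\<bar>"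
      proof (rule ccontr)
        assume "\<not> ?thesis"
        then have "E \<succeq> h * A" by (intro dom_le) simp
        from dom_trans[OF E this] have "(h / t) * (h * A) \<succeq> 1 * (h * A)" by (simp add: algebra_simps)
        then have "h / t \<succeq> 1" using h0 A0 by (subst (asm) dom_cancel) auto
        then have "h / t * t \<succeq> 1 * t" using t by (subst dom_cancel) auto
        then show False using nh t by simp
      qed
      then have "(h * A) * (- (h * A) + E) < 0"
        by (cases "h * A > 0") (auto simp: mult_less_0_iff abs_if split: if_splits)
      then have neg: "poly p x * poly p (x - 2 * h) < 0" by (simp add: val ph)
      \<comment> \<open>The sign change produces a root at distance at most 2h from x, which
        contradicts the isolation of x.\<close>
      have "\<exists>r. \<bar>x - r\<bar> \<le> \<bar>2 * h\<bar> \<and> poly p r = 0"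
      proof (cases "h > 0")
        case True
        then have "x - 2 * h < x" by simp
        moreover have "poly p (x - 2 * h) * poly p x < 0" using neg by (simp add: mult.commute)
        ultimately obtain r where r: "x - 2 * h < r" "r < x" "poly p r = 0" using poly_IVT_sign by blast
        then have "\<bar>x - r\<bar> = x - r" "\<bar>2 * h\<bar> = 2 * h" "x - r \<le> 2 * h" using True by simp_all
        then show ?thesis using r(3) by (intro exI[of _ r]) simp
      next
        case False
        then have "x < x - 2 * h" using h0 by simp
        from poly_IVT_sign[OF this neg] obtain r where r: "x < r" "r < x - 2 * h" "poly p r = 0" by blast
        then have "\<bar>x - r\<bar> = r - x" "\<bar>2 * h\<bar> = - (2 * h)" "r - x \<le> - (2 * h)" using False by simp_all
        then show ?thesis using r(3) by (intro exI[of _ r]) simp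
      qed
      then obtain r where r: "\<bar>x - r\<bar> \<le> \<bar>2 * h\<bar>" "poly p r = 0" by blast
      have "h \<succeq> of_nat 2 * h" by (rule dom_of_nat)
      also have "of_nat 2 * h = 2 * h" by simp
      finally have "h \<succeq> 2 * h" .
      moreover have "2 * h \<succeq> x - r" using r(1) by (rule dom_le)
      moreover have "x - r \<succeq> t" using iso less.prems False r(2) unfolding isolated_def by (metis degree_0)
      ultimately show False using nh dom_trans by blast
    qed
    show ?thesis
    proof (cases j)
      case (Suc i)
      have "A * t \<succeq> poly ((pderiv ^^ Suc i) p) x * t ^ i * t"
        using IH[of i] by (intro dom_mult) (auto simp: A_def)
      then have "A * t \<succeq> poly ((pderiv ^^ j) p) x * t ^ j" by (simp add: Suc algebra_simps del: funpow.simps)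
      then show ?thesis using main dom_trans by blast
    qed simp
  qed
qed

lemma higher_pderiv_closed: "(\<And>q. q \<in> D \<Longrightarrow> pderiv q \<in> D) \<Longrightarrow> p \<in> D \<Longrightarrow> (pderiv ^^ j) p \<in> D"
  by (induction j) auto

text \<open>By \<open>dom_derivative\<close>, p(x) dominates all Taylor terms at x taken at distance
  t. Expanding the derivatives at c around x carries this over to the centre c.\<close>

lemma dom_taylor_term:
  assumes closed: "\<And>q. q \<in> D \<Longrightarrow> pderiv q \<in> D" and iso: "isolated D x t" and t: "t \<noteq> 0" and p: "p \<in> D"
    and xc: "\<bar>x - c\<bar> = \<bar>t\<bar>"
  shows "poly p x \<succeq> poly ((pderiv ^^ i) p) c * t ^ i"
proof -
  let ?q = "(pderiv ^^ i) p"
  have "poly ?q (x + (c - x)) = (\<Sum>j\<le>degree ?q. poly ((pderiv ^^ j) ?q) x / fact j * (c - x) ^ j)"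
    by (rule poly_taylor) simp
  moreover have "x + (c - x) = c" by simp
  ultimately have "poly ?q c * t ^ i = (\<Sum>j\<le>degree ?q. poly ((pderiv ^^ j) ?q) x / fact j * (c - x) ^ j) * t ^ i"
    by (simp only:)
  also have "\<dots> = (\<Sum>j\<le>degree ?q. poly ((pderiv ^^ j) ?q) x / fact j * (c - x) ^ j * t ^ i)"
    by (rule sum_distrib_right)
  finally have s: "poly ?q c * t ^ i = (\<Sum>j\<le>degree ?q. poly ((pderiv ^^ j) ?q) x / fact j * (c - x) ^ j * t ^ i)" .
  show ?thesis unfolding s
  proof (rule dom_sum)
    fix j
    have "poly p x \<succeq> poly ((pderiv ^^ (j + i)) p) x * t ^ (j + i)"
      by (rule dom_derivative[OF closed iso t p])
    then have a: "poly p x \<succeq> poly ((pderiv ^^ j) ?q) x * t ^ j * t ^ i"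
      unfolding funpow_add power_add by (simp add: mult.assoc)
    have "t ^ j \<succeq> (c - x) ^ j"
      using xc by (intro dom_power_mono dom_le) (simp add: abs_minus_commute)
    then have "poly ((pderiv ^^ j) ?q) x * t ^ j * t ^ i \<succeq> poly ((pderiv ^^ j) ?q) x * (c - x) ^ j * t ^ i"
      by (intro dom_mult) auto
    from dom_trans[OF a dom_trans[OF this fact_dom(2)[of _ j]]]
    show "poly p x \<succeq> poly ((pderiv ^^ j) ?q) x / fact j * (c - x) ^ j * t ^ i"
      by simp
  qed
qed

lemma taylor_terms_dom:
  assumes "degree p \<le> n" "\<And>i. i \<le> n \<Longrightarrow> y \<succeq> poly ((pderiv ^^ i) p) c * t ^ i" "\<bar>x - c\<bar> = \<bar>t\<bar>"
  shows "y \<succeq> poly p x"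
proof -
  have "poly p x = (\<Sum>j\<le>n. poly ((pderiv ^^ j) p) c / fact j * (x - c) ^ j)"
    using poly_taylor[OF assms(1), of c "x - c"] by simp
  moreover have term_dom: "y \<succeq> poly ((pderiv ^^ j) p) c / fact j * (x - c) ^ j" if "j \<in> {..n}" for j
  proof -
    have "t ^ j \<succeq> (x - c) ^ j" using assms(3) by (intro dom_power_mono dom_le) simp
    then have "poly ((pderiv ^^ j) p) c * t ^ j \<succeq> poly ((pderiv ^^ j) p) c * (x - c) ^ j" by (intro dom_mult) auto
    from dom_trans[OF assms(2) dom_trans[OF this fact_dom(2)[of _ j]]] that show ?thesis by simp
  qed
  moreover have "y \<succeq> (\<Sum>j\<le>n. poly ((pderiv ^^ j) p) c / fact j * (x - c) ^ j)"
    by (rule dom_sum) (rule term_dom)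
  ultimately show ?thesis by (simp only:)
qed

text \<open>At an isolated point the valuation of p(x) is the least valuation among the Taylor terms
  at c: no cancellation takes place. The comparison therefore depends on x only through the
  valuation of its distance from c.\<close>

lemma dom_iff_taylor:
  assumes closed: "\<And>q. q \<in> D \<Longrightarrow> pderiv q \<in> D" and iso: "isolated D x t" and t: "t \<noteq> 0"
    and pq: "p \<in> D" "q \<in> D" "degree p \<le> n" "degree q \<le> n" and xc: "\<bar>x - c\<bar> = \<bar>t\<bar>"
  shows "poly p x \<succeq> poly q x \<longleftrightarrow>
    (\<exists>i\<le>n. \<forall>j\<le>n. poly ((pderiv ^^ i) p) c * t ^ i \<succeq> poly ((pderiv ^^ j) q) c * t ^ j)"
proof
  assume a: "poly p x \<succeq> poly q x"
  obtain i where i: "i \<le> n" "\<And>j. j \<le> n \<Longrightarrow> poly ((pderiv ^^ i) p) c * t ^ i \<succeq> poly ((pderiv ^^ j) p) c * t ^ j"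
    using dom_max_exists[of n "\<lambda>i. poly ((pderiv ^^ i) p) c * t ^ i"] by blast
  have "poly ((pderiv ^^ i) p) c * t ^ i \<succeq> poly p x" by (rule taylor_terms_dom[OF pq(3) i(2) xc])
  then have "poly ((pderiv ^^ i) p) c * t ^ i \<succeq> poly q x" using a by (rule dom_trans)
  then have key: "poly ((pderiv ^^ i) p) c * t ^ i \<succeq> poly ((pderiv ^^ j) q) c * t ^ j" for j
    by (rule dom_trans[OF _ dom_taylor_term[OF closed iso t pq(2) xc]])
  show "\<exists>i\<le>n. \<forall>j\<le>n. poly ((pderiv ^^ i) p) c * t ^ i \<succeq> poly ((pderiv ^^ j) q) c * t ^ j"
    by (intro exI[of _ i] conjI allI impI i(1) key)
next
  assume "\<exists>i\<le>n. \<forall>j\<le>n. poly ((pderiv ^^ i) p) c * t ^ i \<succeq> poly ((pderiv ^^ j) q) c * t ^ j"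
  then obtain i where i: "\<And>j. j \<le> n \<Longrightarrow> poly ((pderiv ^^ i) p) c * t ^ i \<succeq> poly ((pderiv ^^ j) q) c * t ^ j" by blast
  have "poly ((pderiv ^^ i) p) c * t ^ i \<succeq> poly q x" by (rule taylor_terms_dom[OF pq(4) i xc])
  from dom_trans[OF dom_taylor_term[OF closed iso t pq(1) xc] this]
  show "poly p x \<succeq> poly q x" .
qed

end

subsection \<open>Candidate points\<close>

text \<open>Including 0 guarantees that a nearest centre exists.\<close>

definition cen :: "'k::linordered_field poly set \<Rightarrow> 'k \<Rightarrow> bool" where
  "cen D c \<longleftrightarrow> c = 0 \<or> (\<exists>q\<in>D. q \<noteq> 0 \<and> poly q c = 0)"

text \<open>The critical \<open>\<tau>\<close> represent the valuations of \<open>x - c\<close> at which two Taylor terms have equal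
  valuation or another centre is met. The values \<open>t\<close> of \<open>cand\<close> below represent them as well as the
  valuations between two of them (geometric means) and beyond the extreme ones (multiples by
  \<open>w\<close> and \<open>1 / w\<close>).\<close>
definition crit :: "'k::linordered_field poly set \<Rightarrow> nat \<Rightarrow> 'k \<Rightarrow> 'k \<Rightarrow> bool" where
  "crit D M c \<tau> \<longleftrightarrow> 0 < \<tau> \<and> (\<tau> = 1 \<or> (\<exists>c'. cen D c' \<and> (\<tau> = c' - c \<or> \<tau> = c - c')) \<or>
     (\<exists>q\<in>D. \<exists>q'\<in>D. \<exists>m\<in>{1..M}. poly q c \<noteq> 0 \<and> poly q' c \<noteq> 0 \<and>
        \<tau> ^ (2 * m) * (poly q' c * poly q' c) = poly q c * poly q c))"

text \<open>A critical \<tau> is represented by its half, as t + t = \<tau>, which has the same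
  valuation. If \<tau> is the distance to another centre on the same side, the candidate thus stays
  no closer to that centre than to c.\<close>

definition cand :: "'k::linordered_field poly set \<Rightarrow> nat \<Rightarrow> 'k \<Rightarrow> 'k \<Rightarrow> bool" where
  "cand D M w z \<longleftrightarrow> (\<exists>c. cen D c \<and> (z = c \<or> (\<exists>t \<tau> \<tau>'. crit D M c \<tau> \<and> crit D M c \<tau>' \<and> 0 < t \<and>
     (t * t = \<tau> * \<tau>' \<or> t = \<tau> * w \<or> t * w = \<tau> \<or> t + t = \<tau>) \<and> (z = c + t \<or> z = c - t))))"

lemma finite_cen: "finite D \<Longrightarrow> finite {c. cen D c}"
proof -
  assume "finite D"
  have "{c. cen D c} \<subseteq> insert 0 (\<Union>q\<in>D - {0}. {x. poly q x = 0})"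
    by (auto simp: cen_def)
  moreover have "finite \<dots>" using \<open>finite D\<close> by (auto intro: poly_roots_finite)
  ultimately show ?thesis by (rule finite_subset)
qed

lemma finite_power_eq: "m > 0 \<Longrightarrow> finite {x :: 'k::linordered_field. x ^ m * a = b}" if "a \<noteq> 0"
proof -
  assume m: "m > 0"
  define p where "p = Polynomial.monom a m - [:b:]"
  have "coeff p m = a" using m by (cases m) (auto simp: p_def)
  then have "p \<noteq> 0" using that by auto
  moreover have "{x. x ^ m * a = b} \<subseteq> {x. poly p x = 0}" by (auto simp: p_def poly_monom mult.commute)
  ultimately show ?thesis using poly_roots_finite finite_subset by blast
qed

lemma finite_crit: "finite D \<Longrightarrow> finite {\<tau>. crit D M c \<tau>}"
proof -
  assume D: "finite D"
  let ?S = "\<Union>q\<in>D. \<Union>q'\<in>D. \<Union>m\<in>{1..M}. if poly q c \<noteq> 0 \<and> poly q' c \<noteq> 0 then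
    {\<tau>. \<tau> ^ (2 * m) * (poly q' c * poly q' c) = poly q c * poly q c} else {}"
  have "{\<tau>. crit D M c \<tau>} \<subseteq> insert 1 ((\<lambda>c'. c' - c) ` {c. cen D c} \<union> (\<lambda>c'. c - c') ` {c. cen D c} \<union> ?S)"
    by (force simp: crit_def)
  moreover have "finite ?S"
    using D by (intro finite_UN_I) (auto intro!: finite_power_eq)
  ultimately show ?thesis using finite_cen[OF D] by (meson finite_Un finite_imageI finite_insert finite_subset)
qed

text \<open>Finiteness is what makes the quotients at candidates algebraic, through
  \<open>finite_solution_is_root\<close>.\<close>

lemma finite_cand:
  fixes w :: "'k::linordered_field"
  assumes D: "finite D" and w: "w \<noteq> 0"
  shows "finite {z. cand D M w z}"
proof -
  define K where "K c = {\<tau>. crit D M c \<tau>}" for c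
  define T where "T c = (\<Union>\<tau>\<in>K c. \<Union>\<tau>'\<in>K c. {t. t ^ 2 * 1 = \<tau> * \<tau>'} \<union> {\<tau> * w} \<union> {\<tau> / w} \<union> {\<tau> / 2})" for c
  have "finite (T c)" for c
    unfolding T_def K_def using finite_crit[OF D] by (auto intro!: finite_power_eq simp del: mult_1_right)
  moreover have "{z. cand D M w z} \<subseteq> (\<Union>c\<in>{c. cen D c}. insert c ((\<lambda>t. c + t) ` T c \<union> (\<lambda>t. c - t) ` T c))"
  proof
    fix z assume "z \<in> {z. cand D M w z}"
    then obtain c where c: "cen D c" "z = c \<or> (\<exists>t \<tau> \<tau>'. crit D M c \<tau> \<and> crit D M c \<tau>' \<and> 0 < t \<and>
     (t * t = \<tau> * \<tau>' \<or> t = \<tau> * w \<or> t * w = \<tau> \<or> t + t = \<tau>) \<and> (z = c + t \<or> z = c - t))"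
      by (auto simp: cand_def)
    have "t \<in> T c" if "crit D M c \<tau>" "crit D M c \<tau>'" "t * t = \<tau> * \<tau>' \<or> t = \<tau> * w \<or> t * w = \<tau> \<or> t + t = \<tau>" for t \<tau> \<tau>'
    proof -
      have "t ^ 2 * 1 = \<tau> * \<tau>' \<or> t = \<tau> * w \<or> t = \<tau> / w \<or> t = \<tau> / 2"
        using that(3) w by (auto simp: power2_eq_square)
      then show ?thesis using that(1,2) unfolding T_def K_def by blast
    qed
    then have "z = c \<or> (\<exists>t\<in>T c. z = c + t \<or> z = c - t)"
      using c(2) by metis
    then show "z \<in> (\<Union>c\<in>{c. cen D c}. insert c ((\<lambda>t. c + t) ` T c \<union> (\<lambda>t. c - t) ` T c))"
      using c(1) by (intro UN_I[of c]) auto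
  qed
  moreover have "finite (\<Union>c\<in>{c. cen D c}. insert c ((\<lambda>t. c + t) ` T c \<union> (\<lambda>t. c - t) ` T c))"
    using finite_cen[OF D] calculation(1) by (intro finite_UN_I) simp_all
  ultimately show ?thesis by (meson finite_subset)
qed

section \<open>Moving a solution to a candidate\<close>

context convex_valuation
begin

text \<open>If t has the valuation of an element of \<open>T\<close>, half of the least such element
  is taken. Otherwise t lies in a gap between the larger elements \<open>L\<close> and the smaller
  elements \<open>R\<close>: a geometric mean lies in an inner gap, and \<open>w\<close> leads
  beyond the greatest or the least element. The condition on \<open>S\<close> keeps the new point
  away from the other centres.\<close>

lemma same_position_exists:
  assumes T: "finite T" "1 \<in> T" "\<And>\<tau>. \<tau> \<in> T \<Longrightarrow> 0 < \<tau>" and w: "w > 0" "w \<notin> V" and t: "t > 0"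
    and S: "S \<subseteq> T" "\<And>\<delta>. \<delta> \<in> S \<Longrightarrow> t + t \<le> \<delta>"
  shows "\<exists>t'>0. (\<forall>\<tau>\<in>T. (\<tau> \<succeq> t \<longleftrightarrow> \<tau> \<succeq> t') \<and> (t \<succeq> \<tau> \<longleftrightarrow> t' \<succeq> \<tau>)) \<and> (\<forall>\<delta>\<in>S. t' + t' \<le> \<delta>) \<and>
    (\<exists>\<tau>\<in>T. \<exists>\<tau>'\<in>T. t' * t' = \<tau> * \<tau>' \<or> t' = \<tau> * w \<or> t' * w = \<tau> \<or> t' + t' = \<tau>)"
proof -
  have le: "a \<succeq> b" if "b \<le> a" "0 < b" for a b using that by (intro dom_le) auto
  have half: "a \<succeq> a / 2" "a / 2 \<succeq> a" for a
    using dom_of_nat[of "a / 2" 2] by (auto intro: dom_le)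
  have wV: "\<not> 1 \<succeq> w" using w by (simp add: vdom_def)
  have w1: "w > 1" using wV le[of w 1] w by force
  define E where "E = {\<tau> \<in> T. \<tau> \<succeq> t \<and> t \<succeq> \<tau>}"
  show ?thesis
  proof (cases "E = {}")
    case False
    have finE: "finite E" using T(1) by (simp add: E_def)
    \<comment> \<open>Minimality gives the bound for those \<delta> in \<open>S\<close> that have
      the valuation of t. All other \<delta> in \<open>S\<close> are larger than \<tau> already by
      valuation.\<close>
    define \<tau> where "\<tau> = Min E"
    have \<tau>: "\<tau> \<in> E" "\<And>x. x \<in> E \<Longrightarrow> \<tau> \<le> x" using finE False by (auto simp: \<tau>_def)
    have \<tau>': "\<tau> \<in> T" "\<tau> \<succeq> t" "t \<succeq> \<tau>" "\<tau> > 0" using \<tau> T by (auto simp: E_def)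
    have eq: "\<tau> / 2 \<succeq> t" "t \<succeq> \<tau> / 2" using \<tau>' half dom_trans by blast+
    have "\<tau> / 2 + \<tau> / 2 \<le> \<delta>" if "\<delta> \<in> S" for \<delta>
    proof (cases "\<delta> \<in> E")
      case True
      then show ?thesis using \<tau>(2) by simp
    next
      case False
      have "\<delta> \<succeq> t" using S(2)[OF that] t by (intro le) auto
      then have "\<not> t \<succeq> \<delta>" using False that S(1) by (auto simp: E_def)
      then have "\<not> \<tau> \<succeq> \<delta>" using \<tau>' dom_trans by blast
      then have "\<tau> \<le> \<delta>" using le[of \<delta> \<tau>] T(3) S(1) that by force
      then show ?thesis by simp
    qed
    moreover have "\<forall>\<sigma>\<in>T. (\<sigma> \<succeq> t \<longleftrightarrow> \<sigma> \<succeq> \<tau> / 2) \<and> (t \<succeq> \<sigma> \<longleftrightarrow> \<tau> / 2 \<succeq> \<sigma>)" using eq dom_trans by blast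
    moreover have "\<tau> / 2 + \<tau> / 2 = \<tau>" by simp
    ultimately show ?thesis using \<tau>' by (intro exI[of _ "\<tau> / 2"]) auto
  next
    case True
    define L where "L = {\<tau> \<in> T. \<tau> \<succeq> t}"
    define R where "R = {\<tau> \<in> T. t \<succeq> \<tau>}"
    have fin: "finite L" "finite R" using T(1) by (auto simp: L_def R_def)
    have LR: "L \<union> R = T" "L \<inter> R = {}" using True dom_total by (auto simp: L_def R_def E_def)
    have pos: "\<tau> \<in> L \<Longrightarrow> \<tau> > 0" "\<tau> \<in> R \<Longrightarrow> \<tau> > 0" for \<tau> using T(3) LR by auto
    \<comment> \<open>Lying strictly between \<open>L\<close> and \<open>R\<close> in valuation
      suffices: every \<delta> in \<open>S\<close> belongs to \<open>L\<close>, hence strictly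
      dominates t' and with it t' + t'.\<close>
    have fin_step: ?thesis if t': "t' > 0"
      and a: "\<And>\<tau>. \<tau> \<in> L \<Longrightarrow> \<tau> \<succeq> t' \<and> \<not> t' \<succeq> \<tau>" and b: "\<And>\<tau>. \<tau> \<in> R \<Longrightarrow> t' \<succeq> \<tau> \<and> \<not> \<tau> \<succeq> t'"
      and form: "\<exists>\<tau>\<in>T. \<exists>\<tau>'\<in>T. t' * t' = \<tau> * \<tau>' \<or> t' = \<tau> * w \<or> t' * w = \<tau> \<or> t' + t' = \<tau>" for t'
    proof -
      have "t' + t' \<le> \<delta>" if \<delta>: "\<delta> \<in> S" for \<delta>
      proof (rule ccontr)
        assume n: "\<not> ?thesis"
        have "\<delta> \<succeq> t" using S(2)[OF \<delta>] t by (intro le) auto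
        then have "\<delta> \<in> L" using S(1) \<delta> by (auto simp: L_def)
        then have "\<not> t' \<succeq> \<delta>" using a by blast
        moreover have "t' + t' \<succeq> \<delta>" using n T(3) S(1) \<delta> by (intro le) auto
        moreover have "t' \<succeq> t' + t'" using dom_of_nat[of t' 2] by (metis mult_2 of_nat_numeral)
        ultimately show False using dom_trans by blast
      qed
      moreover have "\<forall>\<tau>\<in>T. (\<tau> \<succeq> t \<longleftrightarrow> \<tau> \<succeq> t') \<and> (t \<succeq> \<tau> \<longleftrightarrow> t' \<succeq> \<tau>)"
      proof
        fix \<tau> assume "\<tau> \<in> T"
        then consider "\<tau> \<in> L" "\<tau> \<notin> R" | "\<tau> \<in> R" "\<tau> \<notin> L" using LR by blast
        then show "(\<tau> \<succeq> t \<longleftrightarrow> \<tau> \<succeq> t') \<and> (t \<succeq> \<tau> \<longleftrightarrow> t' \<succeq> \<tau>)"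
        proof cases
          case 1
          then show ?thesis using a[of \<tau>] \<open>\<tau> \<in> T\<close> by (auto simp: L_def R_def)
        next
          case 2
          then show ?thesis using b[of \<tau>] \<open>\<tau> \<in> T\<close> by (auto simp: L_def R_def)
        qed
      qed
      ultimately show ?thesis using t' form by blast
    qed
    show ?thesis
    proof (cases "L = {}")
      case L: True
      then have "R \<noteq> {}" using LR T(2) by auto
      define \<tau> where "\<tau> = Max R"
      have \<tau>: "\<tau> \<in> R" "\<And>x. x \<in> R \<Longrightarrow> x \<le> \<tau>" using fin \<open>R \<noteq> {}\<close> by (auto simp: \<tau>_def)
      have \<tau>0: "\<tau> > 0" using \<tau> pos by auto
      show ?thesis
      proof (rule fin_step)
        show "\<tau> * w > 0" using \<tau>0 w by simp
        show "\<exists>\<sigma>\<in>T. \<exists>\<tau>'\<in>T. \<tau> * w * (\<tau> * w) = \<sigma> * \<tau>' \<or> \<tau> * w = \<sigma> * w \<or> \<tau> * w * w = \<sigma> \<or> \<tau> * w + \<tau> * w = \<sigma>"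
          using \<tau> LR by blast
        fix \<sigma> assume \<sigma>: "\<sigma> \<in> R"
        have ts: "\<tau> \<succeq> \<sigma>" using \<tau>(2)[OF \<sigma>] pos(2)[OF \<sigma>] by (intro le)
        have "\<tau> * w \<succeq> \<tau>" using w1 \<tau>0 by (intro le) auto
        then have "\<tau> * w \<succeq> \<sigma>" using ts dom_trans by blast
        moreover have "\<not> \<sigma> \<succeq> \<tau> * w"
        proof
          assume "\<sigma> \<succeq> \<tau> * w"
          from dom_trans[OF ts this] have "1 * \<tau> \<succeq> w * \<tau>" by (simp add: mult.commute)
          then show False using wV \<tau>0 by (subst (asm) dom_cancel) auto
        qed
        ultimately show "\<tau> * w \<succeq> \<sigma> \<and> \<not> \<sigma> \<succeq> \<tau> * w" by blast
      qed (use L in auto)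
    next
      case L: False
      define \<tau> where "\<tau> = Min L"
      have \<tau>: "\<tau> \<in> L" "\<And>x. x \<in> L \<Longrightarrow> \<tau> \<le> x" using fin L by (auto simp: \<tau>_def)
      have \<tau>0: "\<tau> > 0" using \<tau> pos by auto
      have \<tau>L: "\<sigma> \<succeq> \<tau>" if "\<sigma> \<in> L" for \<sigma> using \<tau>(2)[OF that] \<tau>0 by (intro le)
      show ?thesis
      proof (cases "R = {}")
        case R: True
        have tw: "\<tau> / w * w = \<tau>" using w by simp
        show ?thesis
        proof (rule fin_step)
          show "\<tau> / w > 0" using \<tau>0 w by simp
          show "\<exists>\<sigma>\<in>T. \<exists>\<tau>'\<in>T. \<tau> / w * (\<tau> / w) = \<sigma> * \<tau>' \<or> \<tau> / w = \<sigma> * w \<or> \<tau> / w * w = \<sigma> \<or> \<tau> / w + \<tau> / w = \<sigma>"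
            using \<tau> LR tw by blast
          fix \<sigma> assume \<sigma>: "\<sigma> \<in> L"
          have "\<tau> \<succeq> \<tau> / w" using w1 \<tau>0 by (intro le) (auto simp: field_simps)
          then have "\<sigma> \<succeq> \<tau> / w" using \<tau>L[OF \<sigma>] dom_trans by blast
          moreover have "\<not> \<tau> / w \<succeq> \<sigma>"
          proof
            assume "\<tau> / w \<succeq> \<sigma>"
            then have "\<tau> / w \<succeq> \<tau>" using \<tau>L[OF \<sigma>] dom_trans by blast
            then have "1 * (\<tau> / w) \<succeq> w * (\<tau> / w)" using tw by (simp add: mult.commute)
            then show False using wV \<tau>0 w by (subst (asm) dom_cancel) auto
          qed
          ultimately show "\<sigma> \<succeq> \<tau> / w \<and> \<not> \<tau> / w \<succeq> \<sigma>" by blast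
        qed (use R in auto)
      next
        case R: False
        define \<rho> where "\<rho> = Max R"
        have \<rho>: "\<rho> \<in> R" "\<And>x. x \<in> R \<Longrightarrow> x \<le> \<rho>" using fin R by (auto simp: \<rho>_def)
        have \<rho>0: "\<rho> > 0" using \<rho> pos by auto
        have \<rho>R: "\<rho> \<succeq> \<sigma>" if "\<sigma> \<in> R" for \<sigma> using \<rho>(2)[OF that] pos(2)[OF that] by (intro le)
        have n: "\<not> \<rho> \<succeq> \<tau>"
        proof
          assume a: "\<rho> \<succeq> \<tau>"
          have "\<tau> \<succeq> t" using \<tau>(1) by (simp add: L_def)
          from dom_trans[OF a this] have "\<rho> \<in> L" using \<rho>(1) by (simp add: L_def R_def)
          then show False using \<rho>(1) LR(2) by blast
        qed
        have lt: "\<rho> < \<tau>"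
        proof (rule ccontr)
          assume "\<not> \<rho> < \<tau>"
          then have "\<tau> \<le> \<rho>" by simp
          from le[OF this \<tau>0] n show False by contradiction
        qed
        \<comment> \<open>The mean is strictly inside the gap: if s had the valuation of \<tau> or
          of \<rho>, comparing s s = \<tau> \<rho> with a square would give \<rho> the valuation of
          \<tau>.\<close>
        obtain s where s: "s > 0" "s ^ 2 = \<tau> * \<rho>" using rcf_nth_root[of "\<tau> * \<rho>" 2] \<tau>0 \<rho>0 by auto
        then have ss: "s * s = \<tau> * \<rho>" by (simp add: power2_eq_square)
        have "s \<le> \<tau>"
        proof (rule ccontr)
          assume "\<not> ?thesis"
          then have "\<tau> * \<rho> < s * s" using lt \<tau>0 \<rho>0 by (intro mult_strict_mono) auto
          then show False using ss by simp
        qed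
        then have ts: "\<tau> \<succeq> s" using s by (intro le) auto
        have "\<rho> \<le> s"
        proof (rule ccontr)
          assume "\<not> ?thesis"
          then have "s * s < \<tau> * \<rho>" using lt s(1) by (intro mult_strict_mono) auto
          then show False using ss by simp
        qed
        then have sr: "s \<succeq> \<rho>" using \<rho>0 by (intro le) auto
        have nst: "\<not> s \<succeq> \<tau>"
        proof
          assume a: "s \<succeq> \<tau>"
          have "\<rho> * \<tau> \<succeq> \<tau> * \<tau>" using dom_mult[OF a a] ss by (simp add: mult.commute)
          then show False using n \<tau>0 by (subst (asm) dom_cancel) auto
        qed
        have nrs: "\<not> \<rho> \<succeq> s"
        proof
          assume a: "\<rho> \<succeq> s"
          have "\<rho> * \<rho> \<succeq> \<tau> * \<rho>" using dom_mult[OF a a] ss by simp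
          then show False using n \<rho>0 by (subst (asm) dom_cancel) auto
        qed
        show ?thesis
        proof (rule fin_step[OF s(1)])
          show "\<exists>\<sigma>\<in>T. \<exists>\<tau>'\<in>T. s * s = \<sigma> * \<tau>' \<or> s = \<sigma> * w \<or> s * w = \<sigma> \<or> s + s = \<sigma>"
            using \<tau>(1) \<rho>(1) LR ss by blast
        qed (use \<tau>L \<rho>R ts sr nst nrs dom_trans in blast)+
      qed
    qed
  qed
qed

text \<open>The point x is moved along the ray from its nearest centre c to a distance t' in the
  same position as t relative to the critical values. No centre is crossed, which preserves signs.
  Both points are isolated, so valuation comparisons reduce to comparisons of Taylor terms at c,
  which the position of the distance decides.\<close>

lemma cand_complete:
  assumes D: "finite D" "\<And>q. q \<in> D \<Longrightarrow> pderiv q \<in> D" "\<And>q. q \<in> D \<Longrightarrow> degree q \<le> M" and w: "w > 0" "w \<notin> V"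
  shows "\<exists>z. cand D M w z \<and> (\<forall>p\<in>D. sg (poly p z) = sg (poly p x)) \<and>
    (\<forall>p\<in>D. \<forall>q\<in>D. poly p z \<succeq> poly q z \<longleftrightarrow> poly p x \<succeq> poly q x)"
proof -
  let ?C = "{c. cen D c}"
  have finC: "finite ?C" by (rule finite_cen[OF D(1)])
  have "0 \<in> ?C" by (simp add: cen_def)
  define t where "t = Min ((\<lambda>c. \<bar>x - c\<bar>) ` ?C)"
  have "t \<in> (\<lambda>c. \<bar>x - c\<bar>) ` ?C" unfolding t_def using finC \<open>0 \<in> ?C\<close> by (intro Min_in) auto
  then obtain c where c: "cen D c" "t = \<bar>x - c\<bar>" by auto
  have near: "t \<le> \<bar>x - r\<bar>" if "cen D r" for r
    unfolding t_def using finC that by (intro Min_le) auto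
  show ?thesis
  proof (cases "t = 0")
    case True
    then have "x = c" using c by simp
    then show ?thesis using c by (intro exI[of _ c]) (auto simp: cand_def)
  next
    case False
    then have t0: "t > 0" using c by simp
    define \<sigma> where "\<sigma> = sgn (x - c)"
    have \<sigma>: "\<sigma> = 1 \<or> \<sigma> = - 1" "x = c + \<sigma> * t"
      using False c by (auto simp: \<sigma>_def sgn_if abs_if split: if_splits)
    have \<sigma>2: "\<sigma> * \<sigma> = 1" using \<sigma> by auto
    define T where "T = {\<tau>. crit D M c \<tau>}"
    \<comment> \<open>The distances from c to the other centres on the side of x. As c is nearest to
      x, each of them is at least 2t, and this is what isolation on that side amounts to; on the
      other side it is automatic.\<close>
    define S where "S = {\<delta>. \<delta> > 0 \<and> cen D (c + \<sigma> * \<delta>)}"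
    have "finite T" unfolding T_def by (rule finite_crit[OF D(1)])
    have ST: "S \<subseteq> T"
    proof
      fix \<delta> assume "\<delta> \<in> S"
      then have "\<delta> > 0" "cen D (c + \<sigma> * \<delta>)" by (auto simp: S_def)
      moreover have "\<delta> = (c + \<sigma> * \<delta>) - c \<or> \<delta> = c - (c + \<sigma> * \<delta>)" using \<sigma>(1) by auto
      ultimately show "\<delta> \<in> T" unfolding T_def crit_def by blast
    qed
    have S2: "t + t \<le> \<delta>" if "\<delta> \<in> S" for \<delta>
    proof -
      have d: "\<delta> > 0" "t \<le> \<bar>x - (c + \<sigma> * \<delta>)\<bar>" using that near by (auto simp: S_def)
      have "\<bar>x - (c + \<sigma> * \<delta>)\<bar> = \<bar>t - \<delta>\<bar>" using \<sigma> by auto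
      then show ?thesis using d by linarith
    qed
    have T1: "1 \<in> T" "\<And>\<tau>. \<tau> \<in> T \<Longrightarrow> 0 < \<tau>" by (auto simp: T_def crit_def)
    obtain t' where t': "t' > 0" "\<And>\<tau>. \<tau> \<in> T \<Longrightarrow> (\<tau> \<succeq> t \<longleftrightarrow> \<tau> \<succeq> t') \<and> (t \<succeq> \<tau> \<longleftrightarrow> t' \<succeq> \<tau>)"
      "\<And>\<delta>. \<delta> \<in> S \<Longrightarrow> t' + t' \<le> \<delta>"
      "\<exists>\<tau>\<in>T. \<exists>\<tau>'\<in>T. t' * t' = \<tau> * \<tau>' \<or> t' = \<tau> * w \<or> t' * w = \<tau> \<or> t' + t' = \<tau>"
      using same_position_exists[OF \<open>finite T\<close> T1 w t0 ST S2] by metis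
    define z where "z = c + \<sigma> * t'"
    have "cand D M w z"
    proof -
      have "z = c + t' \<or> z = c - t'" using \<sigma>(1) by (auto simp: z_def)
      then show ?thesis unfolding cand_def using c(1) t'(1,4) unfolding T_def by blast
    qed
    have iso: "isolated D (c + \<sigma> * u) u" if u: "u > 0" "\<And>\<delta>. \<delta> \<in> S \<Longrightarrow> u + u \<le> \<delta>" for u
      unfolding isolated_def
    proof (intro ballI allI impI, rule dom_le)
      fix q r assume "q \<in> D" "q \<noteq> 0 \<and> poly q r = 0"
      then have r: "cen D r" by (auto simp: cen_def)
      define \<delta> where "\<delta> = \<sigma> * (r - c)"
      have rd: "r = c + \<sigma> * \<delta>" using \<sigma>2 by (simp add: \<delta>_def mult.assoc[symmetric])
      have eq: "\<bar>c + \<sigma> * u - r\<bar> = \<bar>u - \<delta>\<bar>" using \<sigma>(1) by (auto simp: rd)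
      have "u \<le> \<bar>u - \<delta>\<bar>"
      proof (cases "\<delta> > 0")
        case True
        then have "\<delta> \<in> S" using r rd by (simp add: S_def)
        then show ?thesis using u(2)[of \<delta>] by simp
      qed auto
      then show "\<bar>u\<bar> \<le> \<bar>c + \<sigma> * u - r\<bar>" using eq u(1) by simp
    qed
    have isox: "isolated D x t" using iso[OF t0 S2] \<sigma>(2) by simp
    have isoz: "isolated D z t'" using iso[OF t'(1,3)] by (simp add: z_def)
    have "sg (poly p z) = sg (poly p x)" if p: "p \<in> D" for p
    proof (cases "p = 0")
      case False
      \<comment> \<open>A root between x and z would be a centre on the ray at distance at most t or
        t', against the bounds 2t and 2t'.\<close>
      have nz: "poly p y \<noteq> 0" if y: "min x z \<le> y" "y \<le> max x z" for y
      proof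
        assume "poly p y = 0"
        then have cy: "cen D y" using p False by (auto simp: cen_def)
        define \<delta> where "\<delta> = \<sigma> * (y - c)"
        have yd: "y = c + \<sigma> * \<delta>" using \<sigma>2 by (simp add: \<delta>_def mult.assoc[symmetric])
        have "0 < \<delta> \<and> (\<delta> \<le> t \<or> \<delta> \<le> t')"
          using \<sigma>(1) y t0 t'(1) unfolding \<sigma>(2) z_def yd by (auto simp: min_def max_def split: if_splits)
        moreover have "\<delta> \<in> S" using calculation cy yd by (simp add: S_def)
        ultimately show False using S2[of \<delta>] t'(3)[of \<delta>] t0 t'(1) by auto
      qed
      have "poly p (min x z) * poly p (max x z) > 0"
        by (rule poly_sign_constant[OF nz]) auto
      then have "poly p x * poly p z > 0" by (auto simp: min_def max_def mult.commute split: if_splits)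
      then show ?thesis by (auto simp: sg_def zero_less_mult_iff)
    qed simp
    moreover have "poly p z \<succeq> poly q z \<longleftrightarrow> poly p x \<succeq> poly q x" if pq: "p \<in> D" "q \<in> D" for p q
    proof -
      \<comment> \<open>Comparing a t^i with b t^j means comparing a power of t with a quotient of a
        and b, that is, comparing t with the positive m-th root of its absolute value for m the
        difference of i and j. This root is critical.\<close>
      have cmp: "a * t ^ i \<succeq> b * t ^ j \<longleftrightarrow> a * t' ^ i \<succeq> b * t' ^ j"
        if ab: "a = poly f c" "b = poly g c" "f \<in> D" "g \<in> D" and ij: "i \<le> M" "j \<le> M" for a b f g i j
      proof (cases "a = 0 \<or> b = 0")
        case True
        then show ?thesis using t0 t'(1) by auto
      next
        case False
        have crit_ex: "\<exists>\<tau>\<in>T. \<tau> ^ m = \<bar>a' / b'\<bar>" if m: "0 < m" "m \<le> M"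
          and a'b': "a' = poly f' c" "b' = poly g' c" "f' \<in> D" "g' \<in> D" "a' \<noteq> 0" "b' \<noteq> 0" for m a' b' f' g'
        proof -
          obtain \<tau> where \<tau>: "\<tau> > 0" "\<tau> ^ m = \<bar>a' / b'\<bar>" using rcf_nth_root[of "\<bar>a' / b'\<bar>" m] a'b' m by auto
          \<comment> \<open>Squaring removes the absolute value from \<tau>^m = |a'/b'|; this is the
            form used in \<open>crit\<close> and expressible by terms.\<close>
          have "\<tau> ^ (2 * m) = (a' / b')\<^sup>2"
            by (simp only: power_even_eq \<tau>(2) power2_abs)
          then have "\<tau> ^ (2 * m) * (b' * b') = a' * a'"
            using a'b'(6) by (simp only: power_divide power2_eq_square) simp
          then have "crit D M c \<tau>" unfolding crit_def
            using \<tau>(1) m a'b' by (intro conjI disjI2 bexI[of _ f'] bexI[of _ g'] bexI[of _ m]) simp_all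
          then show ?thesis using \<tau>(2) by (auto simp: T_def)
        qed
        show ?thesis
        proof (cases i j rule: linorder_cases)
          case less
          define m where "m = j - i"
          have m: "0 < m" "m \<le> M" "j = i + m" using less ij by (auto simp: m_def)
          obtain \<tau> where \<tau>: "\<tau> \<in> T" "\<tau> ^ m = \<bar>a / b\<bar>" using crit_ex[OF m(1,2) ab] False by auto
          have "a * u ^ i \<succeq> b * u ^ j \<longleftrightarrow> \<tau> \<succeq> u" if "u > 0" for u
          proof -
            have "a / b * (b * u ^ i) = a * u ^ i" using False by simp
            moreover have "u ^ m * (b * u ^ i) = b * u ^ j" unfolding m(3) power_add by (simp only: mult_ac)
            ultimately have "a * u ^ i \<succeq> b * u ^ j \<longleftrightarrow> a / b * (b * u ^ i) \<succeq> u ^ m * (b * u ^ i)"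
              by (simp only:)
            also have "\<dots> \<longleftrightarrow> a / b \<succeq> u ^ m"
            proof (rule dom_cancel)
              show "b * u ^ i \<noteq> 0" using False that by simp
            qed
            also have "\<dots> \<longleftrightarrow> \<tau> ^ m \<succeq> u ^ m" by (simp only: \<tau>(2) dom_abs)
            also have "\<dots> \<longleftrightarrow> \<tau> \<succeq> u" by (rule dom_power_iff[OF m(1)])
            finally show ?thesis .
          qed
          then show ?thesis using t0 t'(1,2) \<tau>(1) by auto
        next
          case equal
          then show ?thesis using t0 t'(1) by (simp add: dom_cancel)
        next
          case greater
          define m where "m = i - j"
          have m: "0 < m" "m \<le> M" "i = j + m" using greater ij by (auto simp: m_def)
          obtain \<tau> where \<tau>: "\<tau> \<in> T" "\<tau> ^ m = \<bar>b / a\<bar>" using crit_ex[OF m(1,2) ab(2,1,4,3)] False by auto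
          have "a * u ^ i \<succeq> b * u ^ j \<longleftrightarrow> u \<succeq> \<tau>" if "u > 0" for u
          proof -
            have "b / a * (a * u ^ j) = b * u ^ j" using False by simp
            moreover have "u ^ m * (a * u ^ j) = a * u ^ i" unfolding m(3) power_add by (simp only: mult_ac)
            ultimately have "a * u ^ i \<succeq> b * u ^ j \<longleftrightarrow> u ^ m * (a * u ^ j) \<succeq> b / a * (a * u ^ j)"
              by (simp only:)
            also have "\<dots> \<longleftrightarrow> u ^ m \<succeq> b / a"
            proof (rule dom_cancel)
              show "a * u ^ j \<noteq> 0" using False that by simp
            qed
            also have "\<dots> \<longleftrightarrow> u ^ m \<succeq> \<tau> ^ m" by (simp only: \<tau>(2) dom_abs)
            also have "\<dots> \<longleftrightarrow> u \<succeq> \<tau>" by (rule dom_power_iff[OF m(1)])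
            finally show ?thesis .
          qed
          then show ?thesis using t0 t'(1,2) \<tau>(1) by auto
        qed
      qed
      have xt: "\<bar>x - c\<bar> = \<bar>t\<bar>" "\<bar>z - c\<bar> = \<bar>t'\<bar>" using \<sigma> by (auto simp: z_def)
      have "poly p z \<succeq> poly q z \<longleftrightarrow> (\<exists>i\<le>M. \<forall>j\<le>M. poly ((pderiv ^^ i) p) c * t' ^ i \<succeq> poly ((pderiv ^^ j) q) c * t' ^ j)"
        by (rule dom_iff_taylor[OF D(2) isoz _ pq D(3) D(3) xt(2)]) (use t' pq in auto)
      also have "\<dots> \<longleftrightarrow> (\<exists>i\<le>M. \<forall>j\<le>M. poly ((pderiv ^^ i) p) c * t ^ i \<succeq> poly ((pderiv ^^ j) q) c * t ^ j)"
        using cmp[OF refl refl] higher_pderiv_closed[of D] D(2) pq by (metis (no_types, lifting))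
      also have "\<dots> \<longleftrightarrow> poly p x \<succeq> poly q x"
        by (rule dom_iff_taylor[OF D(2) isox _ pq D(3) D(3) xt(1), symmetric]) (use t0 pq in auto)
      finally show ?thesis .
    qed
    ultimately show ?thesis using \<open>cand D M w z\<close> by blast
  qed
qed

end

subsection \<open>Candidate points as a formula\<close>

definition tsub :: "'a tm \<Rightarrow> 'a tm \<Rightarrow> 'a tm" where "tsub s t = TAdd s (TNeg t)"

primrec tpow :: "'a tm \<Rightarrow> nat \<Rightarrow> 'a tm" where
  "tpow t 0 = TOne"
| "tpow t (Suc n) = TMul t (tpow t n)"

primrec tnum :: "nat \<Rightarrow> 'a tm" where
  "tnum 0 = TZero"
| "tnum (Suc n) = TAdd TOne (tnum n)"

definition FEq :: "'a tm \<Rightarrow> 'a tm \<Rightarrow> 'a fm" where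
  "FEq s t = FAnd (FNot (Pos (tsub s t))) (FNot (Pos (tsub t s)))"

definition FLe :: "'a tm \<Rightarrow> 'a tm \<Rightarrow> 'a fm" where
  "FLe s t = FNot (Pos (tsub s t))"

definition FNz :: "'a tm \<Rightarrow> 'a fm" where
  "FNz t = FNot (FEq t TZero)"

definition FDisj :: "'a fm list \<Rightarrow> 'a fm" where
  "FDisj fs = foldr FOr fs FFalse"

primrec horner :: "'a tm list \<Rightarrow> 'a tm \<Rightarrow> 'a tm" where
  "horner [] u = TZero"
| "horner (a # q) u = TAdd a (TMul u (horner q u))"

lemma ev_tsub [simp]: "ev \<pi> e (tsub s t) = ev \<pi> e s - ev \<pi> e t"
  by (simp add: tsub_def)

lemma ev_tpow [simp]: "ev \<pi> e (tpow t n) = ev \<pi> e t ^ n"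
  by (induction n) auto

lemma ev_tnum [simp]: "ev \<pi> e (tnum n) = of_nat n"
  by (induction n) auto

lemma ev_horner [simp]: "ev \<pi> e (horner q u) = poly (psem \<pi> e q) (ev \<pi> e u)"
  by (induction q) auto

lemma holds_FEq [simp]: "holds V \<pi> e (FEq s t) \<longleftrightarrow> ev \<pi> e s = ev \<pi> e t"
  by (auto simp: FEq_def)

lemma holds_FLe [simp]: "holds V \<pi> e (FLe s t) \<longleftrightarrow> ev \<pi> e s \<le> ev \<pi> e t"
  by (auto simp: FLe_def)

lemma holds_FNz [simp]: "holds V \<pi> e (FNz t) \<longleftrightarrow> ev \<pi> e t \<noteq> 0"
  by (simp add: FNz_def)

lemma holds_FDisj [simp]: "holds V \<pi> e (FDisj fs) \<longleftrightarrow> (\<exists>f\<in>set fs. holds V \<pi> e f)"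
  by (induction fs) (auto simp: FDisj_def)

lemma holds_FDisj_map: "holds V \<pi> e (FDisj (map g xs)) \<longleftrightarrow> (\<exists>x\<in>set xs. holds V \<pi> e (g x))"
  by simp

lemma holds_FDisj_concat: "holds V \<pi> e (FDisj (concat (map g xs))) \<longleftrightarrow> (\<exists>x\<in>set xs. holds V \<pi> e (FDisj (g x)))"
  by auto

lemma qf_simps [simp]: "qf (FEq s t)" "qf (FLe s t)" "qf (FNz t)" "qf (FDisj fs) \<longleftrightarrow> (\<forall>f\<in>set fs. qf f)"
  by (simp_all add: FEq_def FLe_def FNz_def) (induction fs; auto simp: FDisj_def)

lemma vfree_simps [simp]: "vfree (FEq s t)" "vfree (FLe s t)" "vfree (FNz t)" "vfree (FDisj fs) \<longleftrightarrow> (\<forall>f\<in>set fs. vfree f)"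
  by (simp_all add: FEq_def FLe_def FNz_def) (induction fs; auto simp: FDisj_def)

primrec zero_all :: "'a tm \<Rightarrow> 'a tm" where
  "zero_all (TPar a) = TPar a"
| "zero_all (TVar n) = TZero"
| "zero_all TZero = TZero"
| "zero_all TOne = TOne"
| "zero_all (TAdd s t) = TAdd (zero_all s) (zero_all t)"
| "zero_all (TMul s t) = TMul (zero_all s) (zero_all t)"
| "zero_all (TNeg t) = TNeg (zero_all t)"

primrec zero_var :: "nat \<Rightarrow> 'a tm \<Rightarrow> 'a tm" where
  "zero_var m (TPar a) = TPar a"
| "zero_var m (TVar n) = (if n = m then TZero else TVar n)"
| "zero_var m TZero = TZero"
| "zero_var m TOne = TOne"
| "zero_var m (TAdd s t) = TAdd (zero_var m s) (zero_var m t)"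
| "zero_var m (TMul s t) = TMul (zero_var m s) (zero_var m t)"
| "zero_var m (TNeg t) = TNeg (zero_var m t)"

lemma ev_zero_all [simp]: "ev \<pi> e (zero_all t) = ev \<pi> (\<lambda>_. 0) t"
  by (induction t) auto

lemma ev_zero_var: "ev \<pi> e (zero_var m t) = ev \<pi> (e(m := 0)) t"
  by (induction t) auto

lemma psem_zero_all: "psem \<pi> e (map zero_all q) = psem \<pi> (\<lambda>_. 0) q"
  by (simp add: psem_def comp_def)

lemma psem_zero_var: "psem \<pi> e (map (zero_var m) q) = psem \<pi> (e(m := 0)) q"
  by (simp add: psem_def comp_def ev_zero_var)

lemma psem_eq_0_iff: "psem \<pi> e q = 0 \<longleftrightarrow> (\<forall>a\<in>set q. ev \<pi> e a = 0)"
  by (induction q) auto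

text \<open>Coefficients in \<open>TVar 0\<close>, with all other variables set to zero.\<close>
definition upoly :: "'a tm \<Rightarrow> 'a tm list" where
  "upoly t = map zero_all (cf 0 t)"

lemma poly_upoly [simp]: "poly (psem \<pi> e (upoly t)) x = ev \<pi> ((\<lambda>_. 0)(0 := x)) t"
  by (simp add: upoly_def psem_zero_all poly_cf)

definition derivatives :: "'a tm list list \<Rightarrow> 'a tm list list" where
  "derivatives qs = concat (map (\<lambda>q. map (\<lambda>i. (pder ^^ i) q) [0..<Suc (length q)]) qs)"

lemma mem_derivatives: "q \<in> set (derivatives qs) \<longleftrightarrow> (\<exists>p\<in>set qs. \<exists>i\<le>length p. q = (pder ^^ i) p)"
proof -
  have "set (derivatives qs) = (\<Union>q\<in>set qs. (\<lambda>i. (pder ^^ i) q) ` {0..<Suc (length q)})"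
    by (simp only: derivatives_def set_concat set_map image_image set_upt)
  then show ?thesis
    by (simp only: UN_iff image_iff Bex_def atLeastLessThan_iff less_Suc_eq_le) simp
qed

lemma length_pder_iter: "length ((pder ^^ i) q) = length q - i"
  by (induction i) auto

lemma set_derivatives_pder: "q \<in> set (derivatives qs) \<Longrightarrow> pder q \<in> set (derivatives qs)"
proof -
  assume "q \<in> set (derivatives qs)"
  then obtain p i where p: "p \<in> set qs" "i \<le> length p" "q = (pder ^^ i) p"
    unfolding mem_derivatives by blast
  have "pder q = (pder ^^ (min (Suc i) (length p))) p"
  proof (cases "i = length p")
    case True
    then have "q = []" using p(3) by (metis diff_self_eq_0 length_0_conv length_pder_iter)
    then show ?thesis using True p(3) by (simp add: min_def)
  next
    case False
    then show ?thesis using p by (simp add: min_def)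
  qed
  moreover have "min (Suc i) (length p) \<le> length p" by simp
  ultimately show ?thesis using p(1) unfolding mem_derivatives by blast
qed

lemma set_derivatives_self: "q \<in> set qs \<Longrightarrow> q \<in> set (derivatives qs)"
  unfolding mem_derivatives by (rule bexI[of _ q], rule exI[of _ 0]) simp_all

text \<open>Being fixed by \<open>zero_all\<close> expresses that no variable occurs, so the
  polynomial is the same in every environment.\<close>

definition closed_list :: "'a tm list \<Rightarrow> bool" where
  "closed_list q \<longleftrightarrow> map zero_all q = q"

lemma zero_all_idem [simp]: "zero_all (zero_all t) = zero_all t"
  by (induction t) auto

lemma closed_list_upoly: "closed_list (upoly t)"
  by (auto simp: closed_list_def upoly_def)

lemma closed_list_padd: "closed_list p \<Longrightarrow> closed_list q \<Longrightarrow> closed_list (padd p q)"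
  by (induction p q rule: padd.induct) (auto simp: closed_list_def)

lemma closed_list_pder: "closed_list q \<Longrightarrow> closed_list (pder q)"
proof (induction q rule: pder.induct)
  case (3 a b q)
  then have "closed_list (TZero # pder (b # q))" "closed_list (b # q)" by (auto simp: closed_list_def)
  then show ?case unfolding pder.simps by (intro closed_list_padd)
qed (auto simp: closed_list_def)

lemma psem_closed_list: "closed_list q \<Longrightarrow> psem \<pi> e q = psem \<pi> (\<lambda>_. 0) q"
  by (metis closed_list_def psem_zero_all)

lemma closed_list_derivatives:
  "(\<And>q. q \<in> set qs \<Longrightarrow> closed_list q) \<Longrightarrow> q \<in> set (derivatives qs) \<Longrightarrow> closed_list q"
proof -
  have "closed_list p \<Longrightarrow> closed_list ((pder ^^ i) p)" for p :: "'a tm list" and i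
    by (induction i) (auto intro: closed_list_pder)
  then show "(\<And>q. q \<in> set qs \<Longrightarrow> closed_list q) \<Longrightarrow> q \<in> set (derivatives qs) \<Longrightarrow> closed_list q"
    unfolding mem_derivatives by blast
qed

definition f_cen :: "'a tm list list \<Rightarrow> 'a tm \<Rightarrow> 'a fm" where
  "f_cen ds u = FOr (FEq u TZero)
     (FDisj (map (\<lambda>q. FAnd (FDisj (map FNz q)) (FEq (horner q u) TZero)) ds))"

definition f_crit :: "'a tm list list \<Rightarrow> nat \<Rightarrow> 'a tm \<Rightarrow> 'a tm \<Rightarrow> 'a fm" where
  "f_crit ds M c \<tau> = FAnd (Pos \<tau>) (FOr (FEq \<tau> TOne) (FOr
     (FEx 6 (FAnd (f_cen ds (TVar 6)) (FOr (FEq \<tau> (tsub (TVar 6) c)) (FEq \<tau> (tsub c (TVar 6))))))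
     (FDisj (concat (map (\<lambda>q. concat (map (\<lambda>q'. map (\<lambda>m.
        FAnd (FNz (horner q c)) (FAnd (FNz (horner q' c))
          (FEq (TMul (tpow \<tau> (2 * m)) (TMul (horner q' c) (horner q' c))) (TMul (horner q c) (horner q c)))))
        [1..<Suc M]) ds)) ds)))))"

text \<open>The candidate is \<open>TVar 0\<close>, and \<open>TVar 9\<close> stands for an element outside the valuation ring.\<close>
definition f_cand :: "'a tm list list \<Rightarrow> nat \<Rightarrow> 'a fm" where
  "f_cand ds M = FEx 2 (FAnd (f_cen ds (TVar 2)) (FOr (FEq (TVar 0) (TVar 2))
     (FEx 3 (FEx 4 (FEx 5 (FAnd (f_crit ds M (TVar 2) (TVar 4)) (FAnd (f_crit ds M (TVar 2) (TVar 5))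
       (FAnd (Pos (TVar 3)) (FAnd
         (FOr (FEq (TMul (TVar 3) (TVar 3)) (TMul (TVar 4) (TVar 5)))
           (FOr (FEq (TVar 3) (TMul (TVar 4) (TVar 9))) (FOr (FEq (TMul (TVar 3) (TVar 9)) (TVar 4))
             (FEq (TAdd (TVar 3) (TVar 3)) (TVar 4)))))
         (FOr (FEq (TVar 0) (TAdd (TVar 2) (TVar 3))) (FEq (TVar 0) (tsub (TVar 2) (TVar 3)))))))))))))"

lemma vfree_f_cand [simp]: "vfree (f_cand ds M)"
  by (auto simp: f_cand_def f_crit_def f_cen_def)

context
  fixes ds :: "'a tm list list" and \<pi> :: "'a \<Rightarrow> 'k::linordered_field" and D :: "'k poly set"
  assumes closed: "\<And>q. q \<in> set ds \<Longrightarrow> closed_list q"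
    and D: "D = psem \<pi> (\<lambda>_. 0) ` set ds"
begin

lemma holds_f_cen [simp]: "holds V \<pi> e (f_cen ds u) \<longleftrightarrow> cen D (ev \<pi> e u)"
proof -
  have "(\<exists>a\<in>set q. ev \<pi> e a \<noteq> 0) \<longleftrightarrow> psem \<pi> (\<lambda>_. 0) q \<noteq> 0" if "q \<in> set ds" for q
    using psem_closed_list[OF closed[OF that], of \<pi> e] by (metis psem_eq_0_iff)
  moreover have "psem \<pi> e q = psem \<pi> (\<lambda>_. 0) q" if "q \<in> set ds" for q
    by (rule psem_closed_list[OF closed[OF that]])
  ultimately show ?thesis unfolding f_cen_def cen_def D by simp
qed

lemma holds_f_crit:
  assumes "\<And>x. ev \<pi> (e(6 := x)) c = ev \<pi> e c" "\<And>x. ev \<pi> (e(6 := x)) \<tau> = ev \<pi> e \<tau>"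
  shows "holds V \<pi> e (f_crit ds M c \<tau>) \<longleftrightarrow> crit D M (ev \<pi> e c) (ev \<pi> e \<tau>)"
proof -
  have p: "psem \<pi> e q = psem \<pi> (\<lambda>_. 0) q" if "q \<in> set ds" for q
    by (rule psem_closed_list[OF closed[OF that]])
  show ?thesis
    unfolding f_crit_def crit_def holds.simps FOr_simps holds_FDisj_concat holds_FDisj_map
    by (simp add: assms p atLeastLessThanSuc_atLeastAtMost del: upt_Suc holds_FDisj cong: bex_cong) (simp add: D)
qed

lemma holds_f_cand: "holds V \<pi> e (f_cand ds M) \<longleftrightarrow> cand D M (e 9) (e 0)"
  unfolding f_cand_def cand_def by (simp add: holds_f_crit) 

end

subsection \<open>Valuations of algebraic elements\<close>

lemma holds_sign_cong:
  assumes "qf f" "vfree f" "\<And>t. t \<in> set (atoms f) \<Longrightarrow> sg (ev \<pi> e t) = sg (ev \<pi> e' t)"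
  shows "holds V \<pi> e f \<longleftrightarrow> holds V \<pi> e' f"
  using beval[OF assms(1,2), of "\<lambda>t. sg (ev \<pi> e t)" \<pi> e V] beval[OF assms(1,2), of "\<lambda>t. sg (ev \<pi> e t)" \<pi> e' V] assms(3)
  by simp

lemma finite_gap_right:
  fixes y :: "'k::linordered_field"
  assumes "finite R"
  shows "\<exists>z>y. \<forall>r\<in>R. \<not> (y < r \<and> r \<le> z)"
  using assms
proof (induction R rule: finite_induct)
  case empty
  then show ?case using gt_ex by auto
next
  case (insert r R)
  then obtain z where z: "z > y" "\<And>r. r \<in> R \<Longrightarrow> \<not> (y < r \<and> r \<le> z)" by blast
  show ?case
  proof (cases "y < r")
    case True
    then obtain u where u: "y < u" "u < r" using dense by blast
    have "\<not> (y < s \<and> s \<le> min u z)" if "s \<in> insert r R" for s using that u z by auto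
    then show ?thesis using u z by (intro exI[of _ "min u z"]) auto
  next
    case False
    then show ?thesis using z by (intro exI[of _ z]) auto
  qed
qed

text \<open>If every nonzero atom polynomial were nonzero at y, all signs would persist on an
  interval to the right of y and the solutions would be infinite in number.\<close>

lemma finite_solution_is_root:
  fixes e :: "nat \<Rightarrow> 'k::rcf"
  assumes f: "qf f" "vfree f" and fin: "finite {y. holds V \<pi> (e(n := y)) f}" and y: "holds V \<pi> (e(n := y)) f"
  shows "\<exists>t\<in>set (atoms f). psem \<pi> e (cf n t) \<noteq> 0 \<and> poly (psem \<pi> e (cf n t)) y = 0"
proof (rule ccontr)
  assume neg: "\<not> ?thesis"
  let ?P = "\<lambda>t. psem \<pi> e (cf n t)"
  define R where "R = (\<Union>t\<in>{t \<in> set (atoms f). ?P t \<noteq> 0}. {x. poly (?P t) x = 0})"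
  have "finite R" unfolding R_def by (auto intro: poly_roots_finite)
  from finite_gap_right[OF this] obtain z where z: "z > y" "\<And>r. r \<in> R \<Longrightarrow> \<not> (y < r \<and> r \<le> z)" by blast
  have "holds V \<pi> (e(n := x)) f" if x: "x \<in> {y<..<z}" for x
  proof -
    have "sg (ev \<pi> (e(n := y)) t) = sg (ev \<pi> (e(n := x)) t)" if t: "t \<in> set (atoms f)" for t
    proof (cases "?P t = 0")
      case True
      then show ?thesis by (metis poly_cf poly_0)
    next
      case False
      have "poly (?P t) u \<noteq> 0" if "y \<le> u" "u \<le> x" for u
        using neg False t z(2)[of u] that x by (cases "u = y") (auto simp: R_def)
      then have "poly (?P t) y * poly (?P t) x > 0" using x by (intro poly_sign_constant) auto
      then show ?thesis by (auto simp: poly_cf sg_def zero_less_mult_iff)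
    qed
    then show ?thesis using holds_sign_cong[OF f] y by blast
  qed
  then have "{y<..<z} \<subseteq> {y. holds V \<pi> (e(n := y)) f}" by auto
  then show False using fin z(1) infinite_Ioo finite_subset by blast
qed

context convex_valuation
begin

text \<open>The largest term of a vanishing sum of n terms is balanced by the others, so another
  term is at least 1/n of it. Stating this by the order and not by the valuation makes it
  expressible in an order formula; dividing by the lower power of y leaves the exponent j -
  i.\<close>

lemma two_dominant_terms:
  fixes a :: "nat \<Rightarrow> 'k"
  assumes "(\<Sum>i<n. a i * y ^ i) = 0" "y \<noteq> 0" "\<exists>i<n. a i \<noteq> 0"
  shows "\<exists>i j. i < j \<and> j < n \<and> a i \<noteq> 0 \<and> a j \<noteq> 0 \<and>
    \<bar>a i\<bar> \<le> of_nat n * (\<bar>a j\<bar> * \<bar>y\<bar> ^ (j - i)) \<and> \<bar>a j\<bar> * \<bar>y\<bar> ^ (j - i) \<le> of_nat n * \<bar>a i\<bar>"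
proof -
  let ?T = "\<lambda>i. \<bar>a i * y ^ i\<bar>"
  have "n > 0" using assms(3) by auto
  define m where "m = Max (?T ` {..<n})"
  have "m \<in> ?T ` {..<n}" unfolding m_def using \<open>n > 0\<close> by (intro Max_in) auto
  then obtain j where j: "j < n" "m = ?T j" by auto
  have max: "?T i \<le> ?T j" if "i < n" for i
    using that unfolding j(2)[symmetric] m_def by (intro Max_ge) auto
  have Tj: "?T j > 0"
  proof -
    obtain i where "i < n" "a i \<noteq> 0" using assms(3) by blast
    then have "?T i > 0" using assms(2) by simp
    then show ?thesis using max[OF \<open>i < n\<close>] by linarith
  qed
  \<comment> \<open>Otherwise the n - 1 remaining terms together would be smaller than the largest
    one.\<close>
  have "\<exists>i\<in>{..<n} - {j}. ?T j \<le> of_nat n * ?T i"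
  proof (rule ccontr)
    assume neg: "\<not> ?thesis"
    have "a j * y ^ j = - (\<Sum>i\<in>{..<n} - {j}. a i * y ^ i)"
      using assms(1) j(1) by (simp add: sum.remove[of "{..<n}" j] add_eq_0_iff2)
    then have "?T j = \<bar>\<Sum>i\<in>{..<n} - {j}. a i * y ^ i\<bar>" by simp
    also have "\<dots> \<le> (\<Sum>i\<in>{..<n} - {j}. ?T i)" by (rule sum_abs)
    finally have a: "of_nat n * ?T j \<le> (\<Sum>i\<in>{..<n} - {j}. of_nat n * ?T i)"
      by (simp only: sum_distrib_left[symmetric]) (auto intro: mult_left_mono)
    show False
    proof (cases "{..<n} - {j} = {}")
      case True
      then show ?thesis using a Tj \<open>n > 0\<close> by (simp only: True sum.empty) (simp add: mult_le_0_iff)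
    next
      case False
      have "(\<Sum>i\<in>{..<n} - {j}. of_nat n * ?T i) < (\<Sum>i\<in>{..<n} - {j}. ?T j)"
      proof (rule sum_strict_mono)
        fix i assume "i \<in> {..<n} - {j}"
        then show "of_nat n * ?T i < ?T j" using neg by (meson not_le)
      qed (use False in auto)
      also have "\<dots> = of_nat (n - 1) * ?T j" using j(1) by simp
      also have "\<dots> \<le> of_nat n * ?T j" using Tj by (intro mult_right_mono) auto
      finally show ?thesis using a by simp
    qed
  qed
  then obtain i where i: "i < n" "i \<noteq> j" "?T j \<le> of_nat n * ?T i" by auto
  have Ti: "?T i > 0" using i(3) Tj by (metis mult_zero_right abs_ge_zero less_le not_less order_trans)
  have n1: "(1::'k) \<le> of_nat n" using \<open>n > 0\<close> by (metis of_nat_1 of_nat_le_iff Suc_leI One_nat_def)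
  have both: "?T k \<le> of_nat n * ?T l" if "{k, l} = {i, j}" for k l
  proof -
    have "?T i \<le> of_nat n * ?T j" using max[OF i(1)] n1 Tj by (smt (verit) mult_right_mono mult_1 less_imp_le order_trans)
    then show ?thesis using that i(3) by (auto simp: doubleton_eq_iff)
  qed
  have red: "\<bar>a k\<bar> \<le> of_nat n * (\<bar>a l\<bar> * \<bar>y\<bar> ^ (l - k)) \<and> \<bar>a l\<bar> * \<bar>y\<bar> ^ (l - k) \<le> of_nat n * \<bar>a k\<bar>"
    if kl: "{k, l} = {i, j}" "k < l" for k l
  proof -
    have yk: "\<bar>y\<bar> ^ k > 0" using assms(2) by simp
    have Tl: "?T l = (\<bar>a l\<bar> * \<bar>y\<bar> ^ (l - k)) * \<bar>y\<bar> ^ k"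
      using kl(2) by (simp add: abs_mult power_abs mult.assoc flip: power_add)
    have Tk: "?T k = \<bar>a k\<bar> * \<bar>y\<bar> ^ k" by (simp add: abs_mult power_abs)
    have "\<bar>a k\<bar> * \<bar>y\<bar> ^ k \<le> (of_nat n * (\<bar>a l\<bar> * \<bar>y\<bar> ^ (l - k))) * \<bar>y\<bar> ^ k"
      using both[OF kl(1)] unfolding Tl Tk by (simp add: mult.assoc)
    moreover have "(\<bar>a l\<bar> * \<bar>y\<bar> ^ (l - k)) * \<bar>y\<bar> ^ k \<le> (of_nat n * \<bar>a k\<bar>) * \<bar>y\<bar> ^ k"
      using both[of l k] kl(1) unfolding Tl Tk by (simp add: mult.assoc insert_commute)
    ultimately show ?thesis using yk by (simp add: mult_le_cancel_right)
  qed
  have nz: "a i \<noteq> 0" "a j \<noteq> 0" using Ti Tj by auto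
  show ?thesis
  proof (cases "i < j")
    case True
    then show ?thesis using red[of i j] nz j(1) by blast
  next
    case False
    then have "j < i" using i(2) by simp
    with red[OF insert_commute this] nz i(1) show ?thesis by blast
  qed
qed

lemma dom_of_nat_le: "\<bar>y\<bar> \<le> of_nat n * \<bar>x\<bar> \<Longrightarrow> x \<succeq> y"
proof -
  assume "\<bar>y\<bar> \<le> of_nat n * \<bar>x\<bar>"
  then have "of_nat n * x \<succeq> y" by (intro dom_le) (simp add: abs_mult)
  then show "x \<succeq> y" by (rule dom_trans[OF dom_of_nat])
qed

text \<open>The two inequalities are squared forms of the estimates that make a p^m and b q^m agree
  up to a factor n. These elements then have equal valuation, so m times the valuation of q/p is the
  difference of the valuations of a and b.\<close>

lemma dom_iff_dominant_terms:
  assumes "p \<noteq> 0" "a \<noteq> 0" "b \<noteq> 0" "m > 0"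
    "(a * a) * p ^ (2 * m) \<le> of_nat n * of_nat n * ((b * b) * q ^ (2 * m))"
    "(b * b) * q ^ (2 * m) \<le> of_nat n * of_nat n * ((a * a) * p ^ (2 * m))"
  shows "p \<succeq> q \<longleftrightarrow> b \<succeq> a"
proof -
  have sq: "x * x * u ^ (2 * m) = (x * u ^ m)\<^sup>2" for x u :: 'k
    by (simp add: power2_eq_square power_mult_distrib power_mult[symmetric] mult.commute[of 2] power_mult algebra_simps)
  have "\<bar>a * p ^ m\<bar> \<le> \<bar>of_nat n * (b * q ^ m)\<bar>"
    unfolding abs_le_square_iff using assms(5) unfolding sq by (simp add: power2_eq_square algebra_simps)
  then have 1: "b * q ^ m \<succeq> a * p ^ m" by (intro dom_of_nat_le) (simp add: abs_mult)
  have "\<bar>b * q ^ m\<bar> \<le> \<bar>of_nat n * (a * p ^ m)\<bar>"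
    unfolding abs_le_square_iff using assms(6) unfolding sq by (simp add: power2_eq_square algebra_simps)
  then have 2: "a * p ^ m \<succeq> b * q ^ m" by (intro dom_of_nat_le) (simp add: abs_mult)
  have "p \<succeq> q \<longleftrightarrow> p ^ m \<succeq> q ^ m" by (rule dom_power_iff[OF assms(4), symmetric])
  also have "\<dots> \<longleftrightarrow> p ^ m * b \<succeq> q ^ m * b" by (rule dom_cancel[OF assms(3), symmetric])
  also have "\<dots> \<longleftrightarrow> p ^ m * b \<succeq> a * p ^ m" using 1 2 dom_trans by (metis mult.commute)
  also have "\<dots> \<longleftrightarrow> b * p ^ m \<succeq> a * p ^ m" by (simp add: mult.commute)
  also have "\<dots> \<longleftrightarrow> b \<succeq> a" using assms(1) by (intro dom_cancel) simp
  finally show ?thesis .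
qed

end

text \<open>Satisfied by \<open>TVar 1\<close> exactly when it is the quotient of \<open>t\<close>
  by \<open>s\<close> at some candidate where \<open>s\<close> does not vanish; there are finitely
  many such values.\<close>

definition f_ratio :: "'a tm list list \<Rightarrow> nat \<Rightarrow> 'a tm \<Rightarrow> 'a tm \<Rightarrow> 'a fm" where
  "f_ratio ds M s t = FEx 0 (FAnd (f_cand ds M) (FAnd (FNz (horner (upoly s) (TVar 0)))
     (FEq (TMul (horner (upoly s) (TVar 0)) (TVar 1)) (horner (upoly t) (TVar 0)))))"

text \<open>Each quotient is a root of a nonzero atom of the eliminated formula, read as a
  polynomial in \<open>TVar 1\<close>. As \<open>f_ratio\<close> binds \<open>TVar 0\<close>, that
  variable can be set to zero in the coefficients, which makes them constant under the quantifier
  over the candidate.\<close>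

definition ratio_polys :: "'a tm list list \<Rightarrow> nat \<Rightarrow> 'a tm \<Rightarrow> 'a tm \<Rightarrow> 'a tm list list" where
  "ratio_polys ds M s t = map (\<lambda>u. map (zero_var 0) (cf 1 u)) (atoms (rqe (f_ratio ds M s t)))"

text \<open>At a candidate, the quotient of two polynomials is algebraic over the coefficients and \<open>TVar 9\<close>.
  Two terms of an equation for it have equal valuation, and this determines whether the quotient is in
  the valuation ring.\<close>
definition f_vle :: "'a tm list list \<Rightarrow> 'a tm \<Rightarrow> 'a tm \<Rightarrow> 'a fm" where
  "f_vle rs p q = FOr (FEq q TZero) (FAnd (FNz p) (FDisj (concat (map (\<lambda>r. concat (map (\<lambda>j. map (\<lambda>i.
     FAnd (FNz (r ! i)) (FAnd (FNz (r ! j)) (FAnd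
       (FLe (TMul (TMul (r ! i) (r ! i)) (tpow p (2 * (j - i))))
         (TMul (TMul (tnum (length r)) (tnum (length r))) (TMul (TMul (r ! j) (r ! j)) (tpow q (2 * (j - i))))))
       (FAnd (FLe (TMul (TMul (r ! j) (r ! j)) (tpow q (2 * (j - i))))
         (TMul (TMul (tnum (length r)) (tnum (length r))) (TMul (TMul (r ! i) (r ! i)) (tpow p (2 * (j - i))))))
         (Vle (r ! j) (r ! i))))))
     [0..<j]) [0..<length r])) rs))))"

text \<open>An equivalent of the formula at a candidate in which the valuation atoms compare only
  terms without \<open>TVar 0\<close>.\<close>

primrec localize :: "'a tm list list \<Rightarrow> nat \<Rightarrow> 'a fm \<Rightarrow> 'a fm" where
  "localize ds M FTrue = FTrue"
| "localize ds M (Pos t) = Pos (horner (upoly t) (TVar 0))"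
| "localize ds M (Vle s t) = f_vle (ratio_polys ds M s t) (horner (upoly s) (TVar 0)) (horner (upoly t) (TVar 0))"
| "localize ds M (FNot f) = FNot (localize ds M f)"
| "localize ds M (FAnd f g) = FAnd (localize ds M f) (localize ds M g)"
| "localize ds M (FEx n f) = FFalse"

lemma qf_localize: "qf (localize ds M f)"
  by (induction f) (auto simp: f_vle_def)

lemma (in convex_valuation) holds_f_vle:
  fixes \<pi> :: "'a \<Rightarrow> 'k"
  assumes closed: "\<And>q. q \<in> set ds \<Longrightarrow> closed_list q"
    and D: "D = psem \<pi> (\<lambda>_. 0) ` set ds" and w: "e 9 \<noteq> 0" and z: "cand D M (e 9) (e 0)"
  shows "holds V \<pi> e (f_vle (ratio_polys ds M s t) (horner (upoly s) (TVar 0)) (horner (upoly t) (TVar 0)))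
    \<longleftrightarrow> holds V \<pi> ((\<lambda>_. 0)(0 := e 0)) (Vle s t)"
proof -
  define p where "p = ev \<pi> ((\<lambda>_. 0)(0 := e 0)) s"
  define q where "q = ev \<pi> ((\<lambda>_. 0)(0 := e 0)) t"
  let ?rs = "ratio_polys ds M s t"
  define E where "E r i j \<longleftrightarrow> ev \<pi> e (r ! i) \<noteq> 0 \<and> ev \<pi> e (r ! j) \<noteq> 0 \<and>
    ev \<pi> e (r ! i) * ev \<pi> e (r ! i) * p ^ (2 * (j - i)) \<le> of_nat (length r) * of_nat (length r) * (ev \<pi> e (r ! j) * ev \<pi> e (r ! j) * q ^ (2 * (j - i))) \<and>
    ev \<pi> e (r ! j) * ev \<pi> e (r ! j) * q ^ (2 * (j - i)) \<le> of_nat (length r) * of_nat (length r) * (ev \<pi> e (r ! i) * ev \<pi> e (r ! i) * p ^ (2 * (j - i))) \<and>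
    ev \<pi> e (r ! j) \<succeq> ev \<pi> e (r ! i)" for r i j
  have sound: "p \<succeq> q" if "i < j" "p \<noteq> 0" "E r i j" for r i j
    using dom_iff_dominant_terms[of p "ev \<pi> e (r ! i)" "ev \<pi> e (r ! j)" "j - i" "length r" q] that
    unfolding E_def by simp
  have complete: "\<exists>r\<in>set ?rs. \<exists>j<length r. \<exists>i<j. E r i j" if pq: "p \<noteq> 0" "q \<noteq> 0" "p \<succeq> q"
  proof -
    define y where "y = q / p"
    \<comment> \<open>The truth of the eliminated formula does not depend on \<open>TVar 0\<close>;
      value 0 matches the coefficients of \<open>ratio_polys\<close>.\<close>
    define e' where "e' = e(0 := 0)"
    have finD: "finite D" by (simp add: D)
    have Y: "holds V \<pi> (e'(1 := u)) (f_ratio ds M s t) \<longleftrightarrow> (\<exists>z. cand D M (e 9) z \<and>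
        ev \<pi> ((\<lambda>_. 0)(0 := z)) s \<noteq> 0 \<and> ev \<pi> ((\<lambda>_. 0)(0 := z)) s * u = ev \<pi> ((\<lambda>_. 0)(0 := z)) t)" for u
      unfolding f_ratio_def by (simp add: holds_f_cand[OF closed D] e'_def)
    have vf: "vfree (f_ratio ds M s t)" by (simp add: f_ratio_def)
    have "{u. holds V \<pi> (e'(1 := u)) (f_ratio ds M s t)} \<subseteq>
        (\<lambda>z. ev \<pi> ((\<lambda>_. 0)(0 := z)) t / ev \<pi> ((\<lambda>_. 0)(0 := z)) s) ` {z. cand D M (e 9) z}"
    proof
      fix u assume "u \<in> {u. holds V \<pi> (e'(1 := u)) (f_ratio ds M s t)}"
      then obtain z where z: "cand D M (e 9) z" "ev \<pi> ((\<lambda>_. 0)(0 := z)) s \<noteq> 0"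
        "ev \<pi> ((\<lambda>_. 0)(0 := z)) s * u = ev \<pi> ((\<lambda>_. 0)(0 := z)) t"
        unfolding Y mem_Collect_eq by blast
      then have "u = ev \<pi> ((\<lambda>_. 0)(0 := z)) t / ev \<pi> ((\<lambda>_. 0)(0 := z)) s"
        by (metis nonzero_mult_div_cancel_left)
      then show "u \<in> (\<lambda>z. ev \<pi> ((\<lambda>_. 0)(0 := z)) t / ev \<pi> ((\<lambda>_. 0)(0 := z)) s) ` {z. cand D M (e 9) z}"
        using z(1) by blast
    qed
    then have fin: "finite {u. holds V \<pi> (e'(1 := u)) (rqe (f_ratio ds M s t))}"
      unfolding holds_rqe[OF vf] using finite_cand[OF finD w] finite_subset by blast
    have "holds V \<pi> (e'(1 := y)) (rqe (f_ratio ds M s t))"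
      unfolding holds_rqe[OF vf] Y using z pq by (intro exI[of _ "e 0"]) (auto simp: p_def q_def y_def)
    from finite_solution_is_root[OF _ _ fin this] rqe_simple[OF vf] obtain u
      where u: "u \<in> set (atoms (rqe (f_ratio ds M s t)))" "psem \<pi> e' (cf 1 u) \<noteq> 0" "poly (psem \<pi> e' (cf 1 u)) y = 0"
      by blast
    define r where "r = map (zero_var 0) (cf 1 u)"
    have r: "r \<in> set ?rs" using u(1) by (auto simp: ratio_polys_def r_def)
    have ps: "psem \<pi> e' (cf 1 u) = psem \<pi> e r" by (simp add: r_def psem_zero_var e'_def)
    let ?a = "\<lambda>i. ev \<pi> e (r ! i)"
    have "poly (psem \<pi> e r) y = (\<Sum>i<length r. ?a i * y ^ i)"
    proof -
      have "poly (psem \<pi> e r) y = (\<Sum>i\<le>degree (psem \<pi> e r). coeff (psem \<pi> e r) i * y ^ i)"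
        by (rule poly_altdef)
      also have "\<dots> = (\<Sum>i<length r. coeff (psem \<pi> e r) i * y ^ i)"
      proof (rule sum.mono_neutral_left)
        show "{..degree (psem \<pi> e r)} \<subseteq> {..<length r}"
        proof
          fix i assume i: "i \<in> {..degree (psem \<pi> e r)}"
          have "lead_coeff (psem \<pi> e r) \<noteq> 0" using u(2) ps by simp
          then have "degree (psem \<pi> e r) < length r" by (simp add: coeff_psem split: if_splits)
          then show "i \<in> {..<length r}" using i by simp
        qed
      qed (auto simp: coeff_eq_0)
      also have "\<dots> = (\<Sum>i<length r. ?a i * y ^ i)" by (simp add: coeff_psem)
      finally show ?thesis .
    qed
    then have "(\<Sum>i<length r. ?a i * y ^ i) = 0" using u(3) ps by simp
    moreover have "\<exists>i<length r. ?a i \<noteq> 0"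
      using u(2) unfolding ps psem_eq_0_iff by (metis in_set_conv_nth)
    moreover have "y \<noteq> 0" using pq by (simp add: y_def)
    ultimately obtain i j where ij: "i < j" "j < length r" "?a i \<noteq> 0" "?a j \<noteq> 0"
      "\<bar>?a i\<bar> \<le> of_nat (length r) * (\<bar>?a j\<bar> * \<bar>y\<bar> ^ (j - i))" "\<bar>?a j\<bar> * \<bar>y\<bar> ^ (j - i) \<le> of_nat (length r) * \<bar>?a i\<bar>"
      using two_dominant_terms[of ?a y "length r"] by blast
    define m where "m = j - i"
    have yp: "\<bar>y\<bar> ^ m * \<bar>p\<bar> ^ m = \<bar>q\<bar> ^ m"
    proof -
      have "y * p = q" using pq by (simp add: y_def)
      then show ?thesis by (metis abs_mult power_mult_distrib)
    qed
    have pm: "\<bar>p\<bar> ^ m \<ge> 0" by simp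
    have sq: "x * x * v ^ (2 * m) = (x * v ^ m)\<^sup>2" for x v :: 'k
      by (simp add: power2_eq_square power_mult_distrib power_mult[symmetric] mult.commute[of 2] power_mult algebra_simps)
    have "\<bar>?a i * p ^ m\<bar> \<le> \<bar>of_nat (length r) * (?a j * q ^ m)\<bar>"
      using mult_right_mono[OF ij(5) pm] by (simp add: abs_mult power_abs m_def[symmetric] yp[symmetric] mult.assoc)
    then have c1: "?a i * ?a i * p ^ (2 * m) \<le> of_nat (length r) * of_nat (length r) * (?a j * ?a j * q ^ (2 * m))"
      unfolding abs_le_square_iff sq by (simp add: power2_eq_square algebra_simps)
    have "\<bar>?a j * q ^ m\<bar> \<le> \<bar>of_nat (length r) * (?a i * p ^ m)\<bar>"
      using mult_right_mono[OF ij(6) pm] by (simp add: abs_mult power_abs m_def[symmetric] yp[symmetric] mult.assoc)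
    then have c2: "?a j * ?a j * q ^ (2 * m) \<le> of_nat (length r) * of_nat (length r) * (?a i * ?a i * p ^ (2 * m))"
      unfolding abs_le_square_iff sq by (simp add: power2_eq_square algebra_simps)
    have "?a j \<succeq> ?a i"
      using dom_iff_dominant_terms[OF pq(1) ij(3,4) _ c1 c2] pq(3) ij(1) by (simp add: m_def)
    then have "E r i j" using ij c1 c2 unfolding m_def E_def by blast
    then show ?thesis using r ij(1,2) by blast
  qed
  have "holds V \<pi> e (f_vle ?rs (horner (upoly s) (TVar 0)) (horner (upoly t) (TVar 0)))
      \<longleftrightarrow> q = 0 \<or> p \<noteq> 0 \<and> (\<exists>r\<in>set ?rs. \<exists>j<length r. \<exists>i<j. E r i j)"
    unfolding f_vle_def holds.simps FOr_simps holds_FDisj_concat holds_FDisj_map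
    by (simp add: p_def[symmetric] q_def[symmetric] E_def Bex_def del: fun_upd_apply)
  also have "\<dots> \<longleftrightarrow> p \<succeq> q"
    using sound complete by (metis dom_0_left dom_0_right)
  finally show ?thesis by (simp add: p_def q_def del: fun_upd_apply)
qed

lemma (in convex_valuation) holds_localize:
  fixes \<pi> :: "'a \<Rightarrow> 'k"
  assumes closed: "\<And>q. q \<in> set ds \<Longrightarrow> closed_list q"
    and D: "D = psem \<pi> (\<lambda>_. 0) ` set ds" and w: "e 9 \<noteq> 0" and z: "cand D M (e 9) (e 0)" and f: "qf f"
  shows "holds V \<pi> e (localize ds M f) \<longleftrightarrow> holds V \<pi> ((\<lambda>_. 0)(0 := e 0)) f"
  using f by (induction f) (auto simp: holds_f_vle[OF closed D w z] simp del: holds.simps(3) fun_upd_apply)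

subsection \<open>Splitting on valuation atoms of the parameters\<close>

primrec vatoms :: "'a fm \<Rightarrow> ('a tm \<times> 'a tm) list" where
  "vatoms FTrue = []"
| "vatoms (Pos t) = []"
| "vatoms (Vle s t) = [(s, t)]"
| "vatoms (FNot f) = vatoms f"
| "vatoms (FAnd f g) = vatoms f @ vatoms g"
| "vatoms (FEx n f) = vatoms f"

primrec subst_v :: "('a tm \<times> 'a tm \<Rightarrow> bool) \<Rightarrow> 'a fm \<Rightarrow> 'a fm" where
  "subst_v a FTrue = FTrue"
| "subst_v a (Pos t) = Pos t"
| "subst_v a (Vle s t) = (if a (s, t) then FTrue else FFalse)"
| "subst_v a (FNot f) = FNot (subst_v a f)"
| "subst_v a (FAnd f g) = FAnd (subst_v a f) (subst_v a g)"
| "subst_v a (FEx n f) = FEx n (subst_v a f)"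

lemma vfree_subst_v [simp]: "vfree (subst_v a f)"
  by (induction f) auto

lemma subst_v_vfree: "vfree f \<Longrightarrow> subst_v a f = f"
  by (induction f) auto

lemma holds_subst_v:
  "qf f \<Longrightarrow> (\<And>s t. (s, t) \<in> set (vatoms f) \<Longrightarrow> a (s, t) \<longleftrightarrow> vdom V (ev \<pi> e s) (ev \<pi> e t)) \<Longrightarrow>
    holds V \<pi> e (subst_v a f) \<longleftrightarrow> holds V \<pi> e f"
  by (induction f) auto

text \<open>The valuation atoms do not mention the quantified variable, so their truth values can be
  fixed outside the quantifier. What remains under it is an order formula.\<close>

fun split_v :: "('a tm \<times> 'a tm) list \<Rightarrow> ('a tm \<times> 'a tm \<Rightarrow> bool) \<Rightarrow> 'a fm \<Rightarrow> 'a fm" where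
  "split_v [] a f = rqe (FEx 0 (subst_v a f))"
| "split_v ((s, t) # vs) a f = FOr (FAnd (Vle s t) (split_v vs (a((s, t) := True)) f))
     (FAnd (FNot (Vle s t)) (split_v vs (a((s, t) := False)) f))"

lemma holds_split_v:
  fixes e :: "nat \<Rightarrow> 'k::rcf"
  shows "holds V \<pi> e (split_v vs a f) \<longleftrightarrow>
    (\<exists>z. holds V \<pi> (e(0 := z)) (subst_v (\<lambda>v. if v \<in> set vs then vdom V (ev \<pi> e (fst v)) (ev \<pi> e (snd v)) else a v) f))"
proof (induction vs arbitrary: a)
  case Nil
  have "holds V \<pi> e (rqe (FEx 0 (subst_v a f))) \<longleftrightarrow> holds V \<pi> e (FEx 0 (subst_v a f))"
    by (rule holds_rqe) simp
  then show ?case by (simp only: split_v.simps holds.simps list.set empty_iff if_False)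
next
  case (Cons v vs)
  obtain s t where v: "v = (s, t)" by fastforce
  have eq: "(\<lambda>u. if u \<in> set vs then vdom V (ev \<pi> e (fst u)) (ev \<pi> e (snd u)) else (a(v := b)) u) =
      (\<lambda>u. if u \<in> set (v # vs) then vdom V (ev \<pi> e (fst u)) (ev \<pi> e (snd u)) else a u)"
    if "b \<longleftrightarrow> vdom V (ev \<pi> e s) (ev \<pi> e t)" for b
    using that by (auto simp: v)
  show ?case
  proof (cases "vdom V (ev \<pi> e s) (ev \<pi> e t)")
    case True
    then have "holds V \<pi> e (split_v (v # vs) a f) \<longleftrightarrow> holds V \<pi> e (split_v vs (a(v := True)) f)" by (simp add: v)
    then show ?thesis unfolding Cons.IH using eq[of True] True by (simp only:)
  next
    case False
    then have "holds V \<pi> e (split_v (v # vs) a f) \<longleftrightarrow> holds V \<pi> e (split_v vs (a(v := False)) f)" by (simp add: v)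
    then show ?thesis unfolding Cons.IH using eq[of False] False by (simp only:)
  qed
qed

lemma qf_split_v: "qf (split_v vs a f)"
proof (induction vs a f rule: split_v.induct)
  case (1 a f)
  have "vfree (FEx 0 (subst_v a f))" by simp
  from rqe_simple[OF this] show ?case by (simp only: split_v.simps)
next
  case (2 s t vs a f)
  then show ?case by (simp only: split_v.simps FOr_simps qf.simps)
qed

subsection \<open>Letting a variable tend to infinity\<close>

definition f_lead :: "'a tm list \<Rightarrow> nat \<Rightarrow> 'a fm" where
  "f_lead c i = FAnd (FNz (c ! i)) (FNot (FDisj (map FNz (drop (Suc i) c))))"

definition f_zero :: "'a tm list \<Rightarrow> 'a fm" where
  "f_zero c = FNot (FDisj (map FNz c))"

text \<open>For large values the true leading terms decide. In a valuation comparison the higher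
  degree dominates, and equal degrees leave a comparison of leading coefficients.
  \<open>f_lead\<close> finds the true degree among the formal ones.\<close>

primrec at_infinity :: "nat \<Rightarrow> 'a fm \<Rightarrow> 'a fm" where
  "at_infinity n FTrue = FTrue"
| "at_infinity n (Pos t) = FDisj (map (\<lambda>i. FAnd (f_lead (cf n t) i) (Pos (cf n t ! i))) [0..<length (cf n t)])"
| "at_infinity n (Vle s t) = FOr (f_zero (cf n t)) (FDisj (concat (map (\<lambda>i. map (\<lambda>j.
     FAnd (f_lead (cf n s) i) (FAnd (f_lead (cf n t) j)
       (if j < i then FTrue else if i < j then FFalse else Vle (cf n s ! i) (cf n t ! j))))
     [0..<length (cf n t)]) [0..<length (cf n s)])))"
| "at_infinity n (FNot f) = FNot (at_infinity n f)"
| "at_infinity n (FAnd f g) = FAnd (at_infinity n f) (at_infinity n g)"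
| "at_infinity n (FEx m f) = FFalse"

lemma qf_at_infinity: "qf (at_infinity n f)"
  by (induction f) (auto simp: f_lead_def f_zero_def)

lemma holds_f_zero [simp]: "holds V \<pi> e (f_zero c) \<longleftrightarrow> psem \<pi> e c = 0"
  by (auto simp: f_zero_def psem_eq_0_iff)

lemma holds_f_lead:
  assumes "i < length c"
  shows "holds V \<pi> e (f_lead c i) \<longleftrightarrow> psem \<pi> e c \<noteq> 0 \<and> degree (psem \<pi> e c) = i"
proof
  assume "holds V \<pi> e (f_lead c i)"
  then have nz: "ev \<pi> e (c ! i) \<noteq> 0" and z: "\<And>a. a \<in> set (drop (Suc i) c) \<Longrightarrow> ev \<pi> e a = 0"
    by (auto simp: f_lead_def)
  have ci: "coeff (psem \<pi> e c) i \<noteq> 0" using nz assms by (simp add: coeff_psem)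
  moreover have "coeff (psem \<pi> e c) k = 0" if "k > i" for k
  proof (cases "k < length c")
    case True
    have "k - Suc i < length (drop (Suc i) c)" "c ! k = drop (Suc i) c ! (k - Suc i)"
      using True that by simp_all
    then have "c ! k \<in> set (drop (Suc i) c)" by (simp only: nth_mem)
    then show ?thesis using z True by (simp add: coeff_psem)
  qed (simp add: coeff_psem)
  then have "degree (psem \<pi> e c) \<le> i" by (intro degree_le) auto
  moreover have "i \<le> degree (psem \<pi> e c)" using ci by (rule le_degree)
  ultimately show "psem \<pi> e c \<noteq> 0 \<and> degree (psem \<pi> e c) = i" by auto
next
  assume a: "psem \<pi> e c \<noteq> 0 \<and> degree (psem \<pi> e c) = i"
  then have "coeff (psem \<pi> e c) i \<noteq> 0" by auto
  then have "ev \<pi> e (c ! i) \<noteq> 0" using assms by (simp add: coeff_psem)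
  moreover have "ev \<pi> e x = 0" if x: "x \<in> set (drop (Suc i) c)" for x
  proof -
    obtain k where k: "k < length (drop (Suc i) c)" "x = drop (Suc i) c ! k" using x by (metis in_set_conv_nth)
    then have "x = c ! (Suc i + k)" "Suc i + k < length c" by auto
    moreover have "coeff (psem \<pi> e c) (Suc i + k) = 0" using a by (intro coeff_eq_0) simp
    ultimately show ?thesis by (simp add: coeff_psem)
  qed
  ultimately show "holds V \<pi> e (f_lead c i)" by (auto simp: f_lead_def)
qed

lemma degree_psem_less: "psem \<pi> e c \<noteq> 0 \<Longrightarrow> degree (psem \<pi> e c) < length c"
proof -
  assume "psem \<pi> e c \<noteq> 0"
  then have "coeff (psem \<pi> e c) (degree (psem \<pi> e c)) \<noteq> 0" by simp
  then show ?thesis unfolding coeff_psem by (simp split: if_splits)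
qed

lemma eventually_sg_lead:
  fixes p :: "'k::linordered_field poly"
  assumes "p \<noteq> 0"
  shows "\<forall>\<^sub>F x in at_top. sg (poly p x) = sg (lead_coeff p)"
  using sg_poly_at_top[OF assms] by (auto simp: eventually_at_top_dense)

text \<open>Both 2p minus the leading monomial and twice that monomial minus p have positive leading
  coefficient. The factor 2 does not affect valuations.\<close>

lemma eventually_lead_bounds:
  fixes p :: "'k::linordered_field poly"
  assumes "lead_coeff p > 0"
  shows "\<forall>\<^sub>F x in at_top. lead_coeff p * x ^ degree p < 2 * poly p x \<and> poly p x < 2 * (lead_coeff p * x ^ degree p)"
proof -
  let ?m = "Polynomial.monom (lead_coeff p) (degree p)"
  have gen: "\<forall>\<^sub>F x in at_top. poly q x > 0" if "coeff q (degree p) > 0" "degree q \<le> degree p" for q :: "'k poly"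
  proof -
    have nz: "coeff q (degree p) \<noteq> 0" using that(1) by simp
    then have q: "q \<noteq> 0" by auto
    have d: "degree q = degree p" by (rule antisym[OF that(2) le_degree[OF nz]])
    have lc: "sg (lead_coeff q) = 1" using that(1) by (simp only: d sg_simps)
    from eventually_sg_lead[OF q] show ?thesis
      by eventually_elim (simp only: lc sg_simps)
  qed
  have deg: "degree (smult 2 p - ?m) \<le> degree p" "degree (smult 2 ?m - p) \<le> degree p"
    by (rule degree_diff_le; simp add: degree_monom_le degree_smult_le order.trans[OF degree_smult_le])+
  have c: "coeff (smult 2 p - ?m) (degree p) > 0" "coeff (smult 2 ?m - p) (degree p) > 0"
    using assms by simp_all
  from gen[OF c(1) deg(1)] gen[OF c(2) deg(2)] show ?thesis
    by eventually_elim (simp add: poly_monom)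
qed

context convex_valuation
begin

lemma eventually_lead_dom:
  assumes "p \<noteq> 0"
  shows "\<forall>\<^sub>F x in at_top. poly p x \<succeq> lead_coeff p * x ^ degree p \<and> lead_coeff p * x ^ degree p \<succeq> poly p x"
proof -
  have gen: "\<forall>\<^sub>F x in at_top. poly p x \<succeq> lead_coeff p * x ^ degree p \<and> lead_coeff p * x ^ degree p \<succeq> poly p x"
    if "lead_coeff p > 0" for p
    using eventually_lead_bounds[OF that] eventually_gt_at_top[of 0]
  proof eventually_elim
    case (elim x)
    let ?l = "lead_coeff p * x ^ degree p"
    have l: "?l > 0" using that elim by simp
    have "\<bar>?l\<bar> \<le> of_nat 2 * \<bar>poly p x\<bar>" "\<bar>poly p x\<bar> \<le> of_nat 2 * \<bar>?l\<bar>"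
      using elim l by auto
    then show ?case using dom_of_nat_le by blast
  qed
  show ?thesis
  proof (cases "lead_coeff p > 0")
    case True
    then show ?thesis by (rule gen)
  next
    case False
    then have "lead_coeff (- p) > 0" using assms by (simp add: order_less_le)
    from gen[OF this] show ?thesis
    proof eventually_elim
      case (elim x)
      have neg: "- a \<succeq> - b \<longleftrightarrow> a \<succeq> b" for a b :: 'k by (simp add: vdom_def)
      from elim have "- poly p x \<succeq> - (lead_coeff p * x ^ degree p) \<and> - (lead_coeff p * x ^ degree p) \<succeq> - poly p x" by simp
      then show ?case unfolding neg .
    qed
  qed
qed

text \<open>Comparison of different degrees is strict because the valuation is nontrivial: once |x|
  exceeds |a w / b|, b x dominates a w, which a does not dominate.\<close>

lemma eventually_dom_monomials:
  assumes "a \<noteq> 0" "b \<noteq> 0" "w \<notin> V"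
  shows "\<forall>\<^sub>F x in at_top. a * x ^ i \<succeq> b * x ^ j \<longleftrightarrow> (if j < i then True else if i < j then False else a \<succeq> b)"
proof -
  have nw: "\<not> 1 \<succeq> w" using assms(3) V_convex[OF V_one, of 0] by (auto simp: vdom_def)
  have "\<forall>\<^sub>F x in at_top. x \<ge> (1::'k) \<and> x \<ge> \<bar>b / a\<bar> \<and> x \<ge> \<bar>a / b\<bar> * \<bar>w\<bar>"
    by (intro eventually_conj eventually_ge_at_top)
  then show ?thesis
  proof eventually_elim
    case (elim x)
    have x0: "x > 0" using elim by (auto intro: less_le_trans[of 0 1])
    consider "j < i" | "i < j" | "i = j" by linarith
    then show ?case
    proof cases
      case 1
      then obtain k where k: "i = Suc k + j" by (metis add.commute add_Suc less_imp_Suc_add)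
      have "\<bar>b\<bar> \<le> \<bar>a\<bar> * x" using elim assms(1) by (simp add: field_simps)
      also have "\<dots> \<le> \<bar>a\<bar> * x ^ Suc k"
        using elim by (intro mult_left_mono) (auto intro: self_le_power simp del: power_Suc)
      finally have "a * x ^ Suc k \<succeq> b" using x0 by (intro dom_le) (simp add: abs_mult)
      then have "a * x ^ Suc k * x ^ j \<succeq> b * x ^ j" by (intro dom_mult) auto
      then show ?thesis using 1 by (simp add: k power_add mult.assoc)
    next
      case 2
      then obtain k where k: "j = Suc k + i" by (metis add.commute add_Suc less_imp_Suc_add)
      have "\<not> a * x ^ i \<succeq> b * x ^ j"
      proof
        assume "a * x ^ i \<succeq> b * x ^ j"
        moreover have "b * x ^ j = b * x ^ Suc k * x ^ i" by (simp add: k power_add mult.assoc)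
        ultimately have "a * x ^ i \<succeq> b * x ^ Suc k * x ^ i" by (simp only:)
        then have d: "a \<succeq> b * x ^ Suc k" using x0 by (subst (asm) dom_cancel) auto
        have "\<bar>a * w\<bar> \<le> \<bar>b\<bar> * x" using elim assms(2) by (simp add: abs_mult field_simps)
        also have "\<dots> \<le> \<bar>b\<bar> * x ^ Suc k"
          using elim by (intro mult_left_mono) (auto intro: self_le_power simp del: power_Suc)
        finally have "b * x ^ Suc k \<succeq> a * w" using x0 by (intro dom_le) (simp add: abs_mult)
        from dom_trans[OF d this] have "1 * a \<succeq> w * a" by (simp add: mult.commute)
        then show False using nw assms(1) by (subst (asm) dom_cancel) auto
      qed
      then show ?thesis using 2 by simp
    next
      case 3
      then show ?thesis using x0 by (simp add: dom_cancel)
    qed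
  qed
qed

lemma eventually_at_infinity_atom:
  assumes w: "w \<notin> V"
  shows "\<forall>\<^sub>F x in at_top. holds V \<pi> (e(n := x)) (Vle s t) \<longleftrightarrow> holds V \<pi> e (at_infinity n (Vle s t))"
proof -
  let ?p = "psem \<pi> e (cf n s)" and ?q = "psem \<pi> e (cf n t)"
  have val: "holds V \<pi> (e(n := x)) (Vle s t) \<longleftrightarrow> poly ?p x \<succeq> poly ?q x" for x by (simp add: poly_cf)
  have inf: "holds V \<pi> e (at_infinity n (Vle s t)) \<longleftrightarrow> ?q = 0 \<or> (\<exists>i<length (cf n s). \<exists>j<length (cf n t).
      holds V \<pi> e (f_lead (cf n s) i) \<and> holds V \<pi> e (f_lead (cf n t) j) \<and>
      (if j < i then True else if i < j then False else ev \<pi> e (cf n s ! i) \<succeq> ev \<pi> e (cf n t ! j)))"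
  proof -
    have h: "holds V \<pi> e (if a then FTrue else if b then FFalse else Vle u v) \<longleftrightarrow>
        (if a then True else if b then False else ev \<pi> e u \<succeq> ev \<pi> e v)" for a b u v
      by simp
    show ?thesis
      unfolding at_infinity.simps FOr_simps holds_FDisj_concat holds_FDisj_map holds_f_zero
      by (simp only: holds.simps(5) h set_upt atLeast0LessThan lessThan_iff Bex_def)
  qed
  consider "?q = 0" | "?q \<noteq> 0" "?p = 0" | "?q \<noteq> 0" "?p \<noteq> 0" by blast
  then show ?thesis
  proof cases
    case 1
    then show ?thesis unfolding val inf by simp
  next
    case 2
    have "\<not> holds V \<pi> e (at_infinity n (Vle s t))"
      unfolding inf using 2 holds_f_lead by blast
    moreover have "\<forall>\<^sub>F x in at_top. sg (poly ?q x) = sg (lead_coeff ?q)" by (rule eventually_sg_lead[OF 2(1)])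
    then have "\<forall>\<^sub>F x in at_top. \<not> poly ?p x \<succeq> poly ?q x"
      by eventually_elim (use 2 in \<open>auto simp: sg_def split: if_splits\<close>)
    ultimately show ?thesis unfolding val by (elim eventually_mono) blast
  next
    case 3
    let ?a = "lead_coeff ?p" and ?b = "lead_coeff ?q"
    have c: "ev \<pi> e (cf n s ! degree ?p) = ?a" "ev \<pi> e (cf n t ! degree ?q) = ?b"
      using degree_psem_less[OF 3(1)] degree_psem_less[OF 3(2)] by (simp_all add: coeff_psem)
    have i: "holds V \<pi> e (at_infinity n (Vle s t)) \<longleftrightarrow>
        (if degree ?q < degree ?p then True else if degree ?p < degree ?q then False else ?a \<succeq> ?b)"
    proof -
      have "holds V \<pi> e (at_infinity n (Vle s t)) \<longleftrightarrow> (\<exists>i<length (cf n s). \<exists>j<length (cf n t).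
        degree ?p = i \<and> degree ?q = j \<and> (if j < i then True else if i < j then False else ev \<pi> e (cf n s ! i) \<succeq> ev \<pi> e (cf n t ! j)))"
        unfolding inf using 3 holds_f_lead by blast
      also have "\<dots> \<longleftrightarrow> (if degree ?q < degree ?p then True else if degree ?p < degree ?q then False else ?a \<succeq> ?b)"
        using degree_psem_less[OF 3(1)] degree_psem_less[OF 3(2)] c by auto
      finally show ?thesis .
    qed
    have "?a \<noteq> 0" "?b \<noteq> 0" using 3 by auto
    from eventually_dom_monomials[OF this w, of "degree ?p" "degree ?q"]
      eventually_lead_dom[OF 3(2)] eventually_lead_dom[OF 3(1)]
    show ?thesis unfolding val i
    proof eventually_elim
      case (elim x)
      have "poly ?p x \<succeq> poly ?q x \<longleftrightarrow> ?a * x ^ degree ?p \<succeq> ?b * x ^ degree ?q"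
      proof
        assume "poly ?p x \<succeq> poly ?q x"
        with elim show "?a * x ^ degree ?p \<succeq> ?b * x ^ degree ?q" by (meson dom_trans)
      next
        assume "?a * x ^ degree ?p \<succeq> ?b * x ^ degree ?q"
        with elim show "poly ?p x \<succeq> poly ?q x" by (meson dom_trans)
      qed
      with elim(1) show ?case by (simp only:)
    qed
  qed
qed

lemma eventually_at_infinity:
  assumes w: "w \<notin> V" and f: "qf f"
  shows "\<forall>\<^sub>F x in at_top. holds V \<pi> (e(n := x)) f \<longleftrightarrow> holds V \<pi> e (at_infinity n f)"
  using f
proof (induction f)
  case (Pos t)
  let ?p = "psem \<pi> e (cf n t)"
  have inf: "holds V \<pi> e (at_infinity n (Pos t)) \<longleftrightarrow> (\<exists>i<length (cf n t).
      holds V \<pi> e (f_lead (cf n t) i) \<and> 0 < ev \<pi> e (cf n t ! i))"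
    unfolding at_infinity.simps holds_FDisj_map by (simp add: Bex_def)
  show ?case
  proof (cases "?p = 0")
    case True
    then have "\<not> holds V \<pi> e (at_infinity n (Pos t))" unfolding inf using holds_f_lead by blast
    moreover have "\<not> holds V \<pi> (e(n := x)) (Pos t)" for x
      using True poly_cf[of \<pi> e n t x] by simp
    ultimately show ?thesis by (intro always_eventually) blast
  next
    case False
    have "holds V \<pi> e (at_infinity n (Pos t)) \<longleftrightarrow> (\<exists>i<length (cf n t). degree ?p = i \<and> 0 < ev \<pi> e (cf n t ! i))"
      unfolding inf using False holds_f_lead by blast
    also have "\<dots> \<longleftrightarrow> 0 < lead_coeff ?p"
      using degree_psem_less[OF False] by (auto simp: coeff_psem)
    finally have i: "holds V \<pi> e (at_infinity n (Pos t)) \<longleftrightarrow> 0 < lead_coeff ?p" .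
    from eventually_sg_lead[OF False] show ?thesis unfolding i
    proof eventually_elim
      case (elim x)
      have "holds V \<pi> (e(n := x)) (Pos t) \<longleftrightarrow> 0 < poly ?p x" by (simp only: holds.simps poly_cf)
      also have "\<dots> \<longleftrightarrow> 0 < lead_coeff ?p" using elim by (auto simp: sg_def split: if_splits)
      finally show ?case .
    qed
  qed
next
  case (Vle s t)
  show ?case by (rule eventually_at_infinity_atom[OF w])
next
  case (FNot f)
  then show ?case by simp
next
  case (FAnd f g)
  from FAnd.prems have q: "qf f" "qf g" by auto
  from FAnd.IH(1)[OF q(1)] FAnd.IH(2)[OF q(2)] show ?case by eventually_elim simp
qed auto

end

subsection \<open>Quantifier elimination with valuation\<close>

primrec terms :: "'a fm \<Rightarrow> 'a tm list" where
  "terms FTrue = []"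
| "terms (Pos t) = [t]"
| "terms (Vle s t) = [s, t]"
| "terms (FNot f) = terms f"
| "terms (FAnd f g) = terms f @ terms g"
| "terms (FEx n f) = terms f"

definition vqe_polys :: "'a fm \<Rightarrow> 'a tm list list" where
  "vqe_polys f = derivatives (map upoly (terms f))"

text \<open>A crude common degree bound. The exponents in \<open>crit\<close> are differences of
  Taylor indices, so it bounds them too.\<close>

definition vqe_bound :: "'a fm \<Rightarrow> nat" where
  "vqe_bound f = sum_list (map length (vqe_polys f))"

text \<open>After the quantifier over the candidate is eliminated, \<open>TVar 9\<close> is the only
  foreign variable left. The truth value is the same for every positive value outside the valuation
  ring, so it may be computed at infinity.\<close>

definition vqe :: "'a fm \<Rightarrow> 'a fm" where
  "vqe f = (let C = f_cand (vqe_polys f) (vqe_bound f); g = localize (vqe_polys f) (vqe_bound f) f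
     in at_infinity 9 (split_v (vatoms g) (\<lambda>_. False) (FAnd C g)))"

lemma qf_vqe: "qf (vqe f)"
  by (simp add: vqe_def Let_def qf_at_infinity)

lemma holds_terms_cong:
  assumes "qf f" "\<And>t. t \<in> set (terms f) \<Longrightarrow> sg (ev \<pi> e t) = sg (ev \<pi> e' t)"
    "\<And>s t. s \<in> set (terms f) \<Longrightarrow> t \<in> set (terms f) \<Longrightarrow> vdom V (ev \<pi> e s) (ev \<pi> e t) \<longleftrightarrow> vdom V (ev \<pi> e' s) (ev \<pi> e' t)"
  shows "holds V \<pi> e f \<longleftrightarrow> holds V \<pi> e' f"
  using assms
proof (induction f)
  case (Pos t)
  then have "sg (ev \<pi> e t) = sg (ev \<pi> e' t)" by simp
  then show ?case by (auto simp: sg_def split: if_splits)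
qed auto

text \<open>This provides the independence from \<open>TVar 0\<close> on which the splitting before
  the quantifier relies.\<close>

lemma vatoms_localize:
  assumes "(s, t) \<in> set (vatoms (localize ds M f))"
  shows "s \<in> range (zero_var 0) \<and> t \<in> range (zero_var 0)"
proof -
  have vf: "vatoms f = []" if "vfree f" for f :: "'a fm"
    using that by (induction f) auto
  have disj: "set (vatoms (FDisj fs)) = (\<Union>f\<in>set fs. set (vatoms f))" for fs :: "'a fm list"
    by (induction fs) (auto simp: FDisj_def FOr_def FFalse_def)
  have "s \<in> range (zero_var 0) \<and> t \<in> range (zero_var 0)"
    if "(s, t) \<in> set (vatoms (f_vle (ratio_polys ds M u v) p q))" for u v p q
  proof -
    have "\<exists>r\<in>set (ratio_polys ds M u v). \<exists>i<length r. \<exists>j<length r. s = r ! j \<and> t = r ! i"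
      using that unfolding f_vle_def FOr_def vatoms.simps disj
      by (auto simp: vf disj) (use less_trans in blast)
    then obtain r i j where r: "r \<in> set (ratio_polys ds M u v)" "i < length r" "j < length r" "s = r ! j" "t = r ! i"
      by blast
    then obtain c where "r = map (zero_var 0) c" by (auto simp: ratio_polys_def)
    then show ?thesis using r by auto
  qed
  then show ?thesis using assms by (induction f) (auto simp: FFalse_def)
qed

theorem holds_vqe:
  fixes V :: "'k::rcf set"
  assumes conv: "convex_ring V" and proper: "V \<noteq> UNIV" and f: "qf f"
  shows "holds V \<pi> (\<lambda>_. 0) (vqe f) \<longleftrightarrow> (\<exists>x. holds V \<pi> ((\<lambda>_. 0)(0 := x)) f)"
proof -
  interpret convex_valuation V by unfold_locales (rule conv)
  define ds where "ds = vqe_polys f"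
  define M where "M = vqe_bound f"
  define g where "g = localize ds M f"
  define D where "D = psem \<pi> (\<lambda>_. 0) ` set ds"
  define F where "F = split_v (vatoms g) (\<lambda>_. False) (FAnd (f_cand ds M) g)"
  have vqe: "vqe f = at_infinity 9 F"
    by (simp add: vqe_def Let_def F_def g_def ds_def M_def)
  have closed: "closed_list q" if "q \<in> set ds" for q
    using that closed_list_derivatives[of "map upoly (terms f)" q] closed_list_upoly
    unfolding ds_def vqe_polys_def by auto
  have finD: "finite D" by (simp add: D_def)
  have pD: "pderiv q \<in> D" if qD: "q \<in> D" for q
  proof -
    obtain c where c: "c \<in> set ds" "q = psem \<pi> (\<lambda>_. 0) c" using qD by (auto simp: D_def)
    then have "pder c \<in> set ds" using set_derivatives_pder unfolding ds_def vqe_polys_def by blast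
    then show ?thesis unfolding D_def c(2) psem_pder[symmetric] by (rule imageI)
  qed
  have degD: "degree q \<le> M" if qD: "q \<in> D" for q
  proof -
    obtain c where c: "c \<in> set ds" "q = psem \<pi> (\<lambda>_. 0) c" using qD by (auto simp: D_def)
    have "length c \<le> M"
      unfolding M_def vqe_bound_def ds_def[symmetric] using c(1) by (intro member_le_sum_list) auto
    moreover have "degree q \<le> length c"
      unfolding c(2) by (rule degree_le) (simp add: coeff_psem)
    ultimately show ?thesis by simp
  qed
  obtain w0 where w0: "w0 \<notin> V" using proper by auto
  have "qf F" unfolding F_def by (rule qf_split_v)
  \<comment> \<open>One large w serves two ends: exceeding |w0| puts it outside V by convexity, and
    at it the formula agrees with its value at infinity.\<close>
  have "\<forall>\<^sub>F w in at_top. w > max 0 \<bar>w0\<bar> \<and> (holds V \<pi> ((\<lambda>_. 0)(9 := w)) F \<longleftrightarrow> holds V \<pi> (\<lambda>_. 0) (vqe f))"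
    unfolding vqe by (intro eventually_conj eventually_gt_at_top eventually_at_infinity[OF w0 \<open>qf F\<close>])
  then obtain w where w: "w > max 0 \<bar>w0\<bar>" "holds V \<pi> ((\<lambda>_. 0)(9 := w)) F \<longleftrightarrow> holds V \<pi> (\<lambda>_. 0) (vqe f)"
    using eventually_happens'[OF trivial_limit_at_top_linorder] by blast
  have w': "w > 0" "w \<notin> V"
    using w(1) w0 V_convex[of w w0] by (auto simp: less_imp_le)
  define e :: "nat \<Rightarrow> 'k" where "e = (\<lambda>_. 0)(9 := w)"
  have inv: "ev \<pi> (e(0 := z)) s = ev \<pi> e s" if "s \<in> range (zero_var 0)" for s z
    using that by (auto simp: ev_zero_var)
  have "holds V \<pi> e F \<longleftrightarrow> (\<exists>z. holds V \<pi> (e(0 := z)) (FAnd (f_cand ds M) g))"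
  proof -
    define a where "a = (\<lambda>v. if v \<in> set (vatoms g) then vdom V (ev \<pi> e (fst v)) (ev \<pi> e (snd v)) else False)"
    have "holds V \<pi> (e(0 := z)) (subst_v a g) \<longleftrightarrow> holds V \<pi> (e(0 := z)) g" for z
    proof (rule holds_subst_v)
      show "qf g" by (simp add: g_def qf_localize)
      fix s t assume "(s, t) \<in> set (vatoms g)"
      then show "a (s, t) \<longleftrightarrow> ev \<pi> (e(0 := z)) s \<succeq> ev \<pi> (e(0 := z)) t"
        using vatoms_localize[of s t ds M f] inv by (simp add: a_def g_def)
    qed
    then show ?thesis
      unfolding F_def holds_split_v a_def[symmetric] subst_v.simps subst_v_vfree[OF vfree_f_cand]
      by simp
  qed
  also have "\<dots> \<longleftrightarrow> (\<exists>z. cand D M w z \<and> holds V \<pi> ((\<lambda>_. 0)(0 := z)) f)"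
  proof -
    have "holds V \<pi> (e(0 := z)) (FAnd (f_cand ds M) g) \<longleftrightarrow> cand D M w z \<and> holds V \<pi> ((\<lambda>_. 0)(0 := z)) f" for z
    proof -
      have e9: "(e(0 := z)) 9 = w" "(e(0 := z)) 0 = z" by (simp_all add: e_def)
      have "holds V \<pi> (e(0 := z)) (f_cand ds M) \<longleftrightarrow> cand D M w z"
        using holds_f_cand[OF closed D_def, of V "e(0 := z)" M] unfolding e9 by blast
      moreover have "holds V \<pi> (e(0 := z)) g \<longleftrightarrow> holds V \<pi> ((\<lambda>_. 0)(0 := z)) f" if "cand D M w z"
        using holds_localize[OF closed D_def, of "e(0 := z)" M f] w'(1) that f unfolding e9 g_def by simp
      ultimately show ?thesis by auto
    qed
    then show ?thesis by simp
  qed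
  also have "\<dots> \<longleftrightarrow> (\<exists>x. holds V \<pi> ((\<lambda>_. 0)(0 := x)) f)"
  proof
    assume "\<exists>x. holds V \<pi> ((\<lambda>_. 0)(0 := x)) f"
    then obtain x where x: "holds V \<pi> ((\<lambda>_. 0)(0 := x)) f" by blast
    obtain z where z: "cand D M w z" "\<And>p. p \<in> D \<Longrightarrow> sg (poly p z) = sg (poly p x)"
      "\<And>p q. p \<in> D \<Longrightarrow> q \<in> D \<Longrightarrow> poly p z \<succeq> poly q z \<longleftrightarrow> poly p x \<succeq> poly q x"
      using cand_complete[OF finD pD degD w'] by metis
    have mem: "psem \<pi> (\<lambda>_. 0) (upoly t) \<in> D" if "t \<in> set (terms f)" for t
    proof -
      have "upoly t \<in> set ds" unfolding ds_def vqe_polys_def using that by (intro set_derivatives_self) auto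
      then show ?thesis unfolding D_def by (rule imageI)
    qed
    have "holds V \<pi> ((\<lambda>_. 0)(0 := z)) f \<longleftrightarrow> holds V \<pi> ((\<lambda>_. 0)(0 := x)) f"
    proof (rule holds_terms_cong[OF f])
      fix s t assume s: "s \<in> set (terms f)" and t: "t \<in> set (terms f)"
      show "ev \<pi> ((\<lambda>_. 0)(0 := z)) s \<succeq> ev \<pi> ((\<lambda>_. 0)(0 := z)) t \<longleftrightarrow> ev \<pi> ((\<lambda>_. 0)(0 := x)) s \<succeq> ev \<pi> ((\<lambda>_. 0)(0 := x)) t"
        using z(3)[OF mem[OF s] mem[OF t]] unfolding poly_upoly .
    next
      fix t assume t: "t \<in> set (terms f)"
      show "sg (ev \<pi> ((\<lambda>_. 0)(0 := z)) t) = sg (ev \<pi> ((\<lambda>_. 0)(0 := x)) t)"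
        using z(2)[OF mem[OF t]] unfolding poly_upoly .
    qed
    then show "\<exists>z. cand D M w z \<and> holds V \<pi> ((\<lambda>_. 0)(0 := z)) f" using x z(1) by blast
  qed blast
  finally show ?thesis using w(2) by (simp only: e_def)
qed

subsection \<open>Formulas over ordered valued fields with carriers\<close>

primrec kev :: "('u, 'm) ring_scheme \<Rightarrow> ('a \<Rightarrow> 'u) \<Rightarrow> (nat \<Rightarrow> 'u) \<Rightarrow> 'a tm \<Rightarrow> 'u" where
  "kev K \<pi> e (TPar a) = \<pi> a"
| "kev K \<pi> e (TVar n) = e n"
| "kev K \<pi> e TZero = \<zero>\<^bsub>K\<^esub>"
| "kev K \<pi> e TOne = \<one>\<^bsub>K\<^esub>"
| "kev K \<pi> e (TAdd s t) = kev K \<pi> e s \<oplus>\<^bsub>K\<^esub> kev K \<pi> e t"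
| "kev K \<pi> e (TMul s t) = kev K \<pi> e s \<otimes>\<^bsub>K\<^esub> kev K \<pi> e t"
| "kev K \<pi> e (TNeg t) = \<ominus>\<^bsub>K\<^esub> kev K \<pi> e t"

primrec kholds :: "'u ovring \<Rightarrow> ('a \<Rightarrow> 'u) \<Rightarrow> (nat \<Rightarrow> 'u) \<Rightarrow> 'a fm \<Rightarrow> bool" where
  "kholds K \<pi> e FTrue \<longleftrightarrow> True"
| "kholds K \<pi> e (Pos t) \<longleftrightarrow> ole K \<zero>\<^bsub>K\<^esub> (kev K \<pi> e t) \<and> kev K \<pi> e t \<noteq> \<zero>\<^bsub>K\<^esub>"
| "kholds K \<pi> e (Vle s t) \<longleftrightarrow> vle K (kev K \<pi> e s) (kev K \<pi> e t)"
| "kholds K \<pi> e (FNot f) \<longleftrightarrow> \<not> kholds K \<pi> e f"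
| "kholds K \<pi> e (FAnd f g) \<longleftrightarrow> kholds K \<pi> e f \<and> kholds K \<pi> e g"
| "kholds K \<pi> e (FEx n f) \<longleftrightarrow> (\<exists>x\<in>carrier K. kholds K \<pi> (e(n := x)) f)"

text \<open>Both eliminations are put into one predicate, so that a single hypothetical
  counterexample refutes either of them.\<close>

definition admits_qe :: "'a itself \<Rightarrow> 'u ovring \<Rightarrow> bool" where
  "admits_qe T K \<longleftrightarrow> (\<forall>(f :: 'a fm) \<pi> e. range \<pi> \<subseteq> carrier K \<longrightarrow> range e \<subseteq> carrier K \<longrightarrow>
     (vfree f \<longrightarrow> (kholds K \<pi> e (rqe f) \<longleftrightarrow> kholds K \<pi> e f)) \<and>
     (real_closed_valued_field K \<and> qf f \<longrightarrow> (kholds K \<pi> (\<lambda>_. \<zero>\<^bsub>K\<^esub>) (vqe f) \<longleftrightarrow>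
       (\<exists>x\<in>carrier K. kholds K \<pi> ((\<lambda>_. \<zero>\<^bsub>K\<^esub>)(0 := x)) f))))"

text \<open>The results for the type class \<open>rcf\<close> carry over to fields with a carrier as follows. If some
  real closed field did not admit quantifier elimination, then the carrier of such a field, fixed by
  choice, could be made into a type of class \<open>rcf\<close>, which is impossible. Since the type has to be of
  this class unconditionally, the real numbers serve as a default.\<close>

definition counterexample_exists :: "'a itself \<Rightarrow> 'u itself \<Rightarrow> bool" where
  "counterexample_exists T U \<longleftrightarrow> (\<exists>K :: 'u ovring. real_closed_field K \<and> \<not> admits_qe T K)"

definition counterexample :: "'a itself \<Rightarrow> 'u ovring" where
  "counterexample T = (SOME K. real_closed_field K \<and> \<not> admits_qe T K)"

lemma counterexample:
  "counterexample_exists T TYPE('u) \<Longrightarrow> real_closed_field (counterexample T :: 'u ovring)"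
  "counterexample_exists T TYPE('u) \<Longrightarrow> \<not> admits_qe T (counterexample T :: 'u ovring)"
  unfolding counterexample_exists_def counterexample_def by (metis (mono_tags, lifting) someI_ex)+

typedef ('a, 'u) cfield = "{x :: 'u + real. if counterexample_exists TYPE('a) TYPE('u)
    then x \<in> Inl ` carrier (counterexample TYPE('a)) else x \<in> range Inr}"
proof (cases "counterexample_exists TYPE('a) TYPE('u)")
  case True
  interpret real_closed_field "counterexample TYPE('a) :: 'u ovring" by (rule counterexample(1)[OF True])
  show ?thesis using True zero_closed by (intro exI[of _ "Inl \<zero>\<^bsub>counterexample TYPE('a)\<^esub>"]) auto
qed auto

definition kr :: "('a, 'u) cfield \<Rightarrow> 'u" where "kr x = projl (Rep_cfield x)"
definition rr :: "('a, 'u) cfield \<Rightarrow> real" where "rr x = projr (Rep_cfield x)"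

definition mk :: "'u \<Rightarrow> real \<Rightarrow> ('a, 'u) cfield" where
  "mk a b = Abs_cfield (if counterexample_exists TYPE('a) TYPE('u) then Inl a else Inr b)"

lemma kr_mk: "counterexample_exists TYPE('a) TYPE('u) \<Longrightarrow> a \<in> carrier (counterexample TYPE('a)) \<Longrightarrow>
    kr (mk a b :: ('a, 'u) cfield) = a"
  by (simp add: kr_def mk_def Abs_cfield_inverse)

lemma rr_mk: "\<not> counterexample_exists TYPE('a) TYPE('u) \<Longrightarrow> rr (mk a b :: ('a, 'u) cfield) = b"
  by (simp add: rr_def mk_def Abs_cfield_inverse)

lemma kr_closed: "counterexample_exists TYPE('a) TYPE('u) \<Longrightarrow> kr (x :: ('a, 'u) cfield) \<in> carrier (counterexample TYPE('a))"
  using Rep_cfield[of x] by (auto simp: kr_def)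

lemma kr_eq: "counterexample_exists TYPE('a) TYPE('u) \<Longrightarrow> x = y \<longleftrightarrow> kr x = kr (y :: ('a, 'u) cfield)"
  using Rep_cfield[of x] Rep_cfield[of y] by (auto simp: kr_def Rep_cfield_inject[symmetric])

lemma rr_eq: "\<not> counterexample_exists TYPE('a) TYPE('u) \<Longrightarrow> x = y \<longleftrightarrow> rr x = rr (y :: ('a, 'u) cfield)"
  using Rep_cfield[of x] Rep_cfield[of y] by (auto simp: rr_def Rep_cfield_inject[symmetric])

instantiation cfield :: (type, type) "{plus, zero, one, minus, uminus, times, inverse, linorder, abs, sgn}"
begin

definition zero_cfield :: "('a, 'b) cfield" where "zero_cfield = mk \<zero>\<^bsub>counterexample TYPE('a)\<^esub> 0"
definition one_cfield :: "('a, 'b) cfield" where "one_cfield = mk \<one>\<^bsub>counterexample TYPE('a)\<^esub> 1"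
definition plus_cfield :: "('a, 'b) cfield \<Rightarrow> ('a, 'b) cfield \<Rightarrow> ('a, 'b) cfield" where
  "plus_cfield x y = (mk (kr x \<oplus>\<^bsub>counterexample TYPE('a)\<^esub> kr y) (rr x + rr y) :: ('a, 'b) cfield)"
definition times_cfield :: "('a, 'b) cfield \<Rightarrow> ('a, 'b) cfield \<Rightarrow> ('a, 'b) cfield" where
  "times_cfield x y = (mk (kr x \<otimes>\<^bsub>counterexample TYPE('a)\<^esub> kr y) (rr x * rr y) :: ('a, 'b) cfield)"
definition uminus_cfield :: "('a, 'b) cfield \<Rightarrow> ('a, 'b) cfield" where
  "uminus_cfield x = mk (\<ominus>\<^bsub>counterexample TYPE('a)\<^esub> kr x) (- rr x)"
definition minus_cfield :: "('a, 'b) cfield \<Rightarrow> ('a, 'b) cfield \<Rightarrow> ('a, 'b) cfield" where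
  "minus_cfield x y = x + (- y :: ('a, 'b) cfield)"
definition inverse_cfield :: "('a, 'b) cfield \<Rightarrow> ('a, 'b) cfield" where
  "inverse_cfield x = (if x = 0 then 0 else mk (inv\<^bsub>counterexample TYPE('a)\<^esub> kr x) (inverse (rr x)))"
definition divide_cfield :: "('a, 'b) cfield \<Rightarrow> ('a, 'b) cfield \<Rightarrow> ('a, 'b) cfield" where
  "divide_cfield x y = x * (inverse y :: ('a, 'b) cfield)"
definition less_eq_cfield :: "('a, 'b) cfield \<Rightarrow> ('a, 'b) cfield \<Rightarrow> bool" where
  "less_eq_cfield x (y :: ('a, 'b) cfield) \<longleftrightarrow> (if counterexample_exists TYPE('a) TYPE('b)
     then ole (counterexample TYPE('a)) (kr x) (kr y) else rr x \<le> rr y)"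
definition less_cfield :: "('a, 'b) cfield \<Rightarrow> ('a, 'b) cfield \<Rightarrow> bool" where
  "less_cfield x (y :: ('a, 'b) cfield) \<longleftrightarrow> x \<le> y \<and> \<not> y \<le> x"
definition abs_cfield :: "('a, 'b) cfield \<Rightarrow> ('a, 'b) cfield" where
  "abs_cfield x = (if x < 0 then - x else (x :: ('a, 'b) cfield))"
definition sgn_cfield :: "('a, 'b) cfield \<Rightarrow> ('a, 'b) cfield" where
  "sgn_cfield x = (if x = 0 then 0 else if 0 < x then 1 else - 1 :: ('a, 'b) cfield)"

instance
proof
  fix x y z :: "('a, 'b) cfield"
  show "x < y \<longleftrightarrow> x \<le> y \<and> \<not> y \<le> x" by (rule less_cfield_def)
  have key: "x \<le> x \<and> (x \<le> y \<longrightarrow> y \<le> z \<longrightarrow> x \<le> z) \<and> (x \<le> y \<longrightarrow> y \<le> x \<longrightarrow> x = y) \<and> (x \<le> y \<or> y \<le> x)"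
  proof (cases "counterexample_exists TYPE('a) TYPE('b)")
    case True
    interpret real_closed_field "counterexample TYPE('a) :: 'b ovring" by (rule counterexample(1)[OF True])
    note c = kr_closed[OF True]
    show "x \<le> x \<and> (x \<le> y \<longrightarrow> y \<le> z \<longrightarrow> x \<le> z) \<and> (x \<le> y \<longrightarrow> y \<le> x \<longrightarrow> x = y) \<and> (x \<le> y \<or> y \<le> x)"
      unfolding less_eq_cfield_def if_P[OF True]
    proof (intro conjI impI)
      let ?K = "counterexample TYPE('a) :: 'b ovring"
      show "ole ?K (kr x) (kr x)" by (rule ole_refl[OF c])
      show "ole ?K (kr x) (kr z)" if "ole ?K (kr x) (kr y)" "ole ?K (kr y) (kr z)" by (rule ole_trans[OF c c c that])
      show "x = y" if "ole ?K (kr x) (kr y)" "ole ?K (kr y) (kr x)"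
        unfolding kr_eq[OF True] by (rule ole_antisym[OF c c that])
      show "ole ?K (kr x) (kr y) \<or> ole ?K (kr y) (kr x)" by (rule ole_total[OF c c])
    qed
  next
    case False
    show "x \<le> x \<and> (x \<le> y \<longrightarrow> y \<le> z \<longrightarrow> x \<le> z) \<and> (x \<le> y \<longrightarrow> y \<le> x \<longrightarrow> x = y) \<and> (x \<le> y \<or> y \<le> x)"
      unfolding less_eq_cfield_def rr_eq[OF False] using False by auto
  qed
  note k = key[THEN conjunct1] key[THEN conjunct2, THEN conjunct1] key[THEN conjunct2, THEN conjunct2, THEN conjunct1]
    key[THEN conjunct2, THEN conjunct2, THEN conjunct2]
  show "x \<le> x" by (rule k(1))
  show "x \<le> y \<Longrightarrow> y \<le> z \<Longrightarrow> x \<le> z" by (rule k(2)[rule_format])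
  show "x \<le> y \<Longrightarrow> y \<le> x \<Longrightarrow> x = y" by (rule k(3)[rule_format])
  show "x \<le> y \<or> y \<le> x" by (rule k(4))
qed

end

section \<open>The type of the counterexample as a real closed field\<close>

context
  assumes CE: "counterexample_exists TYPE('a) TYPE('u)"
begin

interpretation CK: real_closed_field "counterexample TYPE('a) :: 'u ovring" by (rule counterexample(1)[OF CE])

lemma kr_ops:
  fixes x y :: "('a, 'u) cfield"
  shows "kr (0 :: ('a, 'u) cfield) = \<zero>\<^bsub>counterexample TYPE('a)\<^esub>" "kr (1 :: ('a, 'u) cfield) = \<one>\<^bsub>counterexample TYPE('a)\<^esub>"
    "kr (x + y) = kr x \<oplus>\<^bsub>counterexample TYPE('a)\<^esub> kr y" "kr (x * y) = kr x \<otimes>\<^bsub>counterexample TYPE('a)\<^esub> kr y"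
    "kr (- x) = \<ominus>\<^bsub>counterexample TYPE('a)\<^esub> kr x"
  unfolding zero_cfield_def one_cfield_def plus_cfield_def times_cfield_def uminus_cfield_def
  using kr_closed[OF CE] by (simp_all add: kr_mk[OF CE])

lemma kr_inverse:
  fixes x :: "('a, 'u) cfield"
  assumes "x \<noteq> 0"
  shows "kr (inverse x) = inv\<^bsub>counterexample TYPE('a)\<^esub> kr x" "kr x \<in> Units (counterexample TYPE('a))"
proof -
  have "kr x \<noteq> \<zero>\<^bsub>counterexample TYPE('a)\<^esub>" using assms kr_eq[OF CE] kr_ops(1) by metis
  then show u: "kr x \<in> Units (counterexample TYPE('a))" using kr_closed[OF CE] CK.field_Units by auto
  then show "kr (inverse x) = inv\<^bsub>counterexample TYPE('a)\<^esub> kr x"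
    unfolding inverse_cfield_def using assms by (simp add: kr_mk[OF CE])
qed

lemma kr_le: "x \<le> y \<longleftrightarrow> ole (counterexample TYPE('a)) (kr x) (kr (y :: ('a, 'u) cfield))"
  using CE by (simp add: less_eq_cfield_def)

lemma kr_field_axioms:
  fixes x y z :: "('a, 'u) cfield"
  shows "x + y + z = x + (y + z)" "x + y = y + x" "0 + x = x" "- x + x = 0"
    "x * y * z = x * (y * z)" "x * y = y * x" "1 * x = x" "(x + y) * z = x * z + y * z"
    "(0 :: ('a, 'u) cfield) \<noteq> 1" "x \<noteq> 0 \<Longrightarrow> inverse x * x = 1"
    "x \<le> y \<Longrightarrow> z + x \<le> z + y" "0 \<le> x \<Longrightarrow> 0 \<le> y \<Longrightarrow> 0 \<le> x * y" "x * y = 0 \<Longrightarrow> x = 0 \<or> y = 0"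
    "0 \<le> x \<Longrightarrow> \<exists>y. y * y = x"
proof -
  note c = kr_closed[OF CE]
  show "x + y + z = x + (y + z)" "x + y = y + x" "0 + x = x" "- x + x = 0"
    "x * y * z = x * (y * z)" "x * y = y * x" "1 * x = x" "(x + y) * z = x * z + y * z"
    "(0 :: ('a, 'u) cfield) \<noteq> 1"
    unfolding kr_eq[OF CE] kr_ops using c
    by (simp_all add: CK.a_ac CK.m_ac CK.l_neg CK.r_neg CK.l_distr CK.r_distr)
  show "inverse x * x = 1" if "x \<noteq> 0"
    unfolding kr_eq[OF CE] kr_ops kr_inverse(1)[OF that] using kr_inverse(2)[OF that] by simp
  show "x \<le> y \<Longrightarrow> z + x \<le> z + y"
    unfolding kr_le kr_ops using c CK.ole_add[of "kr x" "kr y" "kr z"] by (simp add: CK.a_comm)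
  show "0 \<le> x \<Longrightarrow> 0 \<le> y \<Longrightarrow> 0 \<le> x * y"
    unfolding kr_le kr_ops using c CK.ole_mult by blast
  show "x * y = 0 \<Longrightarrow> x = 0 \<or> y = 0"
    unfolding kr_eq[OF CE] kr_ops using c CK.integral by blast
  show "\<exists>y. y * y = x" if "0 \<le> x"
  proof -
    obtain a where "a \<in> carrier (counterexample TYPE('a))" "a \<otimes>\<^bsub>counterexample TYPE('a)\<^esub> a = kr x"
      using CK.nonneg_square[OF c] \<open>0 \<le> x\<close> unfolding kr_le kr_ops by blast
    then have "(mk a 0 :: ('a, 'u) cfield) * mk a 0 = x"
      unfolding kr_eq[OF CE] kr_ops by (simp add: kr_mk[OF CE])
    then show ?thesis by blast
  qed
qed

end

context
  assumes nCE: "\<not> counterexample_exists TYPE('a) TYPE('u)"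
begin

lemma rr_ops:
  fixes x y :: "('a, 'u) cfield"
  shows "rr (0 :: ('a, 'u) cfield) = 0" "rr (1 :: ('a, 'u) cfield) = 1"
    "rr (x + y) = rr x + rr y" "rr (x * y) = rr x * rr y" "rr (- x) = - rr x"
  unfolding zero_cfield_def one_cfield_def plus_cfield_def times_cfield_def uminus_cfield_def
  by (simp_all add: rr_mk[OF nCE])

lemma rr_inverse: "rr (inverse x) = inverse (rr (x :: ('a, 'u) cfield))"
  unfolding inverse_cfield_def by (auto simp: rr_mk[OF nCE] rr_ops)

lemma rr_le: "x \<le> y \<longleftrightarrow> rr x \<le> rr (y :: ('a, 'u) cfield)"
  using nCE by (simp add: less_eq_cfield_def)

lemma rr_field_axioms:
  fixes x y z :: "('a, 'u) cfield"
  shows "x + y + z = x + (y + z)" "x + y = y + x" "0 + x = x" "- x + x = 0"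
    "x * y * z = x * (y * z)" "x * y = y * x" "1 * x = x" "(x + y) * z = x * z + y * z"
    "(0 :: ('a, 'u) cfield) \<noteq> 1" "x \<noteq> 0 \<Longrightarrow> inverse x * x = 1"
    "x \<le> y \<Longrightarrow> z + x \<le> z + y" "0 \<le> x \<Longrightarrow> 0 \<le> y \<Longrightarrow> 0 \<le> x * y" "x * y = 0 \<Longrightarrow> x = 0 \<or> y = 0"
    "0 \<le> x \<Longrightarrow> \<exists>y. y * y = x"
proof -
  show "x + y + z = x + (y + z)" "x + y = y + x" "0 + x = x" "- x + x = 0"
    "x * y * z = x * (y * z)" "x * y = y * x" "1 * x = x" "(x + y) * z = x * z + y * z"
    "(0 :: ('a, 'u) cfield) \<noteq> 1" "x \<noteq> 0 \<Longrightarrow> inverse x * x = 1"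
    "x \<le> y \<Longrightarrow> z + x \<le> z + y" "0 \<le> x \<Longrightarrow> 0 \<le> y \<Longrightarrow> 0 \<le> x * y" "x * y = 0 \<Longrightarrow> x = 0 \<or> y = 0"
    unfolding rr_eq[OF nCE] rr_ops rr_le rr_inverse by (simp_all add: algebra_simps)
  assume "0 \<le> x"
  then have "(mk undefined (sqrt (rr x)) :: ('a, 'u) cfield) * mk undefined (sqrt (rr x)) = x"
    unfolding rr_eq[OF nCE] rr_ops rr_le by (simp add: rr_mk[OF nCE])
  then show "\<exists>y. y * y = x" by blast
qed

end

instance cfield :: (type, type) comm_ring_1
proof
  fix x y z :: "('a, 'b) cfield"
  note ax = kr_field_axioms[where 'a = 'a and 'u = 'b] rr_field_axioms[where 'a = 'a and 'u = 'b]
  show "x + y + z = x + (y + z)" using ax(1,15) by metis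
  show "x + y = y + x" using ax(2,16) by metis
  show "0 + x = x" using ax(3,17) by metis
  show "- x + x = 0" using ax(4,18) by metis
  show "x - y = x + - y" by (rule minus_cfield_def)
  show "x * y * z = x * (y * z)" using ax(5,19) by metis
  show "x * y = y * x" using ax(6,20) by metis
  show "1 * x = x" using ax(7,21) by metis
  show "(x + y) * z = x * z + y * z" using ax(8,22) by metis
  show "(0 :: ('a, 'b) cfield) \<noteq> 1" using ax(9,23) by metis
qed

instance cfield :: (type, type) linordered_field
proof
  fix x y z :: "('a, 'b) cfield"
  note ax = kr_field_axioms[where 'a = 'a and 'u = 'b] rr_field_axioms[where 'a = 'a and 'u = 'b]
  show "x \<noteq> 0 \<Longrightarrow> inverse x * x = 1" using ax(10,24) by metis
  show "x / y = x * inverse y" by (rule divide_cfield_def)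
  show "inverse (0 :: ('a, 'b) cfield) = 0" by (simp add: inverse_cfield_def)
  show addm: "x \<le> y \<Longrightarrow> z + x \<le> z + y" for x y z :: "('a, 'b) cfield" using ax(11,25) by metis
  show "\<bar>x\<bar> = (if x < 0 then - x else x)" by (rule abs_cfield_def)
  show "sgn x = (if x = 0 then 0 else if 0 < x then 1 else - 1)" by (rule sgn_cfield_def)
  show "x < y \<Longrightarrow> 0 < z \<Longrightarrow> z * x < z * y"
  proof -
    assume a: "x < y" "0 < z"
    have d: "0 \<le> y - x" using addm[of x y "- x"] a(1) by simp
    have zd: "0 \<le> z * (y - x)" using ax(12,26) d a(2) by (metis less_imp_le)
    have "z * (y - x) \<noteq> 0" using ax(13,27) a by (metis less_irrefl right_minus_eq)
    then have ne: "z * x \<noteq> z * y" by (simp add: right_diff_distrib)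
    have "z * x \<le> z * y" using addm[OF zd, of "z * x"] by (simp add: right_diff_distrib)
    then show ?thesis using ne by (simp add: order_less_le)
  qed
qed

lemma real_odd_root:
  fixes p :: "real poly"
  assumes "odd (degree p)"
  shows "\<exists>x. poly p x = 0"
proof -
  have p0: "p \<noteq> 0" using assms by auto
  obtain B where B: "\<And>x. x > B \<Longrightarrow> sg (poly p x) = sg (lead_coeff p)" using sg_poly_at_top[OF p0] by blast
  obtain C where C: "\<And>x. x < C \<Longrightarrow> sg (poly p x) = - sg (lead_coeff p)"
    using sg_poly_at_bot[OF p0] assms by auto
  have a: "sg (poly p (\<bar>B\<bar> + 1)) = sg (lead_coeff p)" by (rule B) auto
  have b: "sg (poly p (- \<bar>C\<bar> - 1)) = - sg (lead_coeff p)" by (rule C) auto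
  have "poly p (- \<bar>C\<bar> - 1) * poly p (\<bar>B\<bar> + 1) < 0"
    using a b p0 by (auto simp: sg_def mult_less_0_iff split: if_splits)
  moreover have "- \<bar>C\<bar> - 1 < \<bar>B\<bar> + 1" by linarith
  ultimately show ?thesis using poly_IVT[of "- \<bar>C\<bar> - 1" "\<bar>B\<bar> + 1" p] by blast
qed

context
  assumes CE: "counterexample_exists TYPE('a) TYPE('u)"
begin

interpretation CK: real_closed_field "counterexample TYPE('a) :: 'u ovring" by (rule counterexample(1)[OF CE])

lemma kr_power: "kr ((x :: ('a, 'u) cfield) ^ n) = kr x [^]\<^bsub>counterexample TYPE('a)\<^esub> n"
  using kr_closed[OF CE] by (induction n) (simp_all add: kr_ops[OF CE] CK.m_comm)

lemma kr_sum: "kr (\<Sum>k\<le>(n::nat). f k :: ('a, 'u) cfield) = (\<Oplus>\<^bsub>counterexample TYPE('a)\<^esub>k\<in>{..n}. kr (f k))"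
  using kr_closed[OF CE] by (induction n) (simp_all add: kr_ops[OF CE] CK.finsum_Suc[symmetric] CK.a_comm Pi_def)

lemma kr_odd_root:
  fixes f :: "nat \<Rightarrow> ('a, 'u) cfield"
  assumes "odd n" "f n \<noteq> 0"
  shows "\<exists>x. (\<Sum>k\<le>n. f k * x ^ k) = 0"
proof -
  let ?K = "counterexample TYPE('a) :: 'u ovring"
  note c = kr_closed[OF CE]
  define p where "p = (\<lambda>k. if k \<le> n then kr (f k) else \<zero>\<^bsub>?K\<^esub>)"
  have bd: "bound \<zero>\<^bsub>?K\<^esub> n p" by (rule bound.intro) (simp add: p_def)
  have "p k \<in> carrier ?K" for k
    unfolding p_def by (rule if_split[THEN iffD2]) (intro conjI impI c CK.zero_closed)
  then have pu: "p \<in> up ?K" by (rule mem_upI) (rule exI[of _ n], rule bd)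
  have UPc: "carrier (UP R) = up R" for R :: "'u ovring" by (simp add: UP_def)
  have pc: "p \<in> carrier (UP ?K)" unfolding UPc by (rule pu)
  have cp: "UnivPoly.coeff (UP ?K) p k = p k" for k 
  proof -
    have "UnivPoly.coeff (UP R) q k = q k" if "q \<in> up R" for R :: "'u ovring" and q k
      using that by (simp add: UP_def)
    from this[OF pu] show ?thesis .
  qed
  interpret UP_cring ?K "UP ?K" by (unfold_locales)
  have "kr (f n) \<noteq> \<zero>\<^bsub>?K\<^esub>" using assms(2) kr_eq[OF CE, of "f n" 0] kr_ops(1)[OF CE] by simp
  then have "deg ?K p = n"
  proof (intro antisym deg_aboveI deg_belowI)
    show "UnivPoly.coeff (UP ?K) p m = \<zero>\<^bsub>?K\<^esub>" if "n < m" for m using that unfolding cp by (simp add: p_def)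
    show "UnivPoly.coeff (UP ?K) p n \<noteq> \<zero>\<^bsub>?K\<^esub>" using \<open>kr (f n) \<noteq> \<zero>\<^bsub>?K\<^esub>\<close> unfolding cp by (simp add: p_def)
  qed (use pc in auto)
  then obtain a where a: "a \<in> carrier ?K" "UnivPoly.eval ?K ?K id a p = \<zero>\<^bsub>?K\<^esub>"
    using CK.odd_degree_root[OF pc] assms(1) by auto
  have "UnivPoly.eval ?K ?K id a p = (\<Oplus>\<^bsub>?K\<^esub>i\<in>{..n}. p i \<otimes>\<^bsub>?K\<^esub> a [^]\<^bsub>?K\<^esub> i)"
    using pc \<open>deg ?K p = n\<close> by (simp add: UnivPoly.eval_def cp)
  also have "\<dots> = kr (\<Sum>k\<le>n. f k * mk a 0 ^ k)"
    unfolding kr_sum using a(1) c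
    by (intro CK.finsum_cong') (auto simp: p_def kr_ops[OF CE] kr_power kr_mk[OF CE])
  finally have "(\<Sum>k\<le>n. f k * mk a 0 ^ k) = 0"
    unfolding kr_eq[OF CE] kr_ops[OF CE] using a(2) by simp
  then show ?thesis by blast
qed

end

lemma rr_odd_root:
  fixes f :: "nat \<Rightarrow> ('a, 'u) cfield"
  assumes nCE: "\<not> counterexample_exists TYPE('a) TYPE('u)" and "odd n" "f n \<noteq> 0"
  shows "\<exists>x. (\<Sum>k\<le>n. f k * x ^ k) = 0"
proof -
  define p where "p = (\<Sum>k\<le>n. Polynomial.monom (rr (f k)) k)"
  have c: "coeff p k = (if k \<le> n then rr (f k) else 0)" for k
    by (simp add: p_def coeff_sum)
  have "rr (f n) \<noteq> 0" using assms(3) rr_eq[OF nCE, of "f n" 0] rr_ops(1)[OF nCE] by simp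
  then have "degree p = n" by (intro antisym degree_le le_degree) (auto simp: c)
  then obtain x where x: "poly p x = 0" using real_odd_root assms(2) by blast
  have pw: "rr (y ^ k) = rr y ^ k" for y :: "('a, 'u) cfield" and k
    by (induction k) (simp_all add: rr_ops[OF nCE])
  have sm: "rr (\<Sum>k\<le>n. g k) = (\<Sum>k\<le>n. rr (g k))" for g :: "nat \<Rightarrow> ('a, 'u) cfield" and n
    by (induction n) (simp_all add: rr_ops[OF nCE])
  have "rr (\<Sum>k\<le>n. f k * mk undefined x ^ k) = poly p x"
    by (simp add: sm pw rr_ops[OF nCE] rr_mk[OF nCE] p_def poly_sum poly_monom)
  then have "(\<Sum>k\<le>n. f k * mk undefined x ^ k) = 0"
    unfolding rr_eq[OF nCE] rr_ops[OF nCE] using x by simp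
  then show ?thesis by blast
qed

instance cfield :: (type, type) rcf
proof
  fix x :: "('a, 'b) cfield"
  show "0 \<le> x \<Longrightarrow> \<exists>y. y * y = x"
    using kr_field_axioms(14)[where 'a = 'a and 'u = 'b] rr_field_axioms(14)[where 'a = 'a and 'u = 'b] by blast
next
  fix n :: nat and f :: "nat \<Rightarrow> ('a, 'b) cfield"
  show "odd n \<Longrightarrow> f n \<noteq> 0 \<Longrightarrow> \<exists>x. (\<Sum>k\<le>n. f k * x ^ k) = 0"
    using kr_odd_root[where 'a = 'a and 'u = 'b] rr_odd_root[where 'a = 'a and 'u = 'b] by blast
qed

context
  assumes CE: "counterexample_exists TYPE('a) TYPE('u)"
begin

interpretation CK: real_closed_field "counterexample TYPE('a) :: 'u ovring" by (rule counterexample(1)[OF CE])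

lemma ex_kr: "(\<exists>x :: ('a, 'u) cfield. P (kr x)) \<longleftrightarrow> (\<exists>a\<in>carrier (counterexample TYPE('a)). P a)"
proof
  assume "\<exists>a\<in>carrier (counterexample TYPE('a)). P a"
  then obtain a where a: "a \<in> carrier (counterexample TYPE('a))" "P a" by blast
  have "kr (mk a 0 :: ('a, 'u) cfield) = a" by (rule kr_mk[OF CE a(1)])
  then show "\<exists>x :: ('a, 'u) cfield. P (kr x)" using a(2) by metis
next
  assume "\<exists>x :: ('a, 'u) cfield. P (kr x)"
  then show "\<exists>a\<in>carrier (counterexample TYPE('a)). P a" using kr_closed[OF CE] by blast
qed

lemma kr_ev: "kr (ev \<pi> e t :: ('a, 'u) cfield) = kev (counterexample TYPE('a)) (kr \<circ> \<pi>) (kr \<circ> e) t"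
  by (induction t) (simp_all add: kr_ops[OF CE])

lemma kr_holds:
  fixes \<pi> :: "'b \<Rightarrow> ('a, 'u) cfield"
  shows "holds {x. kr x \<in> vring (counterexample TYPE('a))} \<pi> e f \<longleftrightarrow>
    kholds (counterexample TYPE('a)) (kr \<circ> \<pi>) (kr \<circ> e) f"
proof (induction f arbitrary: e)
  case (Pos t)
  have "0 < x \<longleftrightarrow> ole (counterexample TYPE('a)) \<zero>\<^bsub>counterexample TYPE('a)\<^esub> (kr x) \<and> kr x \<noteq> \<zero>\<^bsub>counterexample TYPE('a)\<^esub>"
    for x :: "('a, 'u) cfield"
    using kr_le[OF CE, of 0 x] kr_eq[OF CE, of x 0] unfolding kr_ops[OF CE] by (auto simp: order_less_le)
  then show ?case by (simp only: holds.simps kholds.simps kr_ev)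
next
  case (Vle s t)
  have "vdom {x. kr x \<in> vring (counterexample TYPE('a))} x y \<longleftrightarrow> vle (counterexample TYPE('a)) (kr x) (kr y)"
    for x y :: "('a, 'u) cfield"
  proof (cases "x = 0")
    case True
    then show ?thesis using kr_eq[OF CE, of y 0] by (simp add: vdom_def vle_def kr_ops[OF CE])
  next
    case False
    have "kr (y / x) = kr y \<otimes>\<^bsub>counterexample TYPE('a)\<^esub> inv\<^bsub>counterexample TYPE('a)\<^esub> kr x"
      unfolding divide_cfield_def kr_ops[OF CE] kr_inverse[OF CE False] ..
    then show ?thesis
      using False kr_eq[OF CE, of y 0] kr_eq[OF CE, of x 0] unfolding kr_ops[OF CE] by (auto simp: vdom_def vle_def)
  qed
  then show ?case by (simp only: holds.simps kholds.simps kr_ev)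
next
  case (FEx n f)
  have upd: "kr \<circ> e(n := x) = (kr \<circ> e)(n := kr x)" for x by auto
  show ?case unfolding holds.simps kholds.simps FEx.IH upd by (rule ex_kr)
qed auto

lemma counterexample_admits_qe: "admits_qe TYPE('a) (counterexample TYPE('a) :: 'u ovring)"
  unfolding admits_qe_def
proof (intro allI impI)
  let ?K = "counterexample TYPE('a) :: 'u ovring"
  let ?V = "{x :: ('a, 'u) cfield. kr x \<in> vring ?K}"
  fix f :: "'a fm" and \<pi> :: "'a \<Rightarrow> 'u" and e :: "nat \<Rightarrow> 'u"
  assume r: "range \<pi> \<subseteq> carrier ?K" "range e \<subseteq> carrier ?K"
  define \<pi>' :: "'a \<Rightarrow> ('a, 'u) cfield" where "\<pi>' = (\<lambda>a. mk (\<pi> a) 0)"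
  define e' :: "nat \<Rightarrow> ('a, 'u) cfield" where "e' = (\<lambda>n. mk (e n) 0)"
  have \<pi>': "kr \<circ> \<pi>' = \<pi>" and e': "kr \<circ> e' = e"
    using r by (auto simp: \<pi>'_def e'_def kr_mk[OF CE] image_subset_iff)
  show "(vfree f \<longrightarrow> (kholds ?K \<pi> e (rqe f) \<longleftrightarrow> kholds ?K \<pi> e f)) \<and>
     (real_closed_valued_field ?K \<and> qf f \<longrightarrow> (kholds ?K \<pi> (\<lambda>_. \<zero>\<^bsub>?K\<^esub>) (vqe f) \<longleftrightarrow>
       (\<exists>x\<in>carrier ?K. kholds ?K \<pi> ((\<lambda>_. \<zero>\<^bsub>?K\<^esub>)(0 := x)) f)))"
  proof (intro conjI impI)
    assume "vfree f"
    then have "holds ?V \<pi>' e' (rqe f) \<longleftrightarrow> holds ?V \<pi>' e' f" by (rule holds_rqe)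
    then show "kholds ?K \<pi> e (rqe f) \<longleftrightarrow> kholds ?K \<pi> e f" by (simp only: kr_holds \<pi>' e')
  next
    assume a: "real_closed_valued_field ?K \<and> qf f"
    then interpret rcvf: real_closed_valued_field ?K by blast
    note sub = subringE[OF rcvf.subring_axioms]
    have neg: "- x \<in> ?V" if "x \<in> ?V" for x using that sub(5) by (simp add: kr_ops[OF CE])
    have conv: "convex_ring ?V"
      unfolding convex_ring_def
    proof (intro conjI ballI allI impI)
      show "1 \<in> ?V" using sub(3) by (simp add: kr_ops[OF CE])
      show "x + y \<in> ?V" "x * y \<in> ?V" if "x \<in> ?V" "y \<in> ?V" for x y
        using that sub(6,7) by (simp_all add: kr_ops[OF CE])
      fix x y :: "('a, 'u) cfield" assume xy: "y \<in> ?V \<and> \<bar>x\<bar> \<le> \<bar>y\<bar>"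
      then have y: "\<bar>y\<bar> \<in> ?V" "- \<bar>y\<bar> \<in> ?V" using neg[of y] neg[of "- y"] by (auto simp: abs_cfield_def)
      have "- \<bar>y\<bar> \<le> x" "x \<le> \<bar>y\<bar>" using xy by (auto simp: abs_le_iff)
      then show "x \<in> ?V"
        using y rcvf.vring_convex[of "kr (- \<bar>y\<bar>)" "kr \<bar>y\<bar>" "kr x"] kr_closed[OF CE] by (simp add: kr_le[OF CE])
    qed
    have proper: "?V \<noteq> UNIV"
    proof
      assume V: "?V = UNIV"
      have "x \<in> vring ?K" if "x \<in> carrier ?K" for x
      proof -
        have "(mk x 0 :: ('a, 'u) cfield) \<in> ?V" using V by blast
        then show ?thesis using that by (simp add: kr_mk[OF CE])
      qed
      then have "vring ?K = carrier ?K" using sub(1) by blast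
      then show False using rcvf.vring_proper by contradiction
    qed
    have z: "kr \<circ> (\<lambda>_. 0 :: ('a, 'u) cfield) = (\<lambda>_. \<zero>\<^bsub>?K\<^esub>)" by (auto simp: kr_ops[OF CE])
    have upd: "kr \<circ> ((\<lambda>_. 0)(0 := x)) = (\<lambda>_. \<zero>\<^bsub>?K\<^esub>)(0 := kr x)" for x :: "('a, 'u) cfield"
      by (auto simp: kr_ops[OF CE])
    have "holds ?V \<pi>' (\<lambda>_. 0) (vqe f) \<longleftrightarrow> (\<exists>x. holds ?V \<pi>' ((\<lambda>_. 0)(0 := x)) f)"
      using a by (intro holds_vqe conv proper) blast
    then have "kholds ?K \<pi> (\<lambda>_. \<zero>\<^bsub>?K\<^esub>) (vqe f) \<longleftrightarrow> (\<exists>x :: ('a, 'u) cfield. kholds ?K \<pi> ((\<lambda>_. \<zero>\<^bsub>?K\<^esub>)(0 := kr x)) f)"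
      by (simp only: kr_holds \<pi>' z upd)
    also have "\<dots> \<longleftrightarrow> (\<exists>x\<in>carrier ?K. kholds ?K \<pi> ((\<lambda>_. \<zero>\<^bsub>?K\<^esub>)(0 := x)) f)"
      by (rule ex_kr)
    finally show "kholds ?K \<pi> (\<lambda>_. \<zero>\<^bsub>?K\<^esub>) (vqe f) \<longleftrightarrow> (\<exists>x\<in>carrier ?K. kholds ?K \<pi> ((\<lambda>_. \<zero>\<^bsub>?K\<^esub>)(0 := x)) f)" .
  qed
qed

end

theorem real_closed_field_admits_qe:
  fixes K :: "'u ovring"
  assumes "real_closed_field K"
  shows "admits_qe TYPE('a) K"
proof (rule ccontr)
  assume "\<not> ?thesis"
  then have CE: "counterexample_exists TYPE('a) TYPE('u)"
    using assms by (auto simp: counterexample_exists_def)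
  from counterexample(2)[OF CE] counterexample_admits_qe[OF CE] show False by blast
qed

subsection \<open>Real closed subfields\<close>

abbreviation subst_carrier :: "'u ovring \<Rightarrow> 'u set \<Rightarrow> 'u ovring" (infixl \<open>\<restriction>\<^sub>c\<close> 100) where
  "K \<restriction>\<^sub>c L \<equiv> K\<lparr>carrier := L\<rparr>"

lemma kev_closed:
  assumes "ring K" "range \<pi> \<subseteq> carrier K" "range e \<subseteq> carrier K"
  shows "kev K \<pi> e t \<in> carrier K"
proof -
  interpret ring K by (rule assms(1))
  show ?thesis using assms(2,3) by (induction t) auto
qed

lemma kev_hom:
  assumes "ring R" "ring S" "h \<in> ring_hom R S" "range \<pi> \<subseteq> carrier R" "range e \<subseteq> carrier R"
  shows "h (kev R \<pi> e t) = kev S (h \<circ> \<pi>) (h \<circ> e) t"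
proof -
  interpret ring_hom_ring R S h
    using assms by (intro ring_hom_ringI2)
  show ?thesis
    by (induction t) (use kev_closed[OF assms(1,4,5)] in simp_all)
qed

lemma id_subring_hom: "L \<subseteq> carrier K \<Longrightarrow> id \<in> ring_hom (K \<restriction>\<^sub>c L) K"
  by (auto intro!: ring_hom_memI)

lemma kev_subring:
  assumes "ring K" "subring L K" "range \<pi> \<subseteq> L" "range e \<subseteq> L"
  shows "kev (K \<restriction>\<^sub>c L) \<pi> e t = kev K \<pi> e t" "kev K \<pi> e t \<in> L"
proof -
  have r: "ring (K \<restriction>\<^sub>c L)" by (rule ring.subring_is_ring[OF assms(1,2)])
  show "kev (K \<restriction>\<^sub>c L) \<pi> e t = kev K \<pi> e t"
    using kev_hom[OF r assms(1) id_subring_hom[OF subringE(1)[OF assms(2)]], of \<pi> e t] assms(3,4) by simp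
  then show "kev K \<pi> e t \<in> L" using kev_closed[OF r, of \<pi> e t] assms(3,4) by simp
qed

lemma kholds_subring:
  assumes "ring K" "subring L K" "qf f" "vfree f" "range \<pi> \<subseteq> L" "range e \<subseteq> L"
  shows "kholds (K \<restriction>\<^sub>c L) \<pi> e f \<longleftrightarrow> kholds K \<pi> e f"
  using assms(3,4) by (induction f) (auto simp: kev_subring[OF assms(1,2,5,6)])

text \<open>Model completeness: in both fields the formula is equivalent to the same quantifier-free
  one, which has the same truth value in a subring.\<close>

lemma kholds_real_closed_subfield:
  fixes f :: "'a fm"
  assumes K: "real_closed_field K" and L: "subfield L K" "real_closed_field (K \<restriction>\<^sub>c L)" and f: "vfree f"
    and r: "range \<pi> \<subseteq> L" "range e \<subseteq> L"
  shows "kholds (K \<restriction>\<^sub>c L) \<pi> e f \<longleftrightarrow> kholds K \<pi> e f"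
proof -
  interpret real_closed_field K by (rule K)
  have sub: "subring L K" by (rule subfieldE(1)[OF L(1)])
  have r': "range \<pi> \<subseteq> carrier K" "range e \<subseteq> carrier K" using r subringE(1)[OF sub] by auto
  have "kholds (K \<restriction>\<^sub>c L) \<pi> e f \<longleftrightarrow> kholds (K \<restriction>\<^sub>c L) \<pi> e (rqe f)"
    using real_closed_field_admits_qe[OF L(2), where 'a = 'a] r f unfolding admits_qe_def by simp
  also have "\<dots> \<longleftrightarrow> kholds K \<pi> e (rqe f)"
    using rqe_simple[OF f] by (intro kholds_subring[OF ring_axioms sub _ _ r]) auto
  also have "\<dots> \<longleftrightarrow> kholds K \<pi> e f"
    using real_closed_field_admits_qe[OF K, where 'a = 'a] r' f unfolding admits_qe_def by blast
  finally show ?thesis .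
qed

section \<open>Roots in real closed subfields\<close>

text \<open>The generic polynomial of formal degree n: the parameters are indexed by natural
  numbers, so a parameter assignment is a coefficient sequence.\<close>

primrec par_poly :: "nat \<Rightarrow> nat tm \<Rightarrow> nat tm" where
  "par_poly 0 u = TPar 0"
| "par_poly (Suc n) u = TAdd (TMul (TPar (Suc n)) (tpow u (Suc n))) (par_poly n u)"

lemma kev_tpow:
  assumes "ring K" "kev K \<pi> e u = x" "x \<in> carrier K"
  shows "kev K \<pi> e (tpow u n) = x [^]\<^bsub>K\<^esub> n"
proof -
  interpret ring K by (rule assms(1))
  show ?thesis by (induction n) (use assms(2) nat_pow_Suc2[OF assms(3)] in \<open>simp_all del: nat_pow_Suc add: nat_pow_0\<close>)
qed

lemma kev_par_poly:
  assumes "cring K" "range p \<subseteq> carrier K" "kev K p e u = x" "x \<in> carrier K"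
  shows "kev K p e (par_poly n u) = (\<Oplus>\<^bsub>K\<^esub>i\<in>{..n}. p i \<otimes>\<^bsub>K\<^esub> x [^]\<^bsub>K\<^esub> i)"
    and "kev K p e (par_poly n u) \<in> carrier K"
proof -
  interpret cring K by (rule assms(1))
  have p: "p i \<in> carrier K" for i using assms(2) by auto
  note tp = kev_tpow[OF ring_axioms assms(3,4)]
  show *: "kev K p e (par_poly n u) = (\<Oplus>\<^bsub>K\<^esub>i\<in>{..n}. p i \<otimes>\<^bsub>K\<^esub> x [^]\<^bsub>K\<^esub> i)"
  proof (induction n)
    case 0
    then show ?case using p assms(4) by simp
  next
    case (Suc n)
    have "kev K p e (par_poly (Suc n) u) = p (Suc n) \<otimes>\<^bsub>K\<^esub> kev K p e (tpow u (Suc n)) \<oplus>\<^bsub>K\<^esub> kev K p e (par_poly n u)"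
      by simp
    then show ?case unfolding tp Suc.IH using p assms(4) by (simp add: Pi_def)
  qed
  show "kev K p e (par_poly n u) \<in> carrier K"
    unfolding * using p assms(4) by simp
qed

text \<open>Links the term with coefficient lists, highest coefficient first, whose multiset of
  roots is known to be finite.\<close>

lemma par_poly_list_eval:
  assumes "cring K" "range p \<subseteq> carrier K" "kev K p e u = x" "x \<in> carrier K"
  shows "kev K p e (par_poly n u) = ring.eval K (map p (rev [0..<Suc n])) x"
proof -
  interpret cring K by (rule assms(1))
  have p: "p i \<in> carrier K" for i using assms(2) by auto
  note tp = kev_tpow[OF ring_axioms assms(3,4)]
  show ?thesis
  proof (induction n)
    case 0
    then show ?case using p assms(4) by simp
  next
    case (Suc n)
    have "kev K p e (par_poly (Suc n) u) = p (Suc n) \<otimes>\<^bsub>K\<^esub> kev K p e (tpow u (Suc n)) \<oplus>\<^bsub>K\<^esub> kev K p e (par_poly n u)"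
      by simp
    also have "\<dots> = eval (p (Suc n) # map p (rev [0..<Suc n])) x"
      unfolding tp Suc.IH by simp
    also have "p (Suc n) # map p (rev [0..<Suc n]) = map p (rev [0..<Suc (Suc n)])" by simp
    finally show ?case .
  qed
qed

lemma finite_par_poly_roots:
  assumes "field K" "range p \<subseteq> carrier K" "p n \<noteq> \<zero>\<^bsub>K\<^esub>"
  shows "finite {x \<in> carrier K. kev K p (\<lambda>_. x) (par_poly n (TVar 0)) = \<zero>\<^bsub>K\<^esub>}"
proof -
  interpret field K by (rule assms(1))
  let ?l = "map p (rev [0..<Suc n])"
  have l: "?l = p n # map p (rev [0..<n])" by simp
  have "polynomial\<^bsub>K\<^esub> (carrier K) ?l"
    unfolding polynomial_def l using assms(2,3) by auto
  then have c: "?l \<in> carrier (poly_ring K)" by (simp add: univ_poly_carrier)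
  have "{x \<in> carrier K. kev K p (\<lambda>_. x) (par_poly n (TVar 0)) = \<zero>\<^bsub>K\<^esub>} \<subseteq> {x. is_root ?l x}"
  proof
    fix x assume x: "x \<in> {x \<in> carrier K. kev K p (\<lambda>_. x) (par_poly n (TVar 0)) = \<zero>\<^bsub>K\<^esub>}"
    then have "eval ?l x = \<zero>\<^bsub>K\<^esub>"
      using par_poly_list_eval[OF is_cring assms(2), of "\<lambda>_. x" "TVar 0" x n] by simp
    then show "x \<in> {x. is_root ?l x}" using x unfolding is_root_def l by simp
  qed
  also have "{x. is_root ?l x} = set_mset (roots ?l)"
    using roots_mem_iff_is_root[OF c] by auto
  finally show ?thesis using finite_set_mset finite_subset by blast
qed

text \<open>\<open>f_count n j k\<close> expresses that there are \<open>j\<close> distinct roots besides \<open>TVar 0, \<dots>, TVar (k - 1)\<close>.\<close>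
primrec f_count :: "nat \<Rightarrow> nat \<Rightarrow> nat \<Rightarrow> nat fm" where
  "f_count n 0 k = FTrue"
| "f_count n (Suc j) k = FEx k (FAnd (FEq (par_poly n (TVar k)) TZero)
     (FAnd (FNot (FDisj (map (\<lambda>i. FEq (TVar k) (TVar i)) [0..<k]))) (f_count n j (Suc k))))"

lemma vfree_f_count: "vfree (f_count n j k)"
  by (induction j arbitrary: k) auto

lemma kholds_FOr: "kholds K \<pi> e (FOr f g) \<longleftrightarrow> kholds K \<pi> e f \<or> kholds K \<pi> e g"
  by (simp add: FOr_def)

lemma kholds_FDisj: "kholds K \<pi> e (FDisj fs) \<longleftrightarrow> (\<exists>f\<in>set fs. kholds K \<pi> e f)"
  by (induction fs) (auto simp: FDisj_def FFalse_def kholds_FOr)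

lemma kholds_FEq:
  assumes "real_closed_field K" "kev K \<pi> e s \<in> carrier K" "kev K \<pi> e t \<in> carrier K"
  shows "kholds K \<pi> e (FEq s t) \<longleftrightarrow> kev K \<pi> e s = kev K \<pi> e t"
proof -
  interpret real_closed_field K by (rule assms(1))
  let ?a = "kev K \<pi> e s" and ?b = "kev K \<pi> e t"
  let ?x = "?a \<oplus>\<^bsub>K\<^esub> \<ominus>\<^bsub>K\<^esub> ?b" and ?y = "?b \<oplus>\<^bsub>K\<^esub> \<ominus>\<^bsub>K\<^esub> ?a"
  have eq: "kholds K \<pi> e (FEq s t) \<longleftrightarrow> \<not> (ole K \<zero>\<^bsub>K\<^esub> ?x \<and> ?x \<noteq> \<zero>\<^bsub>K\<^esub>) \<and> \<not> (ole K \<zero>\<^bsub>K\<^esub> ?y \<and> ?y \<noteq> \<zero>\<^bsub>K\<^esub>)"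
    by (simp add: FEq_def tsub_def)
  have z: "?x = \<zero>\<^bsub>K\<^esub> \<longleftrightarrow> ?a = ?b" "?y = \<zero>\<^bsub>K\<^esub> \<longleftrightarrow> ?a = ?b"
    using assms(2,3) by (metis minus_equality minus_minus r_neg a_inv_closed)+
  have "ole K \<zero>\<^bsub>K\<^esub> ?x \<or> ole K \<zero>\<^bsub>K\<^esub> ?y"
  proof (cases "ole K \<zero>\<^bsub>K\<^esub> ?x")
    case False
    then have "ole K ?x \<zero>\<^bsub>K\<^esub>" using ole_total assms(2,3) by (meson a_closed a_inv_closed zero_closed)
    then have "ole K (?x \<oplus>\<^bsub>K\<^esub> ?y) (\<zero>\<^bsub>K\<^esub> \<oplus>\<^bsub>K\<^esub> ?y)" using assms(2,3) by (intro ole_add) auto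
    moreover have "?x \<oplus>\<^bsub>K\<^esub> ?y = \<zero>\<^bsub>K\<^esub>"
    proof -
      have "\<ominus>\<^bsub>K\<^esub> ?x = ?y" using assms(2,3) by (simp add: minus_add a_comm)
      then show ?thesis using assms(2,3) r_neg[of ?x] by simp
    qed
    ultimately show ?thesis using assms(2,3) by simp
  qed simp
  then show ?thesis unfolding eq z by auto
qed

lemma kholds_f_count:
  assumes K: "real_closed_field K" and p: "range p \<subseteq> carrier K" and e: "range e \<subseteq> carrier K"
  shows "kholds K p e (f_count n j k) \<longleftrightarrow> (\<exists>T. finite T \<and> card T = j \<and>
    T \<subseteq> {x \<in> carrier K. kev K p (\<lambda>_. x) (par_poly n (TVar 0)) = \<zero>\<^bsub>K\<^esub>} - e ` {..<k})"
  using e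
proof (induction j arbitrary: k e)
  case 0
  then show ?case by auto
next
  case (Suc j)
  interpret real_closed_field K by (rule K)
  let ?R = "{x \<in> carrier K. kev K p (\<lambda>_. x) (par_poly n (TVar 0)) = \<zero>\<^bsub>K\<^esub>}"
  have step: "kholds K p (e(k := x)) (FEq (par_poly n (TVar k)) TZero) \<longleftrightarrow> x \<in> ?R"
    "kholds K p (e(k := x)) (FDisj (map (\<lambda>i. FEq (TVar k) (TVar i)) [0..<k])) \<longleftrightarrow> x \<in> e ` {..<k}"
    "kholds K p (e(k := x)) (f_count n j (Suc k)) \<longleftrightarrow> (\<exists>T. finite T \<and> card T = j \<and> T \<subseteq> ?R - insert x (e ` {..<k}))"
    if x: "x \<in> carrier K" for x
  proof -
    have r: "range (e(k := x)) \<subseteq> carrier K" using Suc.prems x by auto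
    have "kev K p (e(k := x)) (par_poly n (TVar k)) = kev K p (\<lambda>_. x) (par_poly n (TVar 0))"
      using kev_par_poly(1)[OF is_cring p, of "e(k := x)" "TVar k" x n] kev_par_poly(1)[OF is_cring p, of "\<lambda>_. x" "TVar 0" x n] x by simp
    moreover have "kev K p (e(k := x)) (par_poly n (TVar k)) \<in> carrier K"
      using kev_par_poly(2)[OF is_cring p, of "e(k := x)" "TVar k" x n] x by simp
    ultimately show "kholds K p (e(k := x)) (FEq (par_poly n (TVar k)) TZero) \<longleftrightarrow> x \<in> ?R"
      using x by (subst kholds_FEq[OF K]) auto
    have "kholds K p (e(k := x)) (FEq (TVar k) (TVar i)) \<longleftrightarrow> x = e i" if "i < k" for i
      using that x Suc.prems by (subst kholds_FEq[OF K]) auto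
    then show "kholds K p (e(k := x)) (FDisj (map (\<lambda>i. FEq (TVar k) (TVar i)) [0..<k])) \<longleftrightarrow> x \<in> e ` {..<k}"
      by (auto simp: kholds_FDisj)
    have "e(k := x) ` {..<Suc k} = insert x (e ` {..<k})" by (auto simp: lessThan_Suc)
    then show "kholds K p (e(k := x)) (f_count n j (Suc k)) \<longleftrightarrow> (\<exists>T. finite T \<and> card T = j \<and> T \<subseteq> ?R - insert x (e ` {..<k}))"
      unfolding Suc.IH[OF r, of "Suc k"] by (simp only:)
  qed
  have "kholds K p e (f_count n (Suc j) k) \<longleftrightarrow> (\<exists>x\<in>carrier K. x \<in> ?R \<and> x \<notin> e ` {..<k} \<and>
      (\<exists>T. finite T \<and> card T = j \<and> T \<subseteq> ?R - insert x (e ` {..<k})))"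
    unfolding f_count.simps kholds.simps by (intro bex_cong refl) (simp only: step)
  also have "\<dots> \<longleftrightarrow> (\<exists>T. finite T \<and> card T = Suc j \<and> T \<subseteq> ?R - e ` {..<k})"
  proof
    assume "\<exists>x\<in>carrier K. x \<in> ?R \<and> x \<notin> e ` {..<k} \<and> (\<exists>T. finite T \<and> card T = j \<and> T \<subseteq> ?R - insert x (e ` {..<k}))"
    then obtain x T where "x \<in> ?R" "x \<notin> e ` {..<k}" "finite T" "card T = j" "T \<subseteq> ?R - insert x (e ` {..<k})" by blast
    then show "\<exists>T. finite T \<and> card T = Suc j \<and> T \<subseteq> ?R - e ` {..<k}"
      by (intro exI[of _ "insert x T"]) (auto simp: card_insert_if)
  next
    assume "\<exists>T. finite T \<and> card T = Suc j \<and> T \<subseteq> ?R - e ` {..<k}"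
    then obtain T where T: "finite T" "card T = Suc j" "T \<subseteq> ?R - e ` {..<k}" by blast
    then obtain x where x: "x \<in> T" by (metis card_eq_0_iff ex_in_conv nat.distinct(1))
    have "finite (T - {x})" "card (T - {x}) = j" "T - {x} \<subseteq> ?R - insert x (e ` {..<k})"
      using T x by auto
    moreover have "x \<in> ?R" "x \<notin> e ` {..<k}" using T(3) x by blast+
    moreover from this have "x \<in> carrier K" by blast
    ultimately show "\<exists>x\<in>carrier K. x \<in> ?R \<and> x \<notin> e ` {..<k} \<and> (\<exists>T. finite T \<and> card T = j \<and> T \<subseteq> ?R - insert x (e ` {..<k}))"
      by blast
  qed
  finally show ?case .
qed

text \<open>The number of roots is expressed by formulas, whose truth by elimination is the same in a real closed
  subfield.\<close>
lemma roots_in_real_closed_subfield: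
  assumes K: "real_closed_field K" and L: "subfield L K" "real_closed_field (K \<restriction>\<^sub>c L)"
    and p: "range p \<subseteq> L" "p n \<noteq> \<zero>\<^bsub>K\<^esub>" and x: "x \<in> carrier K" "kev K p (\<lambda>_. x) (par_poly n (TVar 0)) = \<zero>\<^bsub>K\<^esub>"
  shows "x \<in> L"
proof -
  interpret real_closed_field K by (rule K)
  have sub: "subring L K" by (rule subfieldE(1)[OF L(1)])
  note LK = subringE[OF sub]
  have pK: "range p \<subseteq> carrier K" using p(1) LK(1) by blast
  let ?R = "{x \<in> carrier K. kev K p (\<lambda>_. x) (par_poly n (TVar 0)) = \<zero>\<^bsub>K\<^esub>}"
  let ?RL = "{x \<in> carrier (K \<restriction>\<^sub>c L). kev (K \<restriction>\<^sub>c L) p (\<lambda>_. x) (par_poly n (TVar 0)) = \<zero>\<^bsub>K \<restriction>\<^sub>c L\<^esub>}"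
  let ?e = "\<lambda>_. \<zero>\<^bsub>K\<^esub> :: 'a"
  have fin: "finite ?R" by (rule finite_par_poly_roots[OF field_axioms pK p(2)])
  have "kholds K p ?e (f_count n (card ?R) 0)"
    using kholds_f_count[OF K pK, of ?e n "card ?R" 0] fin by auto
  then have "kholds (K \<restriction>\<^sub>c L) p ?e (f_count n (card ?R) 0)"
    using kholds_real_closed_subfield[OF K L vfree_f_count p(1), of ?e] LK(2) by auto
  then obtain T where T: "finite T" "card T = card ?R" "T \<subseteq> ?RL"
    using kholds_f_count[OF L(2), of p ?e n "card ?R" 0] p(1) LK(2) by auto
  have "?RL \<subseteq> ?R"
  proof
    fix y assume y: "y \<in> ?RL"
    then have "kev (K \<restriction>\<^sub>c L) p (\<lambda>_. y) (par_poly n (TVar 0)) = kev K p (\<lambda>_. y) (par_poly n (TVar 0))"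
      by (intro kev_subring(1)[OF ring_axioms sub p(1)]) auto
    then show "y \<in> ?R" using y LK(1) by auto
  qed
  \<comment> \<open>The subfield has as many roots as K, and they are roots in K, so none are
    missing.\<close>
  then have "T = ?R" using T fin by (intro card_subset_eq) auto
  then have "x \<in> ?RL" using T(3) x by blast
  then show ?thesis by simp
qed

lemma up_carrier: "carrier (UP R) = up R"
  by (simp add: UP_def)

lemma up_coeff: "p \<in> up R \<Longrightarrow> UnivPoly.coeff (UP R) p = p"
  by (simp add: UP_def)

lemma up_eval:
  assumes "cring K" "p \<in> carrier (UP K)" "x \<in> carrier K"
  shows "UnivPoly.eval K K id x p = kev K p (\<lambda>_. x) (par_poly (deg K p) (TVar 0))"
proof -
  have r: "range p \<subseteq> carrier K" using assms(2) by (auto simp: up_carrier up_def)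
  have pu: "p \<in> up K" using assms(2) by (simp add: up_carrier)
  show ?thesis
    using kev_par_poly(1)[OF assms(1) r, of "\<lambda>_. x" "TVar 0" x "deg K p"] assms(2,3)
    by (simp add: UnivPoly.eval_def up_coeff[OF pu])
qed

lemma up_deg_nonzero:
  assumes "cring K" "p \<in> carrier (UP K)" "deg K p \<noteq> 0"
  shows "p (deg K p) \<noteq> \<zero>\<^bsub>K\<^esub>"
proof -
  interpret UP_cring K "UP K" using assms(1) by (simp add: UP_cring_def)
  show ?thesis
    using lcoeff_nonzero_deg[OF assms(3,2)] up_coeff[of p K] assms(2) by (simp add: up_carrier)
qed

lemma up_subring:
  assumes "subring L K" "p \<in> carrier (UP (K \<restriction>\<^sub>c L))"
  shows "p \<in> carrier (UP K)" "deg (K \<restriction>\<^sub>c L) p = deg K p" "range p \<subseteq> L"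
proof -
  have pL: "p \<in> up (K \<restriction>\<^sub>c L)" using assms(2) by (simp add: up_carrier)
  then show "range p \<subseteq> L" by (auto simp: up_def)
  have pK: "p \<in> up K" using pL subringE(1)[OF assms(1)] by (auto simp: up_def)
  then show "p \<in> carrier (UP K)" by (simp add: up_carrier)
  show "deg (K \<restriction>\<^sub>c L) p = deg K p"
    unfolding deg_def up_coeff[OF pL] up_coeff[OF pK] by simp
qed

lemma real_closed_field_subfieldI:
  assumes K: "real_closed_field K" and L: "subfield L K"
    and sq: "\<And>x. x \<in> L \<Longrightarrow> ole K \<zero>\<^bsub>K\<^esub> x \<Longrightarrow> \<exists>y\<in>L. y \<otimes>\<^bsub>K\<^esub> y = x"
    and odd: "\<And>p n. range p \<subseteq> L \<Longrightarrow> odd n \<Longrightarrow> p n \<noteq> \<zero>\<^bsub>K\<^esub> \<Longrightarrow>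
      \<exists>x\<in>L. kev K p (\<lambda>_. x) (par_poly n (TVar 0)) = \<zero>\<^bsub>K\<^esub>"
  shows "real_closed_field (K \<restriction>\<^sub>c L)"
proof -
  interpret real_closed_field K by (rule K)
  have sub: "subring L K" by (rule subfieldE(1)[OF L])
  note LK = subringE[OF sub]
  interpret L: field "K \<restriction>\<^sub>c L" by (rule subfield_iff(2)[OF L])
  show ?thesis
  proof unfold_locales
    fix x y z assume "x \<in> carrier (K \<restriction>\<^sub>c L)" "y \<in> carrier (K \<restriction>\<^sub>c L)" "z \<in> carrier (K \<restriction>\<^sub>c L)"
    then have c: "x \<in> carrier K" "y \<in> carrier K" "z \<in> carrier K" using LK(1) by auto
    show "ole (K \<restriction>\<^sub>c L) x y \<Longrightarrow> ole (K \<restriction>\<^sub>c L) y z \<Longrightarrow> ole (K \<restriction>\<^sub>c L) x z"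
      using ole_trans[OF c] by simp
    show "ole (K \<restriction>\<^sub>c L) x y \<Longrightarrow> ole (K \<restriction>\<^sub>c L) (x \<oplus>\<^bsub>K \<restriction>\<^sub>c L\<^esub> z) (y \<oplus>\<^bsub>K \<restriction>\<^sub>c L\<^esub> z)"
      using ole_add[OF c] by simp
  next
    fix x y assume "x \<in> carrier (K \<restriction>\<^sub>c L)" "y \<in> carrier (K \<restriction>\<^sub>c L)"
    then have c: "x \<in> carrier K" "y \<in> carrier K" using LK(1) by auto
    show "ole (K \<restriction>\<^sub>c L) x y \<Longrightarrow> ole (K \<restriction>\<^sub>c L) y x \<Longrightarrow> x = y" using ole_antisym[OF c] by simp
    show "ole (K \<restriction>\<^sub>c L) x y \<or> ole (K \<restriction>\<^sub>c L) y x" using ole_total[OF c] by simp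
    show "ole (K \<restriction>\<^sub>c L) \<zero>\<^bsub>K \<restriction>\<^sub>c L\<^esub> x \<Longrightarrow> ole (K \<restriction>\<^sub>c L) \<zero>\<^bsub>K \<restriction>\<^sub>c L\<^esub> y \<Longrightarrow> ole (K \<restriction>\<^sub>c L) \<zero>\<^bsub>K \<restriction>\<^sub>c L\<^esub> (x \<otimes>\<^bsub>K \<restriction>\<^sub>c L\<^esub> y)"
      using ole_mult[OF c] by simp
  next
    fix x assume x: "x \<in> carrier (K \<restriction>\<^sub>c L)"
    then show "ole (K \<restriction>\<^sub>c L) x x" using LK(1) ole_refl by auto
    show "ole (K \<restriction>\<^sub>c L) \<zero>\<^bsub>K \<restriction>\<^sub>c L\<^esub> x \<Longrightarrow> \<exists>y\<in>carrier (K \<restriction>\<^sub>c L). y \<otimes>\<^bsub>K \<restriction>\<^sub>c L\<^esub> y = x"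
      using sq x by simp
  next
    fix p assume p: "p \<in> carrier (UP (K \<restriction>\<^sub>c L))" "odd (deg (K \<restriction>\<^sub>c L) p)"
    note up = up_subring[OF sub p(1)]
    let ?n = "deg (K \<restriction>\<^sub>c L) p"
    have "?n \<noteq> 0" using p(2) by (intro notI) simp
    from up_deg_nonzero[OF L.is_cring p(1) this] have "p ?n \<noteq> \<zero>\<^bsub>K\<^esub>" by simp
    from odd[OF up(3) p(2) this] obtain x where x: "x \<in> L" "kev K p (\<lambda>_. x) (par_poly ?n (TVar 0)) = \<zero>\<^bsub>K\<^esub>" by blast
    have "UnivPoly.eval (K \<restriction>\<^sub>c L) (K \<restriction>\<^sub>c L) id x p = kev (K \<restriction>\<^sub>c L) p (\<lambda>_. x) (par_poly ?n (TVar 0))"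
      using x(1) by (intro up_eval[OF L.is_cring p(1)]) simp
    also have "\<dots> = kev K p (\<lambda>_. x) (par_poly ?n (TVar 0))"
      using x(1) by (intro kev_subring(1)[OF ring_axioms sub up(3)]) auto
    finally show "\<exists>x\<in>carrier (K \<restriction>\<^sub>c L). UnivPoly.eval (K \<restriction>\<^sub>c L) (K \<restriction>\<^sub>c L) id x p = \<zero>\<^bsub>K \<restriction>\<^sub>c L\<^esub>"
      using x by auto
  qed
qed

lemma real_closed_field_odd_root:
  assumes K: "real_closed_field K" and p: "range p \<subseteq> carrier K" "odd n" "p n \<noteq> \<zero>\<^bsub>K\<^esub>"
  shows "\<exists>x\<in>carrier K. kev K p (\<lambda>_. x) (par_poly n (TVar 0)) = \<zero>\<^bsub>K\<^esub>"
proof -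
  interpret real_closed_field K by (rule K)
  have cr: "cring K" ..
  \<comment> \<open>Cutting the sequence off at n makes it an element of \<open>up K\<close>; the
    term for degree n sees only the entries up to n.\<close>
  define q where "q = (\<lambda>i. if i \<le> n then p i else \<zero>\<^bsub>K\<^esub>)"
  have pc: "p i \<in> carrier K" for i using p(1) by auto
  then have qc: "q i \<in> carrier K" for i by (simp add: q_def)
  have "bound \<zero>\<^bsub>K\<^esub> n q" by (rule bound.intro) (simp add: q_def)
  then have qu: "q \<in> up K" using mem_upI[of q K] qc by blast
  then have q: "q \<in> carrier (UP K)" by (simp add: up_carrier)
  interpret UP_cring K "UP K" using cr by (simp add: UP_cring_def)
  have "deg K q = n"
  proof (intro antisym deg_aboveI deg_belowI)
    show "UnivPoly.coeff (UP K) q m = \<zero>\<^bsub>K\<^esub>" if "n < m" for m using that unfolding up_coeff[OF qu] by (simp add: q_def)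
    show "UnivPoly.coeff (UP K) q n \<noteq> \<zero>\<^bsub>K\<^esub>" using p(3) unfolding up_coeff[OF qu] by (simp add: q_def)
  qed (use q in auto)
  then obtain x where x: "x \<in> carrier K" "UnivPoly.eval K K id x q = \<zero>\<^bsub>K\<^esub>"
    using odd_degree_root[OF q] p(2) by auto
  have r: "range q \<subseteq> carrier K" using qc by auto
  have "UnivPoly.eval K K id x q = kev K q (\<lambda>_. x) (par_poly n (TVar 0))"
    using up_eval[OF cr q x(1)] \<open>deg K q = n\<close> by simp
  also have "\<dots> = (\<Oplus>\<^bsub>K\<^esub>i\<in>{..n}. q i \<otimes>\<^bsub>K\<^esub> x [^]\<^bsub>K\<^esub> i)"
    using kev_par_poly(1)[OF cr r, of "\<lambda>_. x" "TVar 0" x n] x(1) by simp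
  also have "\<dots> = (\<Oplus>\<^bsub>K\<^esub>i\<in>{..n}. p i \<otimes>\<^bsub>K\<^esub> x [^]\<^bsub>K\<^esub> i)"
    using pc x(1) by (intro abelian_monoid.finsum_cong'[OF abelian_group.axioms(1)[OF ring.is_abelian_group[OF cring.axioms(1)[OF cr]]]]) (auto simp: q_def)
  also have "\<dots> = kev K p (\<lambda>_. x) (par_poly n (TVar 0))"
    using kev_par_poly(1)[OF cr p(1), of "\<lambda>_. x" "TVar 0" x n] x(1) by simp
  finally show ?thesis using x by auto
qed

text \<open>Each member has a root of a given polynomial of odd degree, but a common one is
  required. Any root in K is common, because every member contains all roots in K of polynomials
  over it; a square root in K likewise agrees up to sign with one in each member.\<close>

lemma real_closed_field_Inter:
  assumes K: "real_closed_field K" and ne: "\<L> \<noteq> {}"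
    and L: "\<And>L. L \<in> \<L> \<Longrightarrow> subfield L K \<and> real_closed_field (K \<restriction>\<^sub>c L)"
  shows "subfield (\<Inter>\<L>) K" "real_closed_field (K \<restriction>\<^sub>c \<Inter>\<L>)"
proof -
  interpret real_closed_field K by (rule K)
  show sf: "subfield (\<Inter>\<L>) K"
  proof (rule subfieldI')
    show "subring (\<Inter>\<L>) K" using L subfieldE(1) by (intro subring_Inter ne) blast
    show "inv\<^bsub>K\<^esub> k \<in> \<Inter>\<L>" if "k \<in> \<Inter>\<L> - {\<zero>\<^bsub>K\<^esub>}" for k
      using subfield_m_inv(1) L that by blast
  qed
  have LK: "\<Inter>\<L> \<subseteq> carrier K" by (rule subfieldE(3)[OF sf])
  show "real_closed_field (K \<restriction>\<^sub>c \<Inter>\<L>)"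
  proof (rule real_closed_field_subfieldI[OF K sf])
    fix x assume x: "x \<in> \<Inter>\<L>" "ole K \<zero>\<^bsub>K\<^esub> x"
    then have xc: "x \<in> carrier K" using LK by blast
    obtain y where y: "y \<in> carrier K" "y \<otimes>\<^bsub>K\<^esub> y = x" using nonneg_square[OF xc x(2)] by blast
    have "y \<in> M" if M: "M \<in> \<L>" for M
    proof -
      interpret M: real_closed_field "K \<restriction>\<^sub>c M" using L[OF M] by blast
      have MK: "subring M K" using L[OF M] subfieldE(1) by blast
      have "x \<in> carrier (K \<restriction>\<^sub>c M)" using x(1) M by auto
      from M.nonneg_square[OF this] x(2) obtain z where z: "z \<in> M" "z \<otimes>\<^bsub>K\<^esub> z = x" by auto
      have zc: "z \<in> carrier K" using z(1) subringE(1)[OF MK] by blast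
      have "(y \<ominus>\<^bsub>K\<^esub> z) \<otimes>\<^bsub>K\<^esub> (y \<oplus>\<^bsub>K\<^esub> z) = \<zero>\<^bsub>K\<^esub>"
      proof -
        have "(y \<ominus>\<^bsub>K\<^esub> z) \<otimes>\<^bsub>K\<^esub> (y \<oplus>\<^bsub>K\<^esub> z) = y \<otimes>\<^bsub>K\<^esub> y \<ominus>\<^bsub>K\<^esub> z \<otimes>\<^bsub>K\<^esub> z" using y(1) zc by algebra
        then show ?thesis using y z zc xc by (simp add: a_minus_def r_neg)
      qed
      then have "y \<ominus>\<^bsub>K\<^esub> z = \<zero>\<^bsub>K\<^esub> \<or> y \<oplus>\<^bsub>K\<^esub> z = \<zero>\<^bsub>K\<^esub>" using y(1) zc by (intro integral) auto
      then have "y = z \<or> y = \<ominus>\<^bsub>K\<^esub> z" using y(1) zc r_right_minus_eq sum_zero_eq_neg by blast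
      then show ?thesis using z(1) subringE(5)[OF MK] by auto
    qed
    then show "\<exists>y\<in>\<Inter>\<L>. y \<otimes>\<^bsub>K\<^esub> y = x" using y(2) by blast
  next
    fix p :: "nat \<Rightarrow> _" and n assume p: "range p \<subseteq> \<Inter>\<L>" "odd n" "p n \<noteq> \<zero>\<^bsub>K\<^esub>"
    have "range p \<subseteq> carrier K" using p(1) LK by blast
    from real_closed_field_odd_root[OF K this p(2,3)] obtain x
      where x: "x \<in> carrier K" "kev K p (\<lambda>_. x) (par_poly n (TVar 0)) = \<zero>\<^bsub>K\<^esub>" by blast
    have "x \<in> M" if M: "M \<in> \<L>" for M
    proof (rule roots_in_real_closed_subfield[OF K _ _ _ p(3) x])
      show "subfield M K" "real_closed_field (K \<restriction>\<^sub>c M)" using L[OF M] by auto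
      show "range p \<subseteq> M" using p(1) M by blast
    qed
    then show "\<exists>x\<in>\<Inter>\<L>. kev K p (\<lambda>_. x) (par_poly n (TVar 0)) = \<zero>\<^bsub>K\<^esub>" using x(2) by blast
  qed
qed

subsection \<open>Points of the real-valuative spectrum\<close>

definition rc_closure :: "'u ovring \<Rightarrow> 'u set \<Rightarrow> 'u set" where
  "rc_closure K B = \<Inter>{L. subfield L K \<and> real_closed_field (K \<restriction>\<^sub>c L) \<and> B \<subseteq> L}"

lemma rc_generated_eq: "rc_generated K B = K\<lparr>carrier := rc_closure K B, vring := vring K \<inter> rc_closure K B\<rparr>"
  by (simp add: rc_generated_def rc_closure_def Let_def)

lemma rc_closure:
  assumes "real_closed_field K" "B \<subseteq> carrier K"
  shows "subfield (rc_closure K B) K" "real_closed_field (K \<restriction>\<^sub>c rc_closure K B)" "B \<subseteq> rc_closure K B"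
proof -
  interpret real_closed_field K by (rule assms(1))
  let ?F = "{L. subfield L K \<and> real_closed_field (K \<restriction>\<^sub>c L) \<and> B \<subseteq> L}"
  have "carrier K \<in> ?F" using assms carrier_is_subfield by simp
  then have ne: "?F \<noteq> {}" by blast
  have L: "\<And>L. L \<in> ?F \<Longrightarrow> subfield L K \<and> real_closed_field (K \<restriction>\<^sub>c L)" by blast
  show "subfield (rc_closure K B) K"
    unfolding rc_closure_def by (rule real_closed_field_Inter(1)[OF assms(1) ne L])
  show "real_closed_field (K \<restriction>\<^sub>c rc_closure K B)"
    unfolding rc_closure_def by (rule real_closed_field_Inter(2)[OF assms(1) ne L])
  show "B \<subseteq> rc_closure K B" unfolding rc_closure_def by blast
qed

lemma rc_closure_least:
  "subfield L K \<Longrightarrow> real_closed_field (K \<restriction>\<^sub>c L) \<Longrightarrow> B \<subseteq> L \<Longrightarrow> rc_closure K B \<subseteq> L"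
  unfolding rc_closure_def by blast

lemma rc_closure_subset_carrier: "real_closed_field K \<Longrightarrow> B \<subseteq> carrier K \<Longrightarrow> rc_closure K B \<subseteq> carrier K"
  using rc_closure(1) subfieldE(3) by blast

lemma real_closed_field_image:
  assumes K: "real_closed_field K" and K': "real_closed_field K'" and h: "h \<in> ring_hom K K'"
    and ord: "\<And>x. x \<in> carrier K \<Longrightarrow> ole K' \<zero>\<^bsub>K'\<^esub> (h x) \<Longrightarrow> ole K \<zero>\<^bsub>K\<^esub> x"
  shows "subfield (h ` carrier K) K'" "real_closed_field (K' \<restriction>\<^sub>c (h ` carrier K))"
proof -
  interpret K: real_closed_field K by (rule K)
  interpret K': real_closed_field K' by (rule K')
  interpret h: ring_hom_ring K K' h by (intro ring_hom_ringI2 K.ring_axioms K'.ring_axioms h)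
  show sf: "subfield (h ` carrier K) K'"
    by (rule h.img_is_subfield(2)[OF K.carrier_is_subfield]) simp
  show "real_closed_field (K' \<restriction>\<^sub>c (h ` carrier K))"
  proof (rule real_closed_field_subfieldI[OF K' sf])
    fix x assume "x \<in> h ` carrier K" "ole K' \<zero>\<^bsub>K'\<^esub> x"
    then obtain u where u: "u \<in> carrier K" "x = h u" "ole K \<zero>\<^bsub>K\<^esub> u" using ord by blast
    from K.nonneg_square[OF u(1,3)] obtain v where v: "v \<in> carrier K" "v \<otimes>\<^bsub>K\<^esub> v = u" by blast
    show "\<exists>y\<in>h ` carrier K. y \<otimes>\<^bsub>K'\<^esub> y = x"
      using h.hom_mult[OF v(1,1)] v u(2) by (intro bexI[of _ "h v"]) simp_all
  next
    fix p :: "nat \<Rightarrow> _" and n assume p: "range p \<subseteq> h ` carrier K" "odd n" "p n \<noteq> \<zero>\<^bsub>K'\<^esub>"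
    define q where "q = inv_into (carrier K) h \<circ> p"
    have q: "q i \<in> carrier K" "h (q i) = p i" for i
      using subsetD[OF p(1) rangeI, of i] inv_into_into[of "p i" h "carrier K"] f_inv_into_f[of "p i" h "carrier K"]
      by (simp_all add: q_def)
    have rq: "range q \<subseteq> carrier K" using q(1) by blast
    have "q n \<noteq> \<zero>\<^bsub>K\<^esub>" using p(3) q(2)[of n] by auto
    from real_closed_field_odd_root[OF K rq p(2) this]
    obtain x where x: "x \<in> carrier K" "kev K q (\<lambda>_. x) (par_poly n (TVar 0)) = \<zero>\<^bsub>K\<^esub>" by blast
    have "h (kev K q (\<lambda>_. x) (par_poly n (TVar 0))) = kev K' (h \<circ> q) (h \<circ> (\<lambda>_. x)) (par_poly n (TVar 0))"
      using x(1) by (intro kev_hom[OF K.ring_axioms K'.ring_axioms h rq]) auto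
    moreover have "h \<circ> q = p" "h \<circ> (\<lambda>_. x) = (\<lambda>_::nat. h x)" using q(2) by auto
    ultimately have "kev K' p (\<lambda>_. h x) (par_poly n (TVar 0)) = \<zero>\<^bsub>K'\<^esub>" using x(2) by simp
    then show "\<exists>x\<in>h ` carrier K. kev K' p (\<lambda>_. x) (par_poly n (TVar 0)) = \<zero>\<^bsub>K'\<^esub>" using x(1) by blast
  qed
qed

section \<open>Isomorphisms of generated subfields\<close>

lemma ovfield_iso_refl: "id \<in> ovfield_iso R R"
  by (simp add: ovfield_iso_def ring_iso_set_refl)

lemma ovfield_iso_memE:
  assumes "h \<in> ovfield_iso R S"
  shows "h \<in> ring_iso R S" "x \<in> carrier R \<Longrightarrow> h x \<in> carrier S"
    "x \<in> carrier R \<Longrightarrow> y \<in> carrier R \<Longrightarrow> ole R x y \<longleftrightarrow> ole S (h x) (h y)"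
    "x \<in> carrier R \<Longrightarrow> x \<in> vring R \<longleftrightarrow> h x \<in> vring S"
    "bij_betw h (carrier R) (carrier S)"
  using assms ring_iso_memE[of h R S] by (auto simp: ovfield_iso_def)

lemma ovfield_iso_trans:
  assumes "f \<in> ovfield_iso R S" "g \<in> ovfield_iso S Q"
  shows "g \<circ> f \<in> ovfield_iso R Q"
  using ring_iso_set_trans[OF ovfield_iso_memE(1)[OF assms(1)] ovfield_iso_memE(1)[OF assms(2)]]
    ovfield_iso_memE(2-4)[OF assms(1)] ovfield_iso_memE(3,4)[OF assms(2)]
  unfolding ovfield_iso_def by simp

lemma ovfield_iso_sym:
  assumes "ring R" "f \<in> ovfield_iso R S"
  shows "inv_into (carrier R) f \<in> ovfield_iso S R"
proof -
  let ?g = "inv_into (carrier R) f"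
  have g: "?g x \<in> carrier R" "f (?g x) = x" if "x \<in> carrier S" for x
    using that ovfield_iso_memE(5)[OF assms(2)]
    by (auto simp: bij_betw_def intro: inv_into_into f_inv_into_f)
  show ?thesis
    using ring_iso_set_sym[OF assms(1) ovfield_iso_memE(1)[OF assms(2)]] g
      ovfield_iso_memE(3,4)[OF assms(2)] unfolding ovfield_iso_def by simp
qed

lemma rc_generated_ring_iso_hom:
  assumes "real_closed_field K'" "C' \<subseteq> carrier K'" "h \<in> ovfield_iso (rc_generated K C) (rc_generated K' C')"
    and "G \<subseteq> rc_closure K C"
  shows "h \<in> ring_hom (K \<restriction>\<^sub>c G) K'"
proof -
  note h = ring_iso_memE[OF ovfield_iso_memE(1)[OF assms(3)], unfolded rc_generated_eq, simplified]
  show ?thesis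
    by (rule ring_hom_memI)
      (use h(1-4) subsetD[OF assms(4)] subsetD[OF rc_closure_subset_carrier[OF assms(1,2)]] in simp_all)
qed

lemma ring_rc_generated:
  assumes "real_closed_field K" "B \<subseteq> carrier K"
  shows "ring (rc_generated K B)"
proof -
  interpret real_closed_field K by (rule assms(1))
  have "subring (rc_closure K B) K" by (rule subfieldE(1)[OF rc_closure(1)[OF assms]])
  then interpret R: ring "K \<restriction>\<^sub>c rc_closure K B" by (rule subring_is_ring)
  have "\<exists>y\<in>rc_closure K B. y \<oplus>\<^bsub>K\<^esub> x = \<zero>\<^bsub>K\<^esub>" if "x \<in> rc_closure K B" for x
    using R.a_inv_closed[of x] R.l_neg[of x] that by auto
  then show ?thesis
    unfolding rc_generated_eq
    by (intro ringI abelian_groupI monoidI)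
      (use R.a_assoc R.a_comm R.m_assoc R.l_distr R.r_distr R.a_closed R.m_closed R.zero_closed R.one_closed
        R.l_zero R.l_one R.r_one in auto)
qed

text \<open>The image of a generated subfield is itself a real closed subfield of the target and
  contains the image of the generators.\<close>

lemma rc_closure_image_subset:
  assumes K: "real_closed_field K" "C \<subseteq> carrier K" and K': "real_closed_field K'" "C' \<subseteq> carrier K'"
    and h: "h \<in> ovfield_iso (rc_generated K C) (rc_generated K' C')" and B: "B \<subseteq> rc_closure K C"
  shows "rc_closure K' (h ` B) \<subseteq> h ` rc_closure K B"
proof -
  interpret K: real_closed_field K by (rule K)
  interpret K': real_closed_field K' by (rule K')
  have BK: "B \<subseteq> carrier K" using B rc_closure_subset_carrier[OF K] by blast
  note C = rc_closure[OF K] and Bc = rc_closure[OF K(1) BK]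
  let ?G = "rc_closure K B"
  have G: "?G \<subseteq> rc_closure K C" by (rule rc_closure_least[OF C(1,2) B])
  have hom: "h \<in> ring_hom (K \<restriction>\<^sub>c ?G) K'" by (rule rc_generated_ring_iso_hom[OF K' h G])
  interpret h: ring_hom_ring "K \<restriction>\<^sub>c ?G" K' h
    by (intro ring_hom_ringI2 hom K'.ring_axioms K.subring_is_ring subfieldE(1)[OF Bc(1)])
  have z: "\<zero>\<^bsub>K\<^esub> \<in> ?G" "h \<zero>\<^bsub>K\<^esub> = \<zero>\<^bsub>K'\<^esub>" using h.R.zero_closed h.hom_zero by simp_all
  have ord: "ole (K \<restriction>\<^sub>c ?G) \<zero>\<^bsub>K \<restriction>\<^sub>c ?G\<^esub> x" if "x \<in> carrier (K \<restriction>\<^sub>c ?G)" "ole K' \<zero>\<^bsub>K'\<^esub> (h x)" for x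
    using ovfield_iso_memE(3)[OF h, of "\<zero>\<^bsub>K\<^esub>" x] that z subsetD[OF G] by (simp add: rc_generated_eq)
  note im = real_closed_field_image[OF Bc(2) K'(1) hom ord]
  show ?thesis using im Bc(3) by (intro rc_closure_least) auto
qed

text \<open>Restriction from A[X] to A leaves fewer generators. The inclusion of the preceding
  lemma, applied to the isomorphism and to its inverse, shows that the smaller generated subfields
  correspond to each other.\<close>

lemma ovfield_iso_restrict:
  assumes K: "real_closed_field K" "C \<subseteq> carrier K" and K': "real_closed_field K'" "C' \<subseteq> carrier K'"
    and h: "h \<in> ovfield_iso (rc_generated K C) (rc_generated K' C')" and B: "B \<subseteq> rc_closure K C"
  shows "h \<in> ovfield_iso (rc_generated K B) (rc_generated K' (h ` B))"
proof -
  let ?R = "rc_generated K C" and ?G = "rc_closure K B"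
  let ?g = "inv_into (carrier ?R) h"
  have G: "?G \<subseteq> rc_closure K C" by (rule rc_closure_least[OF rc_closure(1,2)[OF K] B])
  have bij: "bij_betw h (rc_closure K C) (rc_closure K' C')"
    using ovfield_iso_memE(5)[OF h] by (simp add: rc_generated_eq)
  have hB: "h ` B \<subseteq> rc_closure K' C'" using B bij by (auto simp: bij_betw_def)
  have "?g \<in> ovfield_iso (rc_generated K' C') ?R" by (rule ovfield_iso_sym[OF ring_rc_generated[OF K] h])
  from rc_closure_image_subset[OF K' K this hB]
  have "rc_closure K (?g ` h ` B) \<subseteq> ?g ` rc_closure K' (h ` B)" .
  moreover have "?g ` h ` B = B"
    using B bij by (simp add: rc_generated_eq bij_betw_def inv_into_image_cancel)
  ultimately have "h ` ?G \<subseteq> h ` ?g ` rc_closure K' (h ` B)" by auto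
  moreover have "rc_closure K' (h ` B) \<subseteq> rc_closure K' C'" by (rule rc_closure_least[OF rc_closure(1,2)[OF K'] hB])
  then have "h ` ?g ` rc_closure K' (h ` B) = rc_closure K' (h ` B)"
    using bij by (simp add: rc_generated_eq bij_betw_def image_inv_into_cancel)
  ultimately have im: "h ` ?G = rc_closure K' (h ` B)"
    using rc_closure_image_subset[OF K K' h B] by blast
  have bij': "bij_betw h ?G (rc_closure K' (h ` B))"
    using bij_betw_subset[OF bij G im] .
  have hG: "h x \<in> rc_closure K' (h ` B)" "h x \<in> rc_closure K' C'" if "x \<in> ?G" for x
    using that im G bij by (auto simp: bij_betw_def)
  note hi = ring_iso_memE[OF ovfield_iso_memE(1)[OF h], unfolded rc_generated_eq, simplified]
  note ho = ovfield_iso_memE(3,4)[OF h, unfolded rc_generated_eq, simplified]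
  have "h \<in> ring_iso (rc_generated K B) (rc_generated K' (h ` B))"
    unfolding rc_generated_eq by (rule ring_iso_memI) (use hi(2-4) subsetD[OF G] hG bij' in simp_all)
  then show ?thesis
    unfolding ovfield_iso_def rc_generated_eq using ho G hG by auto
qed

section \<open>Equivalence of homomorphisms and their classes\<close>

lemma rcv_homsD:
  assumes "(K, \<phi>) \<in> rcv_homs A"
  shows "real_closed_valued_field K" "real_closed_field K" "\<phi> \<in> ring_hom A K" "\<phi> ` carrier A \<subseteq> carrier K"
  using assms by (auto simp: rcv_homs_def real_closed_valued_field_def ring_hom_def)

lemma rcv_equivI:
  assumes "(K, \<phi>) \<in> rcv_homs A" "(K', \<phi>') \<in> rcv_homs A"
    "\<psi> \<in> ovfield_iso (rc_generated K (\<phi> ` carrier A)) (rc_generated K' (\<phi>' ` carrier A))"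
    "\<And>a. a \<in> carrier A \<Longrightarrow> \<psi> (\<phi> a) = \<phi>' a"
  shows "((K, \<phi>), (K', \<phi>')) \<in> rcv_equiv A"
  using assms by (auto simp: rcv_equiv_def)

lemma rcv_equivE:
  assumes "((K, \<phi>), (K', \<phi>')) \<in> rcv_equiv A"
  obtains \<psi> where "(K, \<phi>) \<in> rcv_homs A" "(K', \<phi>') \<in> rcv_homs A"
    "\<psi> \<in> ovfield_iso (rc_generated K (\<phi> ` carrier A)) (rc_generated K' (\<phi>' ` carrier A))"
    "\<And>a. a \<in> carrier A \<Longrightarrow> \<psi> (\<phi> a) = \<phi>' a"
  using assms by (auto simp: rcv_equiv_def)

text \<open>Homomorphisms are total functions; their values outside the carrier of A do not affect
  the class.\<close>

lemma rcv_equiv_cong: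
  assumes "(K, \<phi>) \<in> rcv_homs A" "(K, \<phi>') \<in> rcv_homs A" "\<And>a. a \<in> carrier A \<Longrightarrow> \<phi> a = \<phi>' a"
  shows "((K, \<phi>), (K, \<phi>')) \<in> rcv_equiv A"
proof -
  have "\<phi> ` carrier A = \<phi>' ` carrier A" using assms(3) by auto
  then show ?thesis using assms ovfield_iso_refl by (intro rcv_equivI[where \<psi> = id]) auto
qed

lemma equiv_rcv_equiv: "equiv (rcv_homs A) (rcv_equiv A)"
proof (rule equivI)
  show "rcv_equiv A \<subseteq> rcv_homs A \<times> rcv_homs A" by (auto simp: rcv_equiv_def)
  show "refl_on (rcv_homs A) (rcv_equiv A)"
    by (rule refl_onI) (auto intro: rcv_equiv_cong)
  show "sym (rcv_equiv A)"
  proof (rule symI, clarify)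
    fix K \<phi> K' \<phi>' assume "((K, \<phi>), (K', \<phi>')) \<in> rcv_equiv A"
    then obtain \<psi> where \<psi>: "(K, \<phi>) \<in> rcv_homs A" "(K', \<phi>') \<in> rcv_homs A"
      "\<psi> \<in> ovfield_iso (rc_generated K (\<phi> ` carrier A)) (rc_generated K' (\<phi>' ` carrier A))"
      "\<And>a. a \<in> carrier A \<Longrightarrow> \<psi> (\<phi> a) = \<phi>' a" by (rule rcv_equivE) blast
    note K = rcv_homsD[OF \<psi>(1)]
    let ?R = "rc_generated K (\<phi> ` carrier A)"
    have inj: "inj_on \<psi> (carrier ?R)" using ovfield_iso_memE(5)[OF \<psi>(3)] by (simp add: bij_betw_def)
    have "inv_into (carrier ?R) \<psi> (\<phi>' a) = \<phi> a" if "a \<in> carrier A" for a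
    proof -
      have "\<phi> a \<in> carrier ?R" using that rc_closure(3)[OF K(2,4)] by (auto simp: rc_generated_eq)
      from inv_into_f_f[OF inj this] show ?thesis using \<psi>(4)[OF that] by simp
    qed
    then show "((K', \<phi>'), (K, \<phi>)) \<in> rcv_equiv A"
      by (intro rcv_equivI[OF \<psi>(2,1) ovfield_iso_sym[OF ring_rc_generated[OF K(2,4)] \<psi>(3)]])
  qed
  show "trans (rcv_equiv A)"
  proof (rule transI, clarify)
    fix K \<phi> K' \<phi>' K'' \<phi>''
    assume "((K, \<phi>), (K', \<phi>')) \<in> rcv_equiv A" "((K', \<phi>'), (K'', \<phi>'')) \<in> rcv_equiv A"
    then obtain \<psi> \<psi>' where \<psi>: "(K, \<phi>) \<in> rcv_homs A" "(K', \<phi>') \<in> rcv_homs A" "(K'', \<phi>'') \<in> rcv_homs A"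
      "\<psi> \<in> ovfield_iso (rc_generated K (\<phi> ` carrier A)) (rc_generated K' (\<phi>' ` carrier A))"
      "\<And>a. a \<in> carrier A \<Longrightarrow> \<psi> (\<phi> a) = \<phi>' a"
      "\<psi>' \<in> ovfield_iso (rc_generated K' (\<phi>' ` carrier A)) (rc_generated K'' (\<phi>'' ` carrier A))"
      "\<And>a. a \<in> carrier A \<Longrightarrow> \<psi>' (\<phi>' a) = \<phi>'' a" by (elim rcv_equivE) blast
    show "((K, \<phi>), (K'', \<phi>'')) \<in> rcv_equiv A"
      using \<psi>(5,7) by (intro rcv_equivI[OF \<psi>(1,3) ovfield_iso_trans[OF \<psi>(4,6)]]) simp
  qed
qed

text \<open>The comparison \<open>vle\<close> involves an inverse taken in K. Since the generated
  ring is a field, the quotient lies in it and is carried by the isomorphism to the corresponding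
  quotient.\<close>

lemma rcv_equiv_invariant:
  assumes "((K, \<phi>), (K', \<phi>')) \<in> rcv_equiv A" "a \<in> carrier A" "b \<in> carrier A"
  shows "ole K \<zero>\<^bsub>K\<^esub> (\<phi> a) \<and> \<phi> a \<noteq> \<zero>\<^bsub>K\<^esub> \<longleftrightarrow> ole K' \<zero>\<^bsub>K'\<^esub> (\<phi>' a) \<and> \<phi>' a \<noteq> \<zero>\<^bsub>K'\<^esub>"
    "vle K (\<phi> a) (\<phi> b) \<longleftrightarrow> vle K' (\<phi>' a) (\<phi>' b)"
proof -
  obtain \<psi> where \<psi>: "(K, \<phi>) \<in> rcv_homs A" "(K', \<phi>') \<in> rcv_homs A"
    "\<psi> \<in> ovfield_iso (rc_generated K (\<phi> ` carrier A)) (rc_generated K' (\<phi>' ` carrier A))"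
    "\<And>a. a \<in> carrier A \<Longrightarrow> \<psi> (\<phi> a) = \<phi>' a" using assms(1) by (rule rcv_equivE) blast
  note HK = rcv_homsD[OF \<psi>(1)] and HK' = rcv_homsD[OF \<psi>(2)]
  interpret K: real_closed_field K by (rule HK)
  interpret K': real_closed_field K' by (rule HK')
  let ?G = "rc_closure K (\<phi> ` carrier A)"
  note G = rc_closure[OF HK(2,4)]
  have GK: "?G \<subseteq> carrier K" by (rule rc_closure_subset_carrier[OF HK(2,4)])
  have sub: "subring ?G K" by (rule subfieldE(1)[OF G(1)])
  have hom: "\<psi> \<in> ring_hom (K \<restriction>\<^sub>c ?G) K'"
    by (rule rc_generated_ring_iso_hom[OF HK'(2,4) \<psi>(3)]) simp
  interpret \<psi>: ring_hom_ring "K \<restriction>\<^sub>c ?G" K' \<psi>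
    by (intro ring_hom_ringI2 hom K'.ring_axioms K.subring_is_ring[OF sub])
  have z: "\<zero>\<^bsub>K\<^esub> \<in> ?G" "\<psi> \<zero>\<^bsub>K\<^esub> = \<zero>\<^bsub>K'\<^esub>" using \<psi>.R.zero_closed \<psi>.hom_zero by simp_all
  have inj: "inj_on \<psi> ?G" using ovfield_iso_memE(5)[OF \<psi>(3)] by (simp add: bij_betw_def rc_generated_eq)
  have aG: "\<phi> c \<in> ?G" if "c \<in> carrier A" for c using that G(3) by blast
  have nz: "\<phi> c = \<zero>\<^bsub>K\<^esub> \<longleftrightarrow> \<phi>' c = \<zero>\<^bsub>K'\<^esub>" if "c \<in> carrier A" for c
    using inj_on_eq_iff[OF inj aG[OF that] z(1)] z(2) \<psi>(4)[OF that] by simp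
  note iso = ovfield_iso_memE[OF \<psi>(3), unfolded rc_generated_eq, simplified]
  show "ole K \<zero>\<^bsub>K\<^esub> (\<phi> a) \<and> \<phi> a \<noteq> \<zero>\<^bsub>K\<^esub> \<longleftrightarrow> ole K' \<zero>\<^bsub>K'\<^esub> (\<phi>' a) \<and> \<phi>' a \<noteq> \<zero>\<^bsub>K'\<^esub>"
    using iso(3)[OF z(1) aG[OF assms(2)]] z(2) \<psi>(4)[OF assms(2)] nz[OF assms(2)] by simp
  have "\<phi> b \<otimes>\<^bsub>K\<^esub> inv\<^bsub>K\<^esub> \<phi> a \<in> vring K \<longleftrightarrow> \<phi>' b \<otimes>\<^bsub>K'\<^esub> inv\<^bsub>K'\<^esub> \<phi>' a \<in> vring K'" if "\<phi> a \<noteq> \<zero>\<^bsub>K\<^esub>"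
  proof -
    have i: "inv\<^bsub>K\<^esub> \<phi> a \<in> ?G" "\<phi> a \<otimes>\<^bsub>K\<^esub> inv\<^bsub>K\<^esub> \<phi> a = \<one>\<^bsub>K\<^esub>"
      using K.subfield_m_inv(1,2)[OF G(1), of "\<phi> a"] aG[OF assms(2)] that by auto
    have "\<psi> (\<phi> a \<otimes>\<^bsub>K\<^esub> inv\<^bsub>K\<^esub> \<phi> a) = \<psi> (\<phi> a) \<otimes>\<^bsub>K'\<^esub> \<psi> (inv\<^bsub>K\<^esub> \<phi> a)"
      using \<psi>.hom_mult[of "\<phi> a" "inv\<^bsub>K\<^esub> \<phi> a"] i(1) aG[OF assms(2)] by simp
    then have e: "\<phi>' a \<otimes>\<^bsub>K'\<^esub> \<psi> (inv\<^bsub>K\<^esub> \<phi> a) = \<one>\<^bsub>K'\<^esub>"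
      using i(2) \<psi>(4)[OF assms(2)] \<psi>.hom_one by simp
    have c: "\<phi>' a \<in> carrier K'" "\<psi> (inv\<^bsub>K\<^esub> \<phi> a) \<in> carrier K'"
      using HK'(4) assms(2) i(1) \<psi>.hom_closed by auto
    have inv: "\<psi> (inv\<^bsub>K\<^esub> \<phi> a) = inv\<^bsub>K'\<^esub> \<phi>' a" using K'.comm_inv_char[OF c e] by simp
    let ?z = "\<phi> b \<otimes>\<^bsub>K\<^esub> inv\<^bsub>K\<^esub> \<phi> a"
    have zG: "?z \<in> ?G" using subringE(6)[OF sub aG[OF assms(3)] i(1)] .
    have "\<psi> ?z = \<phi>' b \<otimes>\<^bsub>K'\<^esub> inv\<^bsub>K'\<^esub> \<phi>' a"
      using \<psi>.hom_mult[of "\<phi> b" "inv\<^bsub>K\<^esub> \<phi> a"] i(1) aG[OF assms(3)] \<psi>(4)[OF assms(3)] inv by simp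
    then show ?thesis using iso(4)[OF zG] iso(2)[OF zG] zG by simp
  qed
  then show "vle K (\<phi> a) (\<phi> b) \<longleftrightarrow> vle K' (\<phi>' a) (\<phi>' b)"
    unfolding vle_def using nz[OF assms(2)] nz[OF assms(3)] by auto
qed

abbreviation rcv_class :: "('a, 'm) ring_scheme \<Rightarrow> 'u ovring \<Rightarrow> ('a \<Rightarrow> 'u) \<Rightarrow> ('a, 'u) rcv_hom set" where
  "rcv_class A K \<phi> \<equiv> rcv_equiv A `` {(K, \<phi>)}"

lemma rcv_class_in_Sperv: "(K, \<phi>) \<in> rcv_homs A \<Longrightarrow> rcv_class A K \<phi> \<in> Sperv A"
  unfolding Sperv_def by (rule quotientI)

lemma SpervE:
  assumes "P \<in> Sperv A"
  obtains K \<phi> where "(K, \<phi>) \<in> rcv_homs A" "P = rcv_class A K \<phi>"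
  using assms unfolding Sperv_def by (elim quotientE) auto

lemma rcv_class_in_Sperv_pos_iff:
  assumes "(K, \<phi>) \<in> rcv_homs A" "a \<in> carrier A"
  shows "rcv_class A K \<phi> \<in> Sperv_pos A a \<longleftrightarrow> ole K \<zero>\<^bsub>K\<^esub> (\<phi> a) \<and> \<phi> a \<noteq> \<zero>\<^bsub>K\<^esub>"
proof -
  have "(K, \<phi>) \<in> rcv_class A K \<phi>" using equiv_class_self[OF equiv_rcv_equiv assms(1)] .
  then show ?thesis
    unfolding Sperv_pos_def using rcv_class_in_Sperv[OF assms(1)] rcv_equiv_invariant(1)[OF _ assms(2,2)] by fast
qed

lemma rcv_class_in_Sperv_vle_iff:
  assumes "(K, \<phi>) \<in> rcv_homs A" "a \<in> carrier A" "b \<in> carrier A"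
  shows "rcv_class A K \<phi> \<in> Sperv_vle A a b \<longleftrightarrow> vle K (\<phi> a) (\<phi> b)"
proof -
  have "(K, \<phi>) \<in> rcv_class A K \<phi>" using equiv_class_self[OF equiv_rcv_equiv assms(1)] .
  then show ?thesis
    unfolding Sperv_vle_def using rcv_class_in_Sperv[OF assms(1)] rcv_equiv_invariant(2)[OF _ assms(2,3)] by fast
qed

lemma constructible_subset_Sperv: "S \<in> constructible A \<Longrightarrow> S \<subseteq> Sperv A"
  by (induction rule: constructible.induct) (auto simp: Sperv_pos_def Sperv_vle_def)

lemma restrict_rcv_homs:
  assumes A: "cring A" and h: "(K, \<phi>) \<in> rcv_homs (UP A)"
  shows "(K, \<lambda>a. \<phi> (UnivPoly.monom (UP A) a 0)) \<in> rcv_homs A"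
proof -
  interpret UP_cring A "UP A" using A by (simp add: UP_cring_def)
  show ?thesis
    using ring_hom_trans[OF const_ring_hom rcv_homsD(3)[OF h]] rcv_homsD(1)[OF h] by (simp add: rcv_homs_def comp_def)
qed

lemma Sperv_restrict_rcv_class:
  assumes A: "cring A" and h: "(K, \<phi>) \<in> rcv_homs (UP A)"
  shows "Sperv_restrict A (rcv_class (UP A) K \<phi>) = rcv_class A K (\<lambda>a. \<phi> (UnivPoly.monom (UP A) a 0))"
proof -
  interpret UP_cring A "UP A" using A by (simp add: UP_cring_def)
  let ?r = "\<lambda>\<phi> a. \<phi> (UnivPoly.monom (UP A) a 0)"
  have *: "((K, ?r \<phi>), (K', ?r \<phi>')) \<in> rcv_equiv A" if e: "((K, \<phi>), (K', \<phi>')) \<in> rcv_equiv (UP A)" for K' \<phi>'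
  proof -
    obtain \<psi> where \<psi>: "(K, \<phi>) \<in> rcv_homs (UP A)" "(K', \<phi>') \<in> rcv_homs (UP A)"
      "\<psi> \<in> ovfield_iso (rc_generated K (\<phi> ` carrier (UP A))) (rc_generated K' (\<phi>' ` carrier (UP A)))"
      "\<And>a. a \<in> carrier (UP A) \<Longrightarrow> \<psi> (\<phi> a) = \<phi>' a" using e by (rule rcv_equivE) blast
    note HK = rcv_homsD[OF \<psi>(1)] and HK' = rcv_homsD[OF \<psi>(2)]
    have B: "?r \<phi> ` carrier A \<subseteq> rc_closure K (\<phi> ` carrier (UP A))" using rc_closure(3)[OF HK(2,4)] by auto
    have "\<psi> ` ?r \<phi> ` carrier A = ?r \<phi>' ` carrier A" unfolding image_image using \<psi>(4) by (intro image_cong) auto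
    with ovfield_iso_restrict[OF HK(2,4) HK'(2,4) \<psi>(3) B] \<psi>(4) show ?thesis
      by (intro rcv_equivI[where \<psi> = \<psi>] restrict_rcv_homs[OF A] \<psi>(1,2)) auto
  qed
  have "rcv_class A K' (?r \<phi>') = rcv_class A K (?r \<phi>)" if "(K', \<phi>') \<in> rcv_class (UP A) K \<phi>" for K' \<phi>'
    using equiv_class_eq[OF equiv_rcv_equiv *] that by simp
  then have **: "(case x of (K', \<phi>') \<Rightarrow> rcv_class A K' (?r \<phi>')) = rcv_class A K (?r \<phi>)"
    if "x \<in> rcv_class (UP A) K \<phi>" for x
    using that by (cases x) (simp only: prod.case)
  have "(K, \<phi>) \<in> rcv_class (UP A) K \<phi>" using equiv_class_self[OF equiv_rcv_equiv h] .
  then show ?thesis unfolding Sperv_restrict_def by (rule UN_constant_eq) (intro ballI **)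
qed

subsection \<open>Constructible sets and formulas\<close>

text \<open>Parameters range over a type, but only elements of the carrier have a meaning.\<close>
definition clip :: "('a, 'm) ring_scheme \<Rightarrow> 'a \<Rightarrow> 'a" where
  "clip A a = (if a \<in> carrier A then a else \<zero>\<^bsub>A\<^esub>)"

lemma range_clip: "ring A \<Longrightarrow> range (clip A) \<subseteq> carrier A"
  by (auto simp: clip_def intro: abelian_monoid.zero_closed abelian_group.axioms(1) ring.is_abelian_group)

lemma constructible_Int:
  assumes "S \<in> constructible A" "T \<in> constructible A"
  shows "S \<inter> T \<in> constructible A"
proof -
  have "S \<inter> T = Sperv A - ((Sperv A - S) \<union> (Sperv A - T))"
    using constructible_subset_Sperv[OF assms(1)] by blast
  then show ?thesis using assms by (simp add: constructible.compl constructible.union)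
qed

text \<open>With all variables zero, a term can be evaluated in A before the homomorphism is
  applied. An atom of the formula thus becomes an elementary constructible set, uniformly in
  K.\<close>

lemma formula_constructible:
  assumes A: "cring A" and f: "qf (f :: 'a fm)"
  shows "\<exists>S\<in>constructible A. \<forall>K \<phi>. (K, \<phi>) \<in> (rcv_homs A :: ('a, 'u) rcv_hom set) \<longrightarrow>
    (rcv_class A K \<phi> \<in> S \<longleftrightarrow> kholds K (\<phi> \<circ> clip A) (\<lambda>_. \<zero>\<^bsub>K\<^esub>) f)"
  using f
proof (induction f)
  interpret A: cring A by (rule A)
  have rng: "range (clip A) \<subseteq> carrier A" "range (\<lambda>_::nat. \<zero>\<^bsub>A\<^esub>) \<subseteq> carrier A"
    using range_clip[OF A.ring_axioms] by auto
  define c where "c = kev A (clip A) (\<lambda>_. \<zero>\<^bsub>A\<^esub>)"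
  have c: "c t \<in> carrier A" for t unfolding c_def by (rule kev_closed[OF A.ring_axioms rng])
  have ev: "kev K (\<phi> \<circ> clip A) (\<lambda>_. \<zero>\<^bsub>K\<^esub>) t = \<phi> (c t)"
    if h: "(K, \<phi>) \<in> (rcv_homs A :: ('a, 'u) rcv_hom set)" for K \<phi> t
  proof -
    interpret K: real_closed_field K by (rule rcv_homsD[OF h])
    interpret \<phi>: ring_hom_ring A K \<phi>
      by (intro ring_hom_ringI2 A.ring_axioms K.ring_axioms rcv_homsD(3)[OF h])
    show ?thesis
      using kev_hom[OF A.ring_axioms K.ring_axioms rcv_homsD(3)[OF h] rng, of t] \<phi>.hom_zero
      by (simp add: c_def comp_def)
  qed
  have cls: "rcv_class A K \<phi> \<in> Sperv A" if "(K, \<phi>) \<in> (rcv_homs A :: ('a, 'u) rcv_hom set)" for K \<phi>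
    by (rule rcv_class_in_Sperv[OF that])
  {
    case FTrue
    \<comment> \<open>The whole spectrum, written as the union of a constructible set and its
      complement.\<close>
    have "Sperv_pos A \<zero>\<^bsub>A\<^esub> \<union> (Sperv A - Sperv_pos A \<zero>\<^bsub>A\<^esub>) \<in> constructible A"
      by (intro constructible.intros) simp_all
    then show ?case by (rule rev_bexI) (use cls in simp)
  next
    case (Pos t)
    show ?case
      by (intro bexI[of _ "Sperv_pos A (c t)"] constructible.pos c allI impI)
        (simp only: kholds.simps ev rcv_class_in_Sperv_pos_iff[OF _ c])
  next
    case (Vle s t)
    show ?case
      by (intro bexI[of _ "Sperv_vle A (c s) (c t)"] constructible.vle c allI impI)
        (simp only: kholds.simps ev rcv_class_in_Sperv_vle_iff[OF _ c c])
  next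
    case (FNot f)
    from FNot.IH FNot.prems[unfolded qf.simps] obtain S where S: "S \<in> constructible A" "\<And>K \<phi>. (K, \<phi>) \<in> (rcv_homs A :: ('a, 'u) rcv_hom set) \<Longrightarrow>
      rcv_class A K \<phi> \<in> S \<longleftrightarrow> kholds K (\<phi> \<circ> clip A) (\<lambda>_. \<zero>\<^bsub>K\<^esub>) f" by blast
    show ?case by (intro bexI[OF _ constructible.compl[OF S(1)]] allI impI) (simp only: kholds.simps Diff_iff cls S(2) simp_thms)
  next
    case (FAnd f g)
    from FAnd.IH FAnd.prems[unfolded qf.simps] obtain S T where S: "S \<in> constructible A" "\<And>K \<phi>. (K, \<phi>) \<in> (rcv_homs A :: ('a, 'u) rcv_hom set) \<Longrightarrow>
      rcv_class A K \<phi> \<in> S \<longleftrightarrow> kholds K (\<phi> \<circ> clip A) (\<lambda>_. \<zero>\<^bsub>K\<^esub>) f"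
      and T: "T \<in> constructible A" "\<And>K \<phi>. (K, \<phi>) \<in> (rcv_homs A :: ('a, 'u) rcv_hom set) \<Longrightarrow>
      rcv_class A K \<phi> \<in> T \<longleftrightarrow> kholds K (\<phi> \<circ> clip A) (\<lambda>_. \<zero>\<^bsub>K\<^esub>) g" by blast
    show ?case by (intro bexI[OF _ constructible_Int[OF S(1) T(1)]] allI impI) (simp only: kholds.simps Int_iff S(2) T(2))
  next
    case (FEx n f)
    then show ?case by simp
  }
qed

text \<open>With the indeterminate as \<open>TVar 0\<close> and the coefficients as parameters, a
  formula about elements of A[X] becomes one over A in a single variable.\<close>

lemma polynomial_is_term:
  assumes A: "cring A" and p: "p \<in> carrier (UP A)"
  shows "\<exists>t. kev (UP A) (\<lambda>a. UnivPoly.monom (UP A) (clip A a) 0)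
    ((\<lambda>_. \<zero>\<^bsub>UP A\<^esub>)(0 := UnivPoly.monom (UP A) \<one>\<^bsub>A\<^esub> 1)) t = p"
proof -
  interpret UP_cring A "UP A" using A by (simp add: UP_cring_def)
  define e :: "nat \<Rightarrow> nat \<Rightarrow> 'a" where "e = (\<lambda>_. \<zero>\<^bsub>UP A\<^esub>)(0 := UnivPoly.monom (UP A) \<one>\<^bsub>A\<^esub> 1)"
  have e0: "e 0 = UnivPoly.monom (UP A) \<one>\<^bsub>A\<^esub> 1" by (simp add: e_def)
  let ?ev = "kev (UP A) (\<lambda>a. UnivPoly.monom (UP A) (clip A a) 0) e"
  have monom: "\<exists>t. ?ev t = UnivPoly.monom (UP A) a i" if a: "a \<in> carrier A" for a i
  proof (induction i)
    case 0
    show ?case using a by (intro exI[of _ "TPar a"]) (simp add: clip_def)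
  next
    case (Suc i)
    then obtain t where "?ev t = UnivPoly.monom (UP A) a i" by blast
    then have "?ev (TMul t (TVar 0)) = UnivPoly.monom (UP A) a (Suc i)"
      using monom_mult[OF a R.one_closed, of i 1] a by (simp add: e0 del: monom_mult)
    then show ?case by blast
  qed
  have "\<exists>t. ?ev t = (\<Oplus>\<^bsub>UP A\<^esub>i\<in>{..n}. UnivPoly.monom (UP A) (UnivPoly.coeff (UP A) p i) i)" for n :: nat
  proof (induction n)
    case 0
    show ?case using monom[of "UnivPoly.coeff (UP A) p 0" 0] p by simp
  next
    case (Suc n)
    then obtain t where t: "?ev t = (\<Oplus>\<^bsub>UP A\<^esub>i\<in>{..n}. UnivPoly.monom (UP A) (UnivPoly.coeff (UP A) p i) i)" by blast
    obtain s where s: "?ev s = UnivPoly.monom (UP A) (UnivPoly.coeff (UP A) p (Suc n)) (Suc n)"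
      using monom[OF coeff_closed[OF p]] by blast
    have "?ev (TAdd s t) = (\<Oplus>\<^bsub>UP A\<^esub>i\<in>{..Suc n}. UnivPoly.monom (UP A) (UnivPoly.coeff (UP A) p i) i)"
      unfolding kev.simps s t using p by (simp add: Pi_def)
    then show ?case by blast
  qed
  from this[of "deg A p"] show ?thesis unfolding up_repr[OF p] e_def .
qed

lemma constructible_formula:
  assumes A: "cring A" and S: "S \<in> constructible (UP A)"
  shows "\<exists>f. qf f \<and> (\<forall>K \<phi>. (K, \<phi>) \<in> (rcv_homs (UP A) :: (nat \<Rightarrow> 'a, 'u) rcv_hom set) \<longrightarrow>
    (rcv_class (UP A) K \<phi> \<in> S \<longleftrightarrow> kholds K (\<lambda>a. \<phi> (UnivPoly.monom (UP A) (clip A a) 0))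
      ((\<lambda>_. \<zero>\<^bsub>K\<^esub>)(0 := \<phi> (UnivPoly.monom (UP A) \<one>\<^bsub>A\<^esub> 1))) f))"
  using S
proof (induction rule: constructible.induct)
  interpret UP_cring A "UP A" using A by (simp add: UP_cring_def)
  let ?X = "UnivPoly.monom (UP A) \<one>\<^bsub>A\<^esub> 1"
  let ?e = "(\<lambda>_. \<zero>\<^bsub>UP A\<^esub>)(0 := ?X) :: nat \<Rightarrow> _"
  let ?c = "\<lambda>a. UnivPoly.monom (UP A) (clip A a) 0"
  have rng: "range ?c \<subseteq> carrier (UP A)" "range ?e \<subseteq> carrier (UP A)"
    using range_clip[OF R.ring_axioms] by auto
  have tm: "\<exists>t. \<forall>K \<phi>. (K, \<phi>) \<in> (rcv_homs (UP A) :: (nat \<Rightarrow> 'a, 'u) rcv_hom set) \<longrightarrow>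
    kev K (\<lambda>a. \<phi> (?c a)) ((\<lambda>_. \<zero>\<^bsub>K\<^esub>)(0 := \<phi> ?X)) t = \<phi> p" if p: "p \<in> carrier (UP A)" for p
  proof -
    obtain t where t: "kev (UP A) ?c ?e t = p" using polynomial_is_term[OF A p] by blast
    have "kev K (\<lambda>a. \<phi> (?c a)) ((\<lambda>_. \<zero>\<^bsub>K\<^esub>)(0 := \<phi> ?X)) t = \<phi> p"
      if h: "(K, \<phi>) \<in> (rcv_homs (UP A) :: (nat \<Rightarrow> 'a, 'u) rcv_hom set)" for K \<phi>
    proof -
      interpret K: real_closed_field K by (rule rcv_homsD[OF h])
      interpret \<phi>: ring_hom_ring "UP A" K \<phi>
        by (intro ring_hom_ringI2 P.ring_axioms K.ring_axioms rcv_homsD(3)[OF h])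
      have e: "\<phi> \<circ> ?e = (\<lambda>_. \<zero>\<^bsub>K\<^esub>)(0 := \<phi> ?X)" "\<phi> \<circ> ?c = (\<lambda>a. \<phi> (?c a))"
        using \<phi>.hom_zero by (auto simp: fun_eq_iff)
      show ?thesis
        using kev_hom[OF P.ring_axioms K.ring_axioms rcv_homsD(3)[OF h] rng, of t] unfolding e t by (rule sym)
    qed
    then show ?thesis by blast
  qed
  {
    case (pos p)
    obtain t where "\<And>K \<phi>. (K, \<phi>) \<in> (rcv_homs (UP A) :: (nat \<Rightarrow> 'a, 'u) rcv_hom set) \<Longrightarrow>
      kev K (\<lambda>a. \<phi> (?c a)) ((\<lambda>_. \<zero>\<^bsub>K\<^esub>)(0 := \<phi> ?X)) t = \<phi> p" using tm[OF pos] by blast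
    then show ?case
      by (intro exI[of _ "Pos t"] conjI allI impI)
        (simp_all only: qf.simps kholds.simps rcv_class_in_Sperv_pos_iff[OF _ pos])
  next
    case (vle p q)
    obtain s t where "\<And>K \<phi>. (K, \<phi>) \<in> (rcv_homs (UP A) :: (nat \<Rightarrow> 'a, 'u) rcv_hom set) \<Longrightarrow>
      kev K (\<lambda>a. \<phi> (?c a)) ((\<lambda>_. \<zero>\<^bsub>K\<^esub>)(0 := \<phi> ?X)) s = \<phi> p"
      "\<And>K \<phi>. (K, \<phi>) \<in> (rcv_homs (UP A) :: (nat \<Rightarrow> 'a, 'u) rcv_hom set) \<Longrightarrow>
      kev K (\<lambda>a. \<phi> (?c a)) ((\<lambda>_. \<zero>\<^bsub>K\<^esub>)(0 := \<phi> ?X)) t = \<phi> q" using tm[OF vle(1)] tm[OF vle(2)] by blast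
    then show ?case
      by (intro exI[of _ "Vle s t"] conjI allI impI)
        (simp_all only: qf.simps kholds.simps rcv_class_in_Sperv_vle_iff[OF _ vle])
  next
    case (compl S)
    then obtain f where f: "qf f" "\<And>K \<phi>. (K, \<phi>) \<in> (rcv_homs (UP A) :: (nat \<Rightarrow> 'a, 'u) rcv_hom set) \<Longrightarrow>
      rcv_class (UP A) K \<phi> \<in> S \<longleftrightarrow> kholds K (\<lambda>a. \<phi> (?c a)) ((\<lambda>_. \<zero>\<^bsub>K\<^esub>)(0 := \<phi> ?X)) f" by blast
    then show ?case
      by (intro exI[of _ "FNot f"] conjI allI impI)
        (simp_all only: qf.simps kholds.simps Diff_iff rcv_class_in_Sperv simp_thms)
  next
    case (union S T)
    then obtain f g where f: "qf f" "\<And>K \<phi>. (K, \<phi>) \<in> (rcv_homs (UP A) :: (nat \<Rightarrow> 'a, 'u) rcv_hom set) \<Longrightarrow>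
      rcv_class (UP A) K \<phi> \<in> S \<longleftrightarrow> kholds K (\<lambda>a. \<phi> (?c a)) ((\<lambda>_. \<zero>\<^bsub>K\<^esub>)(0 := \<phi> ?X)) f"
      and g: "qf g" "\<And>K \<phi>. (K, \<phi>) \<in> (rcv_homs (UP A) :: (nat \<Rightarrow> 'a, 'u) rcv_hom set) \<Longrightarrow>
      rcv_class (UP A) K \<phi> \<in> T \<longleftrightarrow> kholds K (\<lambda>a. \<phi> (?c a)) ((\<lambda>_. \<zero>\<^bsub>K\<^esub>)(0 := \<phi> ?X)) g" by blast
    show ?case
      by (intro exI[of _ "FOr f g"] conjI allI impI)
        (simp_all only: FOr_def qf.simps kholds.simps Un_iff f g simp_thms de_Morgan_conj)
  }
qed

theorem theorem3p3p2:
  fixes A :: "('a, 'm) ring_scheme"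
    and S :: "(nat \<Rightarrow> 'a, 'u) rcv_hom set set"
  assumes "cring A"
    and "S \<in> constructible (UP A)"
  shows "Sperv_restrict A ` S \<in> constructible A"
proof -
  interpret UP_cring A "UP A" using assms(1) by (simp add: UP_cring_def)
  let ?X = "UnivPoly.monom (UP A) \<one>\<^bsub>A\<^esub> 1"
  obtain f where f: "qf f" "\<And>K \<phi>. (K, \<phi>) \<in> (rcv_homs (UP A) :: (nat \<Rightarrow> 'a, 'u) rcv_hom set) \<Longrightarrow>
    rcv_class (UP A) K \<phi> \<in> S \<longleftrightarrow> kholds K (\<lambda>a. \<phi> (UnivPoly.monom (UP A) (clip A a) 0))
      ((\<lambda>_. \<zero>\<^bsub>K\<^esub>)(0 := \<phi> ?X)) f"
    using constructible_formula[OF assms] by blast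
  obtain T where T: "T \<in> constructible A" "\<And>K \<phi>. (K, \<phi>) \<in> (rcv_homs A :: ('a, 'u) rcv_hom set) \<Longrightarrow>
    rcv_class A K \<phi> \<in> T \<longleftrightarrow> kholds K (\<phi> \<circ> clip A) (\<lambda>_. \<zero>\<^bsub>K\<^esub>) (vqe f)"
    using formula_constructible[OF assms(1) qf_vqe, of f] by blast
  \<comment> \<open>The formula defining \<open>T\<close> is quantifier-free, so membership may be
    tested on any representative. Elimination turns it into solvability in the target field of that
    representative.\<close>
  have qe: "rcv_class A K \<phi> \<in> T \<longleftrightarrow> (\<exists>x\<in>carrier K. kholds K (\<phi> \<circ> clip A) ((\<lambda>_. \<zero>\<^bsub>K\<^esub>)(0 := x)) f)"
    if h: "(K, \<phi>) \<in> rcv_homs A" for K :: "'u ovring" and \<phi>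
  proof -
    interpret K: real_closed_field K by (rule rcv_homsD[OF h])
    have "range (\<phi> \<circ> clip A) \<subseteq> carrier K" "range (\<lambda>_::nat. \<zero>\<^bsub>K\<^esub>) \<subseteq> carrier K"
      using range_clip[OF R.ring_axioms] rcv_homsD(4)[OF h] by auto
    with real_closed_field_admits_qe[OF rcv_homsD(2)[OF h], where 'a = 'a] rcv_homsD(1)[OF h] f(1)
    show ?thesis unfolding admits_qe_def T(2)[OF h] by blast
  qed
  have "Sperv_restrict A ` S = T"
  proof
    show "Sperv_restrict A ` S \<subseteq> T"
    proof
      fix Q assume "Q \<in> Sperv_restrict A ` S"
      then obtain P where P: "P \<in> S" "Q = Sperv_restrict A P" by blast
      then obtain K \<phi> where h: "(K, \<phi>) \<in> rcv_homs (UP A)" "P = rcv_class (UP A) K \<phi>"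
        using constructible_subset_Sperv[OF assms(2)] by (blast elim: SpervE)
      let ?\<phi> = "\<lambda>a. \<phi> (UnivPoly.monom (UP A) a 0)"
      have "\<phi> ?X \<in> carrier K" using rcv_homsD(4)[OF h(1)] by auto
      moreover have "kholds K (?\<phi> \<circ> clip A) ((\<lambda>_. \<zero>\<^bsub>K\<^esub>)(0 := \<phi> ?X)) f"
        using f(2)[OF h(1)] P(1) unfolding h(2) comp_def by (simp only:)
      ultimately have "rcv_class A K ?\<phi> \<in> T"
        unfolding qe[OF restrict_rcv_homs[OF assms(1) h(1)]] by (rule rev_bexI)
      then show "Q \<in> T" unfolding P(2) h(2) Sperv_restrict_rcv_class[OF assms(1) h(1)] .
    qed
    show "T \<subseteq> Sperv_restrict A ` S"
    proof
      fix Q assume Q: "Q \<in> T"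
      then obtain K \<phi> where h: "(K, \<phi>) \<in> rcv_homs A" "Q = rcv_class A K \<phi>"
        using constructible_subset_Sperv[OF T(1)] by (blast elim: SpervE)
      interpret K: real_closed_field K by (rule rcv_homsD[OF h(1)])
      \<comment> \<open>The solution lies in the target field K of the given representative, so
        evaluation of the indeterminate at x yields a point above with the same K, where the
        valuation is nontrivial.\<close>
      obtain x where x: "x \<in> carrier K" "kholds K (\<phi> \<circ> clip A) ((\<lambda>_. \<zero>\<^bsub>K\<^esub>)(0 := x)) f"
        using qe[OF h(1)] Q unfolding h(2) by blast
      interpret E: UP_pre_univ_prop A K \<phi> "UP A"
        by (intro UP_pre_univ_propI assms(1) K.is_cring rcv_homsD(3)[OF h(1)])
      let ?\<phi> = "UnivPoly.eval A K \<phi> x"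
      have h': "(K, ?\<phi>) \<in> rcv_homs (UP A)"
        using E.eval_ring_hom[OF x(1)] rcv_homsD(1)[OF h(1)] by (simp add: rcv_homs_def)
      have "(\<lambda>a. ?\<phi> (UnivPoly.monom (UP A) (clip A a) 0)) = \<phi> \<circ> clip A"
        using E.eval_const[OF x(1)] range_clip[OF R.ring_axioms] by (auto simp: fun_eq_iff image_subset_iff)
      moreover have "?\<phi> ?X = x" by (rule E.eval_monom1[OF x(1)])
      ultimately have S: "rcv_class (UP A) K ?\<phi> \<in> S" using f(2)[OF h'] x(2) by (simp only:)
      have "Sperv_restrict A (rcv_class (UP A) K ?\<phi>) = rcv_class A K (\<lambda>a. ?\<phi> (UnivPoly.monom (UP A) a 0))"
        by (rule Sperv_restrict_rcv_class[OF assms(1) h'])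
      also have "\<dots> = rcv_class A K \<phi>"
        using E.eval_const[OF x(1)]
        by (intro equiv_class_eq[OF equiv_rcv_equiv] rcv_equiv_cong restrict_rcv_homs[OF assms(1) h'] h(1)) auto
      finally show "Q \<in> Sperv_restrict A ` S" using S unfolding h(2) by blast
    qed
  qed
  then show ?thesis using T(1) by simp
qed

end
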